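(* Let $m,n\ge1$ be integers, let $1<p_i<\infty$ for $i=1,\dots,m$, let $\frac1p=\frac1{p_1}+\dots+\frac1{p_m}$, and put $\vec P=(p_1,\dots,p_m)$. Let $\alpha=\alpha(p_1,\dots,p_m)$ denote the best possible (smallest) power in $$\|\mathcal M(\vec f\,)\|_{L^p(\nu_{\vec w})}\le C\,[\vec w]_{A_{\vec P}}^{\alpha}\prod_{i=1}^m\|f_i\|_{L^{p_i}(w_i)};$$ that is, $\alpha=\inf E$, where $E$ is the set of real exponents for which this inequality holds for all $\vec w\in A_{\vec P}$ and all $\vec f=(f_1,\dots,f_m)$ with measurable entries, with a finite constant $C$ that may depend on $n,m,\vec P$ and the exponent but not on $\vec w$ or $\vec f$. Then: (i) for all $1<p_1,\dots,p_m<\infty$, $\displaystyle \frac{m}{mp-1}\le\alpha\le\frac1p\Big(1+\sum_{i=1}^m\frac1{p_i-1}\Big)$, and the exponent on the right belongs to $E$; (ii) if $p_1=p_2=\dots=p_m=r>1$, then $\alpha=\frac{m}{r-1}$, and this exponent belongs to $E$.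
   Context: Work in $\mathbb R^n$; cubes have sides parallel to the axes. A weight is a measurable function $w$ on $\mathbb R^n$ with $0<w<\infty$ a.e.; $\|f\|_{L^q(w)}=(\int_{\mathbb R^n}|f|^q w)^{1/q}$ for $0<q<\infty$. For $1<q<\infty$, $q'=q/(q-1)$. The multi(sub)linear maximal operator is $\mathcal M(\vec f\,)(x)=\sup_{Q\ni x}\prod_{i=1}^m\frac1{|Q|}\int_Q|f_i(y_i)|\,dy_i$, the supremum over all cubes $Q$ containing $x$. For an $m$-tuple of weights $\vec w=(w_1,\dots,w_m)$ put $\nu_{\vec w}=\prod_{i=1}^m w_i^{p/p_i}$ and $$[\vec w]_{A_{\vec P}}=\sup_Q\Big(\frac1{|Q|}\int_Q\nu_{\vec w}\Big)\prod_{i=1}^m\Big(\frac1{|Q|}\int_Q w_i^{1-p_i'}\Big)^{p/p_i'},$$ the supremum over all cubes $Q$; $\vec w\in A_{\vec P}$ means $[\vec w]_{A_{\vec P}}<\infty$. *)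

theory Defs
  imports "HOL-Analysis.Analysis"
begin

text \<open>
  Everything is valued in \<^typ>\<open>ennreal\<close>, so that integrals, suprema and norms exist without side
  conditions; as usual in measure theory, \<open>0 * \<infinity> = 0\<close>. The dimension \<open>n\<close> is \<open>CARD('n)\<close>, and an
  \<open>m\<close>-tuple is a function on \<^typ>\<open>nat\<close> of which only the values at \<open>1, \<dots>, m\<close> are used.
\<close>

text \<open>Real powers of extended nonnegative reals. Unlike for \<^term>\<open>(powr)\<close> on the reals, \<open>0\<close> to a
  negative power is \<open>\<infinity>\<close> and \<open>0\<close> to the power \<open>0\<close> is \<open>1\<close>.\<close>

definition ennpow :: "ennreal \<Rightarrow> real \<Rightarrow> ennreal" where
  "ennpow x a =
     (if a = 0 then 1
      else if x = 0 then (if a > 0 then 0 else \<infinity>)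
      else if x = \<infinity> then (if a > 0 then \<infinity> else 0)
      else ennreal (enn2real x powr a))"

definition conj_exponent :: "real \<Rightarrow> real" where
  "conj_exponent q = q / (q - 1)"

text \<open>Nondegenerate closed cubes with sides parallel to the axes.\<close>

definition cubes :: "(real ^ 'n) set set" where
  "cubes = {cbox a (\<chi> i. a $ i + l) | a l. l > 0}"

definition average :: "(real ^ 'n) set \<Rightarrow> (real ^ 'n \<Rightarrow> ennreal) \<Rightarrow> ennreal" where
  "average Q g = (\<integral>\<^sup>+ x \<in> Q. g x \<partial>lebesgue) / emeasure lebesgue Q"

definition weight :: "(real ^ 'n \<Rightarrow> ennreal) \<Rightarrow> bool" where
  "weight w \<longleftrightarrow> w \<in> borel_measurable lebesgue \<and> (AE x in lebesgue. 0 < w x \<and> w x < \<infinity>)"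

definition weighted_norm :: "real \<Rightarrow> (real ^ 'n \<Rightarrow> ennreal) \<Rightarrow> (real ^ 'n \<Rightarrow> ennreal) \<Rightarrow> ennreal" where
  "weighted_norm q w g = ennpow (\<integral>\<^sup>+ x. ennpow (g x) q * w x \<partial>lebesgue) (1 / q)"

definition multi_maximal :: "nat \<Rightarrow> (nat \<Rightarrow> real ^ 'n \<Rightarrow> complex) \<Rightarrow> real ^ 'n \<Rightarrow> ennreal" where
  "multi_maximal m f x =
     (SUP Q \<in> {Q \<in> cubes. x \<in> Q}. \<Prod>i = 1..m. average Q (\<lambda>y. ennreal (norm (f i y))))"

text \<open>In the following definitions \<open>P i\<close> is \<open>p\<^sub>i\<close>, and \<open>p\<close> is meant to satisfy
  \<open>1 / p = 1 / P 1 + \<dots> + 1 / P m\<close>.\<close>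

definition product_weight ::
    "nat \<Rightarrow> real \<Rightarrow> (nat \<Rightarrow> real) \<Rightarrow> (nat \<Rightarrow> real ^ 'n \<Rightarrow> ennreal) \<Rightarrow> real ^ 'n \<Rightarrow> ennreal" where
  "product_weight m p P w x = (\<Prod>i = 1..m. ennpow (w i x) (p / P i))"

definition AP_const ::
    "nat \<Rightarrow> real \<Rightarrow> (nat \<Rightarrow> real) \<Rightarrow> (nat \<Rightarrow> real ^ 'n \<Rightarrow> ennreal) \<Rightarrow> ennreal" where
  "AP_const m p P w =
     (SUP Q \<in> cubes. average Q (product_weight m p P w) *
        (\<Prod>i = 1..m. ennpow (average Q (\<lambda>x. ennpow (w i x) (1 - conj_exponent (P i))))
                          (p / conj_exponent (P i))))"

definition AP_weights ::
    "nat \<Rightarrow> real \<Rightarrow> (nat \<Rightarrow> real) \<Rightarrow> (nat \<Rightarrow> real ^ 'n \<Rightarrow> ennreal) set" where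
  "AP_weights m p P = {w. (\<forall>i \<in> {1..m}. weight (w i)) \<and> AP_const m p P w < \<infinity>}"

text \<open>The set \<open>E\<close> of exponents for which the weighted inequality holds; the argument of type
  \<^typ>\<open>'n itself\<close> records the dimension.\<close>

definition admissible_exponents ::
    "'n::finite itself \<Rightarrow> nat \<Rightarrow> real \<Rightarrow> (nat \<Rightarrow> real) \<Rightarrow> real set" where
  "admissible_exponents _ m p P =
     {\<beta>. \<exists>C::real. \<forall>w \<in> AP_weights m p P. \<forall>f :: nat \<Rightarrow> real ^ 'n \<Rightarrow> complex.
        (\<forall>i \<in> {1..m}. f i \<in> borel_measurable lebesgue) \<longrightarrow>
        weighted_norm p (product_weight m p P w) (multi_maximal m f)
          \<le> ennreal C * ennpow (AP_const m p P w) \<beta> *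
            (\<Prod>i = 1..m. weighted_norm (P i) (w i) (\<lambda>x. ennreal (norm (f i x))))}"

text \<open>The infimum is taken in \<^typ>\<open>ereal\<close>, where it is meaningful also for sets that are empty or
  unbounded below.\<close>

definition best_exponent :: "'n::finite itself \<Rightarrow> nat \<Rightarrow> real \<Rightarrow> (nat \<Rightarrow> real) \<Rightarrow> ereal" where
  "best_exponent N m p P = (INF \<beta> \<in> admissible_exponents N m p P. ereal \<beta>)"

end

theory Submission
  imports Defs
begin

text \<open>
Throughout, \<open>\<sigma>\<^sub>i = w\<^sub>i\<close> to the power \<open>1 - p\<^sub>i'\<close> is the dual weight of \<open>w\<^sub>i\<close>, \<open>g\<^sub>i = f\<^sub>i / \<sigma>\<^sub>i\<close>,
\<open>\<nu>\<close> is the joint weight, and \<open>[w]\<close> is the constant of the weights.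

Upper bounds. By the one-third trick every cube lies in a cell of comparable size of one of
\<open>2^n\<close> translates of a dyadic grid whose largest cells are as large as desired, so Fatou's lemma reduces
the claim to dyadic maximal operators, uniformly in the top scale and in the translation
(\<open>multi_maximal_le_grids\<close>). Of a dyadic grid only this is used: its generations are nested countable
partitions into cells of positive finite measure. In that setting the maximal function of \<^emph>\<open>any\<close>
measure \<open>\<sigma>\<close> is bounded on \<open>L\<^sup>q(\<sigma>)\<close> with a constant depending on \<open>q\<close> alone
(\<open>cell_maximal_strong_type\<close>, Doob's inequality). The mean of \<open>f\<^sub>i\<close> over a cell \<open>Q\<close> is the mean of
\<open>g\<^sub>i\<close> with respect to \<open>\<sigma>\<^sub>i\<close> times the mean of \<open>\<sigma>\<^sub>i\<close>, and the weight condition controls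
the means of the \<open>\<sigma>\<^sub>i\<close>.

For the mixed exponent, let \<open>F(Q)\<close> be the product of the means of the \<open>f\<^sub>i\<close>. Selecting a cell
whenever \<open>F\<close> has grown by a fixed factor since the last selected ancestor gives a sparse family: each
selected \<open>Q\<close> keeps a part \<open>E\<^sub>Q\<close> of at least half its measure, these parts are disjoint, and the
maximal function is at most a constant times the largest \<open>F(Q)\<close> over the selected cells around the point
(\<open>sparse_domination\<close>). The weight condition bounds \<open>F(Q)^p \<nu>(Q)\<close> by \<open>[w]\<close> times a product of powers
with exponents \<open>p / p\<^sub>i\<close>, which add up to one, so Hoelder's inequality over the family separates the
indices. Since \<open>\<nu>\<close> and the \<open>\<sigma>\<^sub>i\<close>, raised to suitable powers, multiply to one, the
weight condition also forces \<open>\<sigma>\<^sub>i(Q)\<close> to be at most a constant times \<open>[w]\<close> to the power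
\<open>p\<^sub>i' / p\<close> times \<open>\<sigma>\<^sub>i(E\<^sub>Q)\<close> (\<open>balanced_weights_measure_comparison\<close>); by disjointness the sums
are then dominated by the maximal functions of the \<open>\<sigma>\<^sub>i\<close> (\<open>carleson_embedding\<close>). The powers of \<open>[w]\<close>
in the bound for the \<open>p\<close>-th power of the norm are \<open>1\<close> and \<open>p\<^sub>i' / p\<^sub>i = 1 / (p\<^sub>i - 1)\<close> for each \<open>i\<close>.

If all \<open>p\<^sub>i\<close> equal \<open>r\<close>, all exponents in the weight condition agree and no family of cells is needed:
\<open>F(Q)\<close> to the power \<open>(r - 1) / m\<close> is at most \<open>[w]\<close> times the \<open>\<nu>\<close>-mean over \<open>Q\<close> of a function built from the
maximal functions of the \<open>\<sigma>\<^sub>i\<close>, and the maximal function of \<open>\<nu>\<close> is bounded on \<open>L\<close> with exponent \<open>r'\<close>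
(\<open>multilinear_cell_maximal_diagonal_bound\<close>). The only power of \<open>[w]\<close> in the resulting bound for the
\<open>p\<close>-th power of the norm is \<open>r'\<close>, and \<open>r' / p = m / (r - 1)\<close>.

Lower bound. Let \<open>w\<^sub>i\<close> be the power of \<open>\<bar>x\<^sub>j\<bar>\<close> for which \<open>\<sigma>\<^sub>i\<close> has
density \<open>\<bar>x\<^sub>j\<bar>\<close> to the power \<open>\<epsilon> - 1\<close>, and let every \<open>f\<^sub>i\<close> be this density on the unit cube. Integrals
of it are of size \<open>1 / \<epsilon>\<close>, so \<open>[w]\<close> is at most of order \<open>1 / \<epsilon>\<close> to the power \<open>m p - 1\<close>, while the mean of \<open>f\<^sub>i\<close>
over a cube that joins \<open>x\<close> to the hyperplane \<open>x\<^sub>j = 0\<close> is \<open>f\<^sub>i(x) / \<epsilon>\<close>, which gives \<open>m\<close> factors \<open>1 / \<epsilon>\<close>. Letting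
\<open>\<epsilon>\<close> tend to zero forces the exponent to be at least \<open>m / (m p - 1)\<close>.
\<close>

section \<open>Real powers of extended nonnegative reals\<close>

lemma ennpow_ennreal: "0 < r \<Longrightarrow> ennpow (ennreal r) a = ennreal (r powr a)"
  by (simp add: ennpow_def)

lemma ennpow_ennreal_pos: "0 \<le> r \<Longrightarrow> 0 < a \<Longrightarrow> ennpow (ennreal r) a = ennreal (r powr a)"
  by (cases "r = 0") (auto simp: ennpow_def)

lemma ennpow_0 [simp]: "0 < a \<Longrightarrow> ennpow 0 a = 0"
  and ennpow_top [simp]: "0 < a \<Longrightarrow> ennpow top a = top"
  and ennpow_exp_0 [simp]: "ennpow x 0 = 1"
  by (auto simp: ennpow_def)

lemma ennpow_one [simp]: "ennpow 1 a = 1"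
  by (simp add: ennpow_def)

lemma ennpow_exp_1 [simp]: "ennpow x 1 = x"
  by (cases x) (auto simp: ennpow_def)

lemma ennpow_eq_0_iff: "0 < a \<Longrightarrow> ennpow x a = 0 \<longleftrightarrow> x = 0"
  by (cases x) (auto simp: ennpow_def)

lemma ennpow_eq_top_iff: "0 < a \<Longrightarrow> ennpow x a = top \<longleftrightarrow> x = top"
  by (cases x) (auto simp: ennpow_def)

lemma ennpow_mult: "0 \<le> a \<Longrightarrow> ennpow (x * y) a = ennpow x a * ennpow y a"
proof (cases "a = 0")
  case False
  assume "0 \<le> a"
  with False have a: "0 < a" by simp
  show ?thesis
  proof (cases "x = 0 \<or> y = 0 \<or> x = top \<or> y = top")
    case True
    with a show ?thesis by (auto simp: ennreal_mult_eq_top_iff ennreal_top_mult ennreal_mult_top ennpow_eq_0_iff)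
  next
    case False
    then obtain r s where "x = ennreal r" "y = ennreal s" "0 < r" "0 < s"
      by (cases x; cases y) (auto simp: less_le)
    then show ?thesis
      by (simp add: ennreal_mult[symmetric] ennpow_ennreal powr_mult)
  qed
qed simp

lemma ennpow_ennpow: "0 < a \<Longrightarrow> 0 < b \<Longrightarrow> ennpow (ennpow x a) b = ennpow x (a * b)"
  by (cases x) (auto simp: ennpow_ennreal_pos powr_powr)

lemma ennpow_add: "0 < a \<Longrightarrow> 0 < b \<Longrightarrow> ennpow x (a + b) = ennpow x a * ennpow x b"
  by (cases x) (auto simp: ennpow_ennreal_pos powr_add ennreal_mult)

lemma ennpow_mono: "0 \<le> a \<Longrightarrow> x \<le> y \<Longrightarrow> ennpow x a \<le> ennpow y a"
proof (cases "a = 0")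
  case False
  assume "0 \<le> a" "x \<le> y"
  with False show ?thesis
    by (cases x; cases y) (auto simp: ennpow_ennreal_pos top_unique intro!: ennreal_leI powr_mono2)
qed simp

lemma ennpow_antimono: "a \<le> 0 \<Longrightarrow> 0 < x \<Longrightarrow> x \<le> y \<Longrightarrow> ennpow y a \<le> ennpow x a"
proof (cases "a = 0")
  case False
  assume "a \<le> 0" "0 < x" "x \<le> y"
  with False show ?thesis
    by (cases x; cases y) (auto simp: ennpow_def top_unique less_le intro!: ennreal_leI powr_mono2')
qed simp

lemma ennpow_inverse_cancel: "0 < a \<Longrightarrow> ennpow (ennpow x a) (1 / a) = x"
  "0 < a \<Longrightarrow> ennpow (ennpow x (1 / a)) a = x"
  by (simp_all add: ennpow_ennpow)

lemma ennpow_le_iff: "0 < a \<Longrightarrow> ennpow x a \<le> y \<longleftrightarrow> x \<le> ennpow y (1 / a)"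
  using ennpow_mono[of a x "ennpow y (1/a)"] ennpow_mono[of "1/a" "ennpow x a" y]
  by (auto simp: ennpow_inverse_cancel)

lemma ennpow_prod: "0 \<le> a \<Longrightarrow> ennpow (\<Prod>i\<in>I. f i) a = (\<Prod>i\<in>I. ennpow (f i) a)"
  by (induction I rule: infinite_finite_induct) (auto simp: ennpow_mult)

lemma ennpow_sum_exp:
  assumes "finite I" "I \<noteq> {}" "\<And>i. i \<in> I \<Longrightarrow> 0 < a i"
  shows "ennpow x (\<Sum>i\<in>I. a i) = (\<Prod>i\<in>I. ennpow x (a i))"
  using assms by (induction I rule: finite_ne_induct) (auto simp: ennpow_add sum_pos)

lemma borel_measurable_ennpow [measurable]:
  assumes [measurable]: "f \<in> borel_measurable M"
  shows "(\<lambda>x. ennpow (f x) a) \<in> borel_measurable M"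
proof (cases "a = 0")
  case False
  define c d :: ennreal where "c = (if a > 0 then 0 else top)" and "d = (if a > 0 then top else 0)"
  have "(\<lambda>x. ennpow (f x) a) =
      (\<lambda>x. if f x = 0 then c else if f x = top then d else ennreal (enn2real (f x) powr a))"
    using False by (auto simp: ennpow_def c_def d_def)
  then show ?thesis by simp
qed simp

section \<open>Hoelder's inequality for finitely many functions\<close>

text \<open>
Convexity of the exponential function, if all \<open>x i\<close> are positive and finite. If some \<open>x i\<close> vanishes, so does
the left side, and if some \<open>x i\<close> is infinite, so is the right side, because the \<open>\<theta> i\<close> are positive.
\<close>

lemma weighted_AM_GM:
  fixes x :: "'i \<Rightarrow> ennreal"
  assumes I: "finite I" "\<And>i. i \<in> I \<Longrightarrow> 0 < \<theta> i" "(\<Sum>i\<in>I. \<theta> i) = 1"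
  shows "(\<Prod>i\<in>I. ennpow (x i) (\<theta> i)) \<le> (\<Sum>i\<in>I. ennreal (\<theta> i) * x i)"
proof -
  consider "\<exists>i\<in>I. x i = 0" | "\<exists>i\<in>I. x i = top" | "\<forall>i\<in>I. 0 < x i \<and> x i < top"
    by (metis ennreal_zero_less_top less_top zero_less_iff_neq_zero)
  then show ?thesis
  proof cases
    case 1
    then obtain j where "j \<in> I" "x j = 0" by auto
    with I have "(\<Prod>i\<in>I. ennpow (x i) (\<theta> i)) = 0"
      by (intro prod_zero) (auto intro!: bexI[of _ j])
    then show ?thesis by (simp only: zero_le)
  next
    case 2
    then obtain j where j: "j \<in> I" "x j = top" by auto
    have "top = ennreal (\<theta> j) * x j"
      using j I(2)[of j] by (auto simp: ennreal_mult_top ennreal_eq_0_iff)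
    also have "\<dots> \<le> (\<Sum>i\<in>I. ennreal (\<theta> i) * x i)"
      by (rule member_le_sum) (use j I in auto)
    finally show ?thesis by (simp add: top_unique)
  next
    case 3
    define r where "r i = enn2real (x i)" for i
    have r: "x i = ennreal (r i)" "0 < r i" if "i \<in> I" for i
      using 3 that by (auto simp: r_def enn2real_positive_iff)
    have "(\<Prod>i\<in>I. ennpow (x i) (\<theta> i)) = ennreal (\<Prod>i\<in>I. r i powr \<theta> i)"
      using r by (subst prod_ennreal[symmetric]) (auto simp: ennpow_ennreal intro!: prod.cong)
    also have "(\<Prod>i\<in>I. r i powr \<theta> i) = (\<Prod>i\<in>I. exp (\<theta> i * ln (r i)))"
      by (intro prod.cong refl) (auto simp: powr_def dest: r(2))
    also have "\<dots> = exp (\<Sum>i\<in>I. \<theta> i *\<^sub>R ln (r i))"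
      using I by (simp add: exp_sum)
    also have "\<dots> \<le> (\<Sum>i\<in>I. \<theta> i * exp (ln (r i)))"
    proof (rule convex_on_sum[OF I(1) _ exp_convex I(3)])
      show "I \<noteq> {}" using I(3) by auto
    qed (use I(2) in \<open>auto intro: less_imp_le\<close>)
    also have "ennreal \<dots> = (\<Sum>i\<in>I. ennreal (\<theta> i) * x i)"
      using r I by (subst sum_ennreal[symmetric]) (auto simp: ennreal_mult less_imp_le intro!: sum.cong)
    finally show ?thesis by (simp add: ennreal_leI)
  qed
qed

text \<open>
Normalise every \<open>f i\<close> to integral one and integrate the weighted inequality of arithmetic and geometric
means. A vanishing integral makes the product vanish almost everywhere, so the convention
\<open>0 * \<infinity> = 0\<close> on the right side is harmless.
\<close>

lemma Holder_nn_integral: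
  fixes f :: "'i \<Rightarrow> 'a \<Rightarrow> ennreal"
  assumes [measurable]: "\<And>i. i \<in> I \<Longrightarrow> f i \<in> borel_measurable M"
    and I: "finite I" "\<And>i. i \<in> I \<Longrightarrow> 0 < \<theta> i" "(\<Sum>i\<in>I. \<theta> i) = 1"
  shows "(\<integral>\<^sup>+x. (\<Prod>i\<in>I. ennpow (f i x) (\<theta> i)) \<partial>M) \<le> (\<Prod>i\<in>I. ennpow (\<integral>\<^sup>+x. f i x \<partial>M) (\<theta> i))"
proof -
  define n where "n i = (\<integral>\<^sup>+x. f i x \<partial>M)" for i
  consider "\<exists>i\<in>I. n i = 0" | "\<forall>i\<in>I. n i \<noteq> 0" "\<exists>i\<in>I. n i = top" | "\<forall>i\<in>I. 0 < n i \<and> n i < top"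
    by (metis less_top zero_less_iff_neq_zero)
  then show ?thesis
  proof cases
    case 1
    then obtain j where j: "j \<in> I" "n j = 0" by auto
    then have "AE x in M. f j x = 0"
      by (simp add: n_def nn_integral_0_iff_AE)
    then have "AE x in M. (\<Prod>i\<in>I. ennpow (f i x) (\<theta> i)) = 0"
      by eventually_elim (rule prod_zero, use j I in \<open>auto intro!: bexI[of _ j]\<close>)
    then have "(\<integral>\<^sup>+x. (\<Prod>i\<in>I. ennpow (f i x) (\<theta> i)) \<partial>M) = (\<integral>\<^sup>+x. 0 \<partial>M)"
      by (rule nn_integral_cong_AE)
    then show ?thesis by (simp only: nn_integral_const mult_zero_left zero_le)
  next
    case 2
    then obtain j where j: "j \<in> I" "n j = top" by auto
    have "\<forall>i\<in>I. ennpow (n i) (\<theta> i) \<noteq> 0"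
      using 2 I by (simp add: ennpow_eq_0_iff)
    moreover have "ennpow (n j) (\<theta> j) = top"
      using j I by simp
    ultimately have "(\<Prod>i\<in>I. ennpow (n i) (\<theta> i)) = top"
      unfolding ennreal_prod_eq_top using I(1) j(1) by blast
    then show ?thesis unfolding n_def[symmetric] by (simp only: top_greatest)
  next
    case 3
    have eq: "(\<Prod>i\<in>I. ennpow (f i x) (\<theta> i)) =
        (\<Prod>i\<in>I. ennpow (n i) (\<theta> i)) * (\<Prod>i\<in>I. ennpow (f i x / n i) (\<theta> i))" for x
    proof -
      have "n i * (f i x / n i) = f i x" if "i \<in> I" for i
        using 3 that by (auto simp: ennreal_times_divide ennreal_mult_divide_eq mult.commute[of "n i"] less_top[symmetric])
      then have "ennpow (f i x) (\<theta> i) = ennpow (n i) (\<theta> i) * ennpow (f i x / n i) (\<theta> i)" if "i \<in> I" for i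
        using I that by (subst ennpow_mult[symmetric]) (auto simp: less_imp_le)
      then show ?thesis
        by (subst prod.distrib[symmetric]) (rule prod.cong, auto)
    qed
    have "(\<integral>\<^sup>+x. (\<Prod>i\<in>I. ennpow (f i x / n i) (\<theta> i)) \<partial>M)
        \<le> (\<integral>\<^sup>+x. (\<Sum>i\<in>I. ennreal (\<theta> i) * (f i x / n i)) \<partial>M)"
      by (intro nn_integral_mono weighted_AM_GM I)
    also have "\<dots> = (\<Sum>i\<in>I. ennreal (\<theta> i) * (n i / n i))"
      by (simp add: nn_integral_sum nn_integral_cmult nn_integral_divide n_def)
    also have "\<dots> = (\<Sum>i\<in>I. ennreal (\<theta> i))"
      using 3 by (intro sum.cong) auto
    also have "\<dots> = 1"
      using I by (subst sum_ennreal) (auto simp: less_imp_le)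
    finally have *: "(\<integral>\<^sup>+x. (\<Prod>i\<in>I. ennpow (f i x / n i) (\<theta> i)) \<partial>M) \<le> 1" .
    have "(\<integral>\<^sup>+x. (\<Prod>i\<in>I. ennpow (f i x) (\<theta> i)) \<partial>M) =
        (\<Prod>i\<in>I. ennpow (n i) (\<theta> i)) * (\<integral>\<^sup>+x. (\<Prod>i\<in>I. ennpow (f i x / n i) (\<theta> i)) \<partial>M)"
      unfolding eq by (rule nn_integral_cmult) measurable
    also have "\<dots> \<le> (\<Prod>i\<in>I. ennpow (n i) (\<theta> i)) * 1"
      by (intro mult_left_mono *) simp
    finally show ?thesis by (simp only: n_def mult_1_right)
  qed
qed

section \<open>Maximal functions of nested partitions\<close>

definition mean_on :: "'a measure \<Rightarrow> 'a set \<Rightarrow> ('a \<Rightarrow> ennreal) \<Rightarrow> ennreal" where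
  "mean_on M Q g = (\<integral>\<^sup>+y\<in>Q. g y \<partial>M) / emeasure M Q"

definition cell_maximal :: "'a measure \<Rightarrow> (nat \<Rightarrow> 'a \<Rightarrow> 'a set) \<Rightarrow> ('a \<Rightarrow> ennreal) \<Rightarrow> 'a \<Rightarrow> ennreal" where
  "cell_maximal M cell g x = (SUP k. mean_on M (cell k x) g)"

text \<open>
\<open>cell k x\<close> is the cell around \<open>x\<close> in the \<open>k\<close>-th partition. The measure is a parameter because the
argument needs the same cells for Lebesgue measure, for each \<open>\<sigma>\<^sub>i\<close> and for \<open>\<nu>\<close>.
\<close>

locale nested_partitions =
  fixes M :: "'a measure" and cell :: "nat \<Rightarrow> 'a \<Rightarrow> 'a set"
  assumes space_UNIV: "space M = UNIV"
    and cell_self: "x \<in> cell k x"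
    and cell_eq: "y \<in> cell k x \<Longrightarrow> cell k y = cell k x"
    and cell_Suc: "cell (Suc k) x \<subseteq> cell k x"
    and sets_cell [measurable]: "cell k x \<in> sets M"
    and countable_cells: "countable (range (cell k))"
    and finite_cell: "emeasure M (cell k x) \<noteq> top"
begin

text \<open>
In the language of martingales, \<open>adapted k\<close> is measurability with respect to the \<sigma>-algebra generated by
the \<open>k\<close>-th partition, and \<open>mean_on M (cell k x) g\<close> is a conditional expectation.
\<close>

definition adapted :: "nat \<Rightarrow> ('a \<Rightarrow> 'b) \<Rightarrow> bool" where
  "adapted k h \<longleftrightarrow> (\<forall>x. \<forall>y\<in>cell k x. h y = h x)"

lemma cell_antimono: "j \<le> k \<Longrightarrow> cell k x \<subseteq> cell j x"
  by (rule lift_Suc_antimono_le[of "\<lambda>k. cell k x"], rule cell_Suc)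

lemma adapted_cell: "j \<le> k \<Longrightarrow> adapted k (cell j)"
  unfolding adapted_def using cell_antimono cell_eq by blast

lemma adapted_mean: "j \<le> k \<Longrightarrow> adapted k (\<lambda>x. mean_on M (cell j x) g)"
  using adapted_cell[of j k] unfolding adapted_def by auto

lemma sets_adapted:
  assumes "adapted k P"
  shows "{x. P x} \<in> sets M"
proof -
  have "{x. P x} = \<Union>{C \<in> range (cell k). C \<subseteq> {x. P x}}"
    using assms cell_self unfolding adapted_def by blast
  also have "\<dots> \<in> sets M"
    by (rule sets.countable_Union) (use countable_cells in \<open>auto intro: countable_subset\<close>)
  finally show ?thesis .
qed

lemma measurable_adapted: "adapted k h \<Longrightarrow> h \<in> borel_measurable M"
proof (rule measurableI)
  fix B assume "adapted k h"
  then have "adapted k (\<lambda>x. h x \<in> B)" by (auto simp: adapted_def)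
  from sets_adapted[OF this] show "h -` B \<inter> space M \<in> sets M"
    by (simp add: space_UNIV vimage_def)
qed simp

lemma measurable_mean [measurable]: "(\<lambda>x. mean_on M (cell k x) g) \<in> borel_measurable M"
  by (rule measurable_adapted[OF adapted_mean[OF order_refl]])

lemma measurable_cell_maximal [measurable]: "cell_maximal M cell g \<in> borel_measurable M"
  unfolding cell_maximal_def by measurable

lemma sets_cell_maximal_greater [measurable]: "{x. t < cell_maximal M cell g x} \<in> sets M"
proof -
  have "{x \<in> space M. t < cell_maximal M cell g x} \<in> sets M" by measurable
  then show ?thesis by (simp add: space_UNIV)
qed

lemma nn_integral_cells:
  assumes [measurable]: "\<phi> \<in> borel_measurable M"
  shows "(\<integral>\<^sup>+C. (\<integral>\<^sup>+x\<in>C. \<phi> x \<partial>M) \<partial>count_space (range (cell k))) = (\<integral>\<^sup>+x. \<phi> x \<partial>M)"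
proof -
  have "(\<integral>\<^sup>+C. (\<integral>\<^sup>+x\<in>C. \<phi> x \<partial>M) \<partial>count_space (range (cell k))) =
      (\<integral>\<^sup>+x. (\<integral>\<^sup>+C. \<phi> x * indicator C x \<partial>count_space (range (cell k))) \<partial>M)"
    by (rule nn_integral_count_space_nn_integral[OF countable_cells, symmetric]) auto
  also have "\<dots> = (\<integral>\<^sup>+x. \<phi> x \<partial>M)"
  proof (rule nn_integral_cong)
    fix x
    have "(\<integral>\<^sup>+C. \<phi> x * indicator C x \<partial>count_space (range (cell k))) =
        (\<Sum>C\<in>{cell k x}. \<phi> x * indicator C x)"
      by (rule nn_integral_count_space') (auto dest: cell_eq simp: indicator_def split: if_splits)
    then show "(\<integral>\<^sup>+C. \<phi> x * indicator C x \<partial>count_space (range (cell k))) = \<phi> x"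
      using cell_self by simp
  qed
  finally show ?thesis .
qed

text \<open>
On a cell of measure zero both sides vanish, since \<open>0 / 0 = 0\<close>.
\<close>

lemma mean_times_measure:
  assumes [measurable]: "g \<in> borel_measurable M"
  shows "mean_on M (cell k x) g * emeasure M (cell k x) = (\<integral>\<^sup>+y\<in>cell k x. g y \<partial>M)"
proof (cases "emeasure M (cell k x) = 0")
  case True
  then have "cell k x \<in> null_sets M"
    by (auto intro: null_setsI)
  then have "AE y in M. y \<notin> cell k x" by (rule AE_not_in)
  then have "(\<integral>\<^sup>+y\<in>cell k x. g y \<partial>M) = (\<integral>\<^sup>+y. 0 \<partial>M)"
    by (intro nn_integral_cong_AE) auto
  with True show ?thesis by (simp only: nn_integral_const mult_zero_left mult_zero_right)
next
  case False
  with finite_cell show ?thesis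
    unfolding mean_on_def by (metis ennreal_divide_times ennreal_divide_self less_top mult_1_right)
qed

text \<open>
The defining property of the conditional expectation; summing over the cells reduces it to
\<open>mean_times_measure\<close>.
\<close>

lemma nn_integral_mean_adapted:
  assumes [measurable]: "g \<in> borel_measurable M" and h: "adapted k h"
  shows "(\<integral>\<^sup>+x. mean_on M (cell k x) g * h x \<partial>M) = (\<integral>\<^sup>+x. g x * h x \<partial>M)"
proof -
  have [measurable]: "h \<in> borel_measurable M" by (rule measurable_adapted[OF h])
  have "(\<integral>\<^sup>+x. mean_on M (cell k x) g * h x \<partial>M) =
     (\<integral>\<^sup>+C. (\<integral>\<^sup>+x\<in>C. mean_on M (cell k x) g * h x \<partial>M) \<partial>count_space (range (cell k)))"
    by (rule nn_integral_cells[symmetric]) measurable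
  also have "\<dots> = (\<integral>\<^sup>+C. (\<integral>\<^sup>+x\<in>C. g x * h x \<partial>M) \<partial>count_space (range (cell k)))"
  proof (rule nn_integral_cong)
    fix C assume "C \<in> space (count_space (range (cell k)))"
    then obtain z where C: "C = cell k z" by auto
    have h': "h x = h z" if "x \<in> C" for x using h that C by (auto simp: adapted_def)
    have "(\<integral>\<^sup>+x\<in>C. mean_on M (cell k x) g * h x \<partial>M) = (\<integral>\<^sup>+x. mean_on M C g * h z * indicator C x \<partial>M)"
      using cell_eq by (intro nn_integral_cong) (auto simp: indicator_def h' C)
    also have "\<dots> = h z * (mean_on M C g * emeasure M C)"
      by (subst nn_integral_cmult_indicator) (auto simp: C ac_simps)
    also have "\<dots> = (\<integral>\<^sup>+x. h z * (g x * indicator C x) \<partial>M)"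
      by (subst nn_integral_cmult) (auto simp: C mean_times_measure)
    also have "\<dots> = (\<integral>\<^sup>+x\<in>C. g x * h x \<partial>M)"
      by (intro nn_integral_cong) (auto simp: indicator_def h' ac_simps)
    finally show "(\<integral>\<^sup>+x\<in>C. mean_on M (cell k x) g * h x \<partial>M) = (\<integral>\<^sup>+x\<in>C. g x * h x \<partial>M)" .
  qed
  also have "\<dots> = (\<integral>\<^sup>+x. g x * h x \<partial>M)"
    by (rule nn_integral_cells) measurable
  finally show ?thesis .
qed

text \<open>
Split the set according to the first generation whose mean exceeds \<open>t\<close>. Each part is a union of cells on which
the mean exceeds \<open>t\<close>, so its measure is controlled by the integral of \<open>g\<close> over that same part.
\<close>

lemma cell_maximal_weak_type:
  assumes [measurable]: "g \<in> borel_measurable M"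
  shows "t * emeasure M {x. t < cell_maximal M cell g x} \<le> (\<integral>\<^sup>+x. g x \<partial>M)"
proof -
  let ?m = "\<lambda>k x. mean_on M (cell k x) g"
  define A where "A k = {x. t < ?m k x \<and> (\<forall>j<k. \<not> t < ?m j x)}" for k
  have adA: "adapted k (\<lambda>x. x \<in> A k)" for k
    unfolding A_def adapted_def
  proof (intro allI ballI)
    fix x y assume "y \<in> cell k x"
    then have "cell j y = cell j x" if "j \<le> k" for j
      using adapted_cell[OF that] by (auto simp: adapted_def)
    then show "(y \<in> {x. t < ?m k x \<and> (\<forall>j<k. \<not> t < ?m j x)}) =
        (x \<in> {x. t < ?m k x \<and> (\<forall>j<k. \<not> t < ?m j x)})"
      by auto
  qed
  have adA': "adapted k (\<lambda>x. indicator (A k) x :: ennreal)" for k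
    using adA[of k] by (auto simp: adapted_def indicator_def)
  have [measurable]: "A k \<in> sets M" for k
    using sets_adapted[OF adA[of k]] by simp
  have disj: "disjoint_family A"
    unfolding disjoint_family_on_def A_def
    by (auto simp: set_eq_iff) (metis linorder_neqE_nat)
  have "{x. t < cell_maximal M cell g x} = (\<Union>k. A k)"
  proof (intro set_eqI iffI)
    fix x assume "x \<in> {x. t < cell_maximal M cell g x}"
    then have ex: "\<exists>k. t < ?m k x" by (auto simp: cell_maximal_def less_SUP_iff)
    then show "x \<in> (\<Union>k. A k)"
      unfolding A_def using LeastI_ex[OF ex] not_less_Least by blast
  qed (auto simp: A_def cell_maximal_def less_SUP_iff)
  then have "t * emeasure M {x. t < cell_maximal M cell g x} = (\<Sum>k. t * emeasure M (A k))"
    using disj by (simp add: suminf_emeasure[symmetric] image_subset_iff)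
  also have "\<dots> \<le> (\<Sum>k. \<integral>\<^sup>+x\<in>A k. g x \<partial>M)"
  proof (intro suminf_le)
    fix k
    have "t * emeasure M (A k) = (\<integral>\<^sup>+x. t * indicator (A k) x \<partial>M)"
      by (simp add: nn_integral_cmult_indicator)
    also have "\<dots> \<le> (\<integral>\<^sup>+x. ?m k x * indicator (A k) x \<partial>M)"
      by (intro nn_integral_mono) (auto simp: indicator_def A_def)
    also have "\<dots> = (\<integral>\<^sup>+x\<in>A k. g x \<partial>M)"
      by (rule nn_integral_mean_adapted[OF _ adA']) measurable
    finally show "t * emeasure M (A k) \<le> (\<integral>\<^sup>+x\<in>A k. g x \<partial>M)" .
  qed auto
  also have "\<dots> = (\<integral>\<^sup>+x\<in>(\<Union>k. A k). g x \<partial>M)"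
    by (rule nn_integral_disjoint_family[symmetric]) (use disj in auto)
  also have "\<dots> \<le> (\<integral>\<^sup>+x. g x \<partial>M)"
    by (intro nn_integral_mono) (auto simp: indicator_def)
  finally show ?thesis .
qed

text \<open>
Cells inside a given cell do not see the values of \<open>g\<close> outside, so the global estimate applies to \<open>g\<close> cut
off to the cell.
\<close>

lemma cell_maximal_weak_type_cell:
  assumes [measurable]: "g \<in> borel_measurable M"
  shows "t * emeasure M {y \<in> cell k x. \<exists>j\<ge>k. t < mean_on M (cell j y) g} \<le> (\<integral>\<^sup>+y\<in>cell k x. g y \<partial>M)"
proof -
  let ?g = "\<lambda>y. g y * indicator (cell k x) y"
  have "{y \<in> cell k x. \<exists>j\<ge>k. t < mean_on M (cell j y) g} \<subseteq> {y. t < cell_maximal M cell ?g y}"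
  proof safe
    fix y j assume y: "y \<in> cell k x" "k \<le> j" "t < mean_on M (cell j y) g"
    have "cell j y \<subseteq> cell k x"
      using cell_antimono[OF y(2), of y] cell_eq[OF y(1)] by simp
    then have "mean_on M (cell j y) ?g = mean_on M (cell j y) g"
      unfolding mean_on_def
      by (intro arg_cong2[where f = "(/)"] refl nn_integral_cong) (auto simp: indicator_def)
    with y(3) show "t < cell_maximal M cell ?g y"
      by (auto simp: cell_maximal_def less_SUP_iff intro!: exI[of _ j])
  qed
  then have "t * emeasure M {y \<in> cell k x. \<exists>j\<ge>k. t < mean_on M (cell j y) g}
      \<le> t * emeasure M {y. t < cell_maximal M cell ?g y}"
    by (intro mult_left_mono emeasure_mono) auto
  also have "\<dots> \<le> (\<integral>\<^sup>+y. ?g y \<partial>M)"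
    by (rule cell_maximal_weak_type) measurable
  finally show ?thesis .
qed

lemma sigma_finite: "sigma_finite_measure M"
proof
  show "\<exists>A. countable A \<and> A \<subseteq> sets M \<and> \<Union> A = space M \<and> (\<forall>a\<in>A. emeasure M a \<noteq> \<infinity>)"
    using cell_self finite_cell
    by (intro exI[of _ "range (cell 0)"]) (auto simp: space_UNIV countable_cells)
qed

end

section \<open>The strong type inequality\<close>

lemma ennreal_eq_topI:
  fixes x :: ennreal
  assumes "\<And>s. 0 \<le> s \<Longrightarrow> ennreal s \<le> x"
  shows "x = top"
proof (cases x)
  case (real r)
  with assms[of "r + 1"] show ?thesis by simp
qed

lemma nn_integral_powr_below:
  fixes y :: ennreal
  assumes "0 < c"
  shows "(\<integral>\<^sup>+t\<in>{t. 0 < t \<and> ennreal t < y}. ennreal (c * t powr (c - 1)) \<partial>lborel) = ennpow y c"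
proof -
  have fin: "(\<integral>\<^sup>+t\<in>{t. 0 < t \<and> ennreal t < ennreal r}. ennreal (c * t powr (c - 1)) \<partial>lborel) = ennreal (r powr c)"
    if "0 \<le> r" for r
  proof -
    have "((\<lambda>t. c * t powr (c - 1)) has_integral c * (r powr (c - 1 + 1) / (c - 1 + 1))) {0..r}"
      using assms that by (intro has_integral_mult_right has_integral_powr_from_0) auto
    then have "(\<integral>\<^sup>+t\<in>{0..r}. ennreal (c * t powr (c - 1)) \<partial>lborel) = ennreal (r powr c)"
      using assms by (subst nn_integral_has_integral_lebesgue') auto
    moreover have "(\<integral>\<^sup>+t\<in>{t. 0 < t \<and> ennreal t < ennreal r}. ennreal (c * t powr (c - 1)) \<partial>lborel) =
        (\<integral>\<^sup>+t\<in>{0..r}. ennreal (c * t powr (c - 1)) \<partial>lborel)"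
    proof (rule nn_integral_cong_AE)
      have "AE t in lborel. t \<noteq> 0 \<and> t \<noteq> r"
        using AE_lborel_singleton[of "0::real"] AE_lborel_singleton[of r] by eventually_elim simp
      then show "AE t in lborel. ennreal (c * t powr (c - 1)) * indicator {t. 0 < t \<and> ennreal t < ennreal r} t =
          ennreal (c * t powr (c - 1)) * indicator {0..r} t"
        by eventually_elim (use that in \<open>auto simp: indicator_def ennreal_less_iff\<close>)
    qed
    ultimately show ?thesis by simp
  qed
  show ?thesis
  proof (cases y)
    case (real r)
    then show ?thesis using fin[of r] assms by (simp add: ennpow_ennreal_pos)
  next
    case top
    have "ennreal s \<le> (\<integral>\<^sup>+t\<in>{t. 0 < t \<and> ennreal t < y}. ennreal (c * t powr (c - 1)) \<partial>lborel)"
      if "0 \<le> s" for s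
    proof -
      have "ennreal s = ennreal ((s powr (1 / c)) powr c)"
        using that assms by (simp add: powr_powr)
      also have "\<dots> = (\<integral>\<^sup>+t\<in>{t. 0 < t \<and> ennreal t < ennreal (s powr (1 / c))}. ennreal (c * t powr (c - 1)) \<partial>lborel)"
        by (rule fin[symmetric]) simp
      also have "\<dots> \<le> (\<integral>\<^sup>+t\<in>{t. 0 < t \<and> ennreal t < y}. ennreal (c * t powr (c - 1)) \<partial>lborel)"
        by (intro nn_integral_mono) (auto simp: indicator_def top)
      finally show ?thesis .
    qed
    then have "(\<integral>\<^sup>+t\<in>{t. 0 < t \<and> ennreal t < y}. ennreal (c * t powr (c - 1)) \<partial>lborel) = top"
      by (rule ennreal_eq_topI)
    then show ?thesis using assms top by simp
  qed
qed

text \<open>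
The layer cake formula for one value \<open>y\<close>: integrated over a measure space, it turns bounds for the
superlevel sets of a function into bounds for its \<open>L\<^sup>c\<close> norm.
\<close>

lemma nn_integral_layers:
  assumes "0 < c"
  shows "(\<integral>\<^sup>+t. (if 0 < t \<and> ennreal t < y then ennreal (c * t powr (c - 1)) else 0) \<partial>lborel) = ennpow y c"
  unfolding nn_integral_powr_below[OF assms, symmetric]
  by (intro nn_integral_cong) (auto simp: indicator_def)

text \<open>
Marcinkiewicz interpolation with \<open>L\<^sup>\<infinity>\<close>. Write \<open>h\<close> to the power \<open>q\<close> as an integral over its
layers, insert the weak bound, and exchange the integrals again. The right side of the weak bound contains \<open>g\<close>
only where it exceeds \<open>t / 2\<close>, so that the inner integral of \<open>t\<close> to the power \<open>q - 2\<close> runs over a bounded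
range and converges as \<open>q > 1\<close>.
\<close>

lemma strong_type_from_weak_type:
  fixes g h :: "'a \<Rightarrow> ennreal"
  assumes "sigma_finite_measure M" and q: "1 < q"
    and [measurable]: "g \<in> borel_measurable M" "h \<in> borel_measurable M"
    and weak: "\<And>t. 0 < t \<Longrightarrow> ennreal t * emeasure M {x\<in>space M. ennreal t < h x}
        \<le> 2 * (\<integral>\<^sup>+x. (if ennreal t < 2 * g x then g x else 0) \<partial>M)"
  shows "(\<integral>\<^sup>+x. ennpow (h x) q \<partial>M) \<le> ennreal (2 powr q * q / (q - 1)) * (\<integral>\<^sup>+x. ennpow (g x) q \<partial>M)"
proof -
  interpret M: sigma_finite_measure M by fact
  interpret pair_sigma_finite lborel M by standard
  let ?k = "\<lambda>c t y. if 0 < t \<and> ennreal t < y then ennreal (c * t powr (c - 1)) else 0"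
  have "(\<integral>\<^sup>+x. ennpow (h x) q \<partial>M) = (\<integral>\<^sup>+x. (\<integral>\<^sup>+t. ?k q t (h x) \<partial>lborel) \<partial>M)"
    using q by (subst nn_integral_layers) auto
  also have "\<dots> = (\<integral>\<^sup>+t. (\<integral>\<^sup>+x. ?k q t (h x) \<partial>M) \<partial>lborel)"
    by (rule Fubini') measurable
  also have "\<dots> \<le> (\<integral>\<^sup>+t. (\<integral>\<^sup>+x. ennreal (2 * q / (q - 1)) * (g x * ?k (q - 1) t (2 * g x)) \<partial>M) \<partial>lborel)"
  proof (rule nn_integral_mono)
    fix t :: real
    show "(\<integral>\<^sup>+x. ?k q t (h x) \<partial>M) \<le> (\<integral>\<^sup>+x. ennreal (2 * q / (q - 1)) * (g x * ?k (q - 1) t (2 * g x)) \<partial>M)"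
    proof (cases "0 < t")
      case True
      let ?J = "\<integral>\<^sup>+x. (if ennreal t < 2 * g x then g x else 0) \<partial>M"
      have "(\<integral>\<^sup>+x. ?k q t (h x) \<partial>M)
          = (\<integral>\<^sup>+x. ennreal (q * t powr (q - 1)) * indicator {x\<in>space M. ennreal t < h x} x \<partial>M)"
        using True by (intro nn_integral_cong) (auto simp: indicator_def)
      also have "\<dots> = ennreal (q * t powr (q - 1)) * emeasure M {x\<in>space M. ennreal t < h x}"
        by (rule nn_integral_cmult_indicator) measurable
      also have "\<dots> = ennreal (q * t powr (q - 2)) * ennreal t * emeasure M {x\<in>space M. ennreal t < h x}"
        using True q by (subst ennreal_mult[symmetric]) (auto simp: powr_diff power2_eq_square)
      also have "\<dots> \<le> ennreal (q * t powr (q - 2)) * (2 * ?J)"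
        unfolding mult.assoc by (intro mult_left_mono weak True) simp
      also have "\<dots> = (ennreal (q * t powr (q - 2)) * ennreal 2) * ?J"
        by (simp add: mult.assoc)
      also have "ennreal (q * t powr (q - 2)) * ennreal 2 = ennreal (2 * q / (q - 1)) * ennreal ((q - 1) * t powr (q - 2))"
        using q by (subst (1 2) ennreal_mult[symmetric]) (auto simp: mult.commute)
      also have "\<dots> * ?J = (\<integral>\<^sup>+x. (ennreal (2 * q / (q - 1)) * ennreal ((q - 1) * t powr (q - 2))) *
          (if ennreal t < 2 * g x then g x else 0) \<partial>M)"
        by (rule nn_integral_cmult[symmetric]) measurable
      also have "\<dots> = (\<integral>\<^sup>+x. ennreal (2 * q / (q - 1)) * (g x * ?k (q - 1) t (2 * g x)) \<partial>M)"
        using True by (intro nn_integral_cong) (auto simp: ac_simps)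
      finally show ?thesis .
    qed simp
  qed
  also have "\<dots> = (\<integral>\<^sup>+x. (\<integral>\<^sup>+t. ennreal (2 * q / (q - 1)) * (g x * ?k (q - 1) t (2 * g x)) \<partial>lborel) \<partial>M)"
    by (rule Fubini'[symmetric]) measurable
  also have "\<dots> = (\<integral>\<^sup>+x. ennreal (2 powr q * q / (q - 1)) * ennpow (g x) q \<partial>M)"
  proof (rule nn_integral_cong)
    fix x
    have "(\<integral>\<^sup>+t. ennreal (2 * q / (q - 1)) * (g x * ?k (q - 1) t (2 * g x)) \<partial>lborel) =
        ennreal (2 * q / (q - 1)) * (g x * (\<integral>\<^sup>+t. ?k (q - 1) t (2 * g x) \<partial>lborel))"
    proof -
      have "(\<integral>\<^sup>+t. g x * ?k (q - 1) t (2 * g x) \<partial>lborel) = g x * (\<integral>\<^sup>+t. ?k (q - 1) t (2 * g x) \<partial>lborel)"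
        by (rule nn_integral_cmult) measurable
      moreover have "(\<integral>\<^sup>+t. ennreal (2 * q / (q - 1)) * (g x * ?k (q - 1) t (2 * g x)) \<partial>lborel) =
          ennreal (2 * q / (q - 1)) * (\<integral>\<^sup>+t. g x * ?k (q - 1) t (2 * g x) \<partial>lborel)"
        by (rule nn_integral_cmult) measurable
      ultimately show ?thesis by (simp only:)
    qed
    also have "(\<integral>\<^sup>+t. ?k (q - 1) t (2 * g x) \<partial>lborel) = ennpow (2 * g x) (q - 1)"
      using q by (intro nn_integral_layers) simp
    also have "\<dots> = ennreal (2 powr (q - 1)) * ennpow (g x) (q - 1)"
      using q ennpow_ennreal[of 2 "q - 1"] by (simp add: ennpow_mult)
    also have "g x * \<dots> = ennreal (2 powr (q - 1)) * ennpow (g x) q"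
      using q ennpow_add[of 1 "q - 1" "g x"] by (simp add: ac_simps)
    also have "ennreal (2 * q / (q - 1)) * \<dots> = ennreal (2 powr q * q / (q - 1)) * ennpow (g x) q"
    proof -
      have "2 * q / (q - 1) * 2 powr (q - 1) = 2 powr q * q / (q - 1)"
        using q by (simp add: powr_diff divide_simps)
      moreover have "ennreal (2 * q / (q - 1)) * ennreal (2 powr (q - 1)) = ennreal (2 * q / (q - 1) * 2 powr (q - 1))"
        using q by (intro ennreal_mult[symmetric]) auto
      ultimately show ?thesis by (simp only: mult.assoc[symmetric])
    qed
    finally show "(\<integral>\<^sup>+t. ennreal (2 * q / (q - 1)) * (g x * ?k (q - 1) t (2 * g x)) \<partial>lborel) =
        ennreal (2 powr q * q / (q - 1)) * ennpow (g x) q" .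
  qed
  also have "\<dots> = ennreal (2 powr q * q / (q - 1)) * (\<integral>\<^sup>+x. ennpow (g x) q \<partial>M)"
    by (rule nn_integral_cmult) measurable
  finally show ?thesis .
qed

text \<open>
The part of \<open>g\<close> below \<open>t / 2\<close> contributes at most \<open>t / 2\<close> to any mean, so where the maximal function exceeds
\<open>t\<close> that of the remaining part exceeds \<open>t / 2\<close>.
\<close>

theorem (in nested_partitions) cell_maximal_strong_type:
  assumes q: "1 < q" and [measurable]: "g \<in> borel_measurable M"
  shows "(\<integral>\<^sup>+x. ennpow (cell_maximal M cell g x) q \<partial>M) \<le>
    ennreal (2 powr q * q / (q - 1)) * (\<integral>\<^sup>+x. ennpow (g x) q \<partial>M)"
proof (rule strong_type_from_weak_type[OF sigma_finite q])
  fix t :: real assume t: "0 < t"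
  let ?g = "\<lambda>x. if ennreal t < 2 * g x then g x else 0"
  have g_le: "g x \<le> ?g x + ennreal (t / 2)" for x
    by (cases "g x") (use t in \<open>auto simp: ennreal_less_iff ennreal_mult[symmetric] simp flip: ennreal_numeral intro!: ennreal_leI\<close>)
  have half: "ennreal t = ennreal (t / 2) + ennreal (t / 2)"
    using t by (subst ennreal_plus[symmetric]) auto
  have sub: "{x \<in> space M. ennreal t < cell_maximal M cell g x} \<subseteq> {x. ennreal (t / 2) < cell_maximal M cell ?g x}"
  proof safe
    fix x assume "ennreal t < cell_maximal M cell g x"
    then obtain k where k: "ennreal t < mean_on M (cell k x) g"
      by (auto simp: cell_maximal_def less_SUP_iff)
    have "mean_on M (cell k x) g \<le>
        ((\<integral>\<^sup>+y\<in>cell k x. ?g y \<partial>M) + ennreal (t / 2) * emeasure M (cell k x)) / emeasure M (cell k x)"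
      unfolding mean_on_def
    proof (rule divide_right_mono_ennreal)
      have "(\<integral>\<^sup>+y\<in>cell k x. g y \<partial>M) \<le>
          (\<integral>\<^sup>+y. ?g y * indicator (cell k x) y + ennreal (t / 2) * indicator (cell k x) y \<partial>M)"
      proof (rule nn_integral_mono)
        fix y
        show "g y * indicator (cell k x) y \<le>
            ?g y * indicator (cell k x) y + ennreal (t / 2) * indicator (cell k x) y"
          using g_le[of y] by (cases "y \<in> cell k x") (simp_all only: indicator_simps mult_1_right mult_zero_right add_0, simp)
      qed
      also have "\<dots> = (\<integral>\<^sup>+y\<in>cell k x. ?g y \<partial>M) + ennreal (t / 2) * emeasure M (cell k x)"
        by (subst nn_integral_add) (auto simp: nn_integral_cmult_indicator)
      finally show "(\<integral>\<^sup>+y\<in>cell k x. g y \<partial>M) \<le> \<dots>" .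
    qed
    also have "\<dots> \<le> mean_on M (cell k x) ?g + ennreal (t / 2)"
      unfolding add_divide_distrib_ennreal mean_on_def
      using finite_cell[of k x]
      by (cases "emeasure M (cell k x) = 0") (auto simp: ennreal_mult_divide_eq)
    finally have "ennreal t < mean_on M (cell k x) ?g + ennreal (t / 2)"
      using k by simp
    then have "ennreal (t / 2) < mean_on M (cell k x) ?g"
      unfolding half by (metis add_right_mono linorder_not_le)
    then show "ennreal (t / 2) < cell_maximal M cell ?g x"
      by (auto simp: cell_maximal_def less_SUP_iff)
  qed
  have "ennreal t * emeasure M {x \<in> space M. ennreal t < cell_maximal M cell g x} \<le>
      ennreal t * emeasure M {x \<in> space M. ennreal (t / 2) < cell_maximal M cell ?g x}"
    using sub by (intro mult_left_mono emeasure_mono) (simp_all add: space_UNIV sets_cell_maximal_greater)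
  also have "\<dots> = 2 * (ennreal (t / 2) * emeasure M {x. ennreal (t / 2) < cell_maximal M cell ?g x})"
  proof -
    have "ennreal t = 2 * ennreal (t / 2)"
      using t by (simp flip: ennreal_numeral ennreal_mult)
    then show ?thesis by (simp only: space_UNIV UNIV_I simp_thms mult.assoc)
  qed
  also have "\<dots> \<le> 2 * (\<integral>\<^sup>+x. ?g x \<partial>M)"
    by (intro mult_left_mono cell_maximal_weak_type) auto
  finally show "ennreal t * emeasure M {x \<in> space M. ennreal t < cell_maximal M cell g x} \<le> 2 * (\<integral>\<^sup>+x. ?g x \<partial>M)" .
qed measurable

section \<open>Sparse families of cells\<close>

text \<open>
The most recently selected value before stage \<open>k\<close>, where stage \<open>k\<close> is selected if \<open>u k\<close> exceeds \<open>a\<close> times the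
value selected last, and \<open>0\<close> stands for the situation before any selection.
\<close>

primrec stopped :: "ennreal \<Rightarrow> (nat \<Rightarrow> ennreal) \<Rightarrow> nat \<Rightarrow> ennreal" where
  "stopped a u 0 = 0"
| "stopped a u (Suc k) = (if a * stopped a u k < u k then u k else stopped a u k)"

lemma stopped_cong: "(\<And>j. j < k \<Longrightarrow> u j = v j) \<Longrightarrow> stopped a u k = stopped a v k"
  by (induction k) auto

lemma stopped_le_Suc: "1 \<le> a \<Longrightarrow> stopped a u k \<le> stopped a u (Suc k)"
  using mult_right_mono[of 1 a "stopped a u k"] by auto

lemma stopped_mono: "1 \<le> a \<Longrightarrow> j \<le> k \<Longrightarrow> stopped a u j \<le> stopped a u k"
  by (rule lift_Suc_mono_le[of "stopped a u"], rule stopped_le_Suc)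

lemma le_stopped_Suc: "1 \<le> a \<Longrightarrow> u k \<le> a * stopped a u (Suc k)"
  using mult_right_mono[of 1 a "u k"] by auto

lemma stopped_cases:
  "stopped a u k = 0 \<or> (\<exists>j<k. a * stopped a u j < u j \<and> stopped a u k = u j)"
  by (induction k) (auto intro: less_SucI)

lemma (in nested_partitions) cells_comparable:
  assumes "z \<in> cell j x" "z \<in> cell k y"
  shows "cell j x \<subseteq> cell k y \<or> cell k y \<subseteq> cell j x"
  using assms cell_eq cell_antimono[of j k z] cell_antimono[of k j z] by (metis linear)

text \<open>
A cell \<open>cell k x\<close> is selected when \<open>F\<close> has grown by the factor \<open>a\<close> beyond its value at the last selected
cell around \<open>x\<close>, and \<open>E C\<close> is what the smaller selected cells leave of \<open>C\<close>. Every value of \<open>F\<close> at a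
cell around \<open>x\<close> is at most \<open>a\<close> times a selected one. If \<open>F\<close> grows by \<open>a = (2 n)^n\<close>, where \<open>n\<close> is
the number of functions, one of the \<open>n\<close> means has grown by \<open>2 n\<close>. The weak type inequality confines this to a
part of relative measure at most \<open>1 / (2 n)\<close> for each function, so at most half of \<open>C\<close> is lost.
\<close>

lemma (in nested_partitions) sparse_domination:
  fixes f :: "'i \<Rightarrow> 'a \<Rightarrow> ennreal"
  assumes I: "finite I" "I \<noteq> {}" and [measurable]: "\<And>i. i \<in> I \<Longrightarrow> f i \<in> borel_measurable M"
  defines "F \<equiv> \<lambda>C. \<Prod>i\<in>I. mean_on M C (f i)" and "a \<equiv> (2 * of_nat (card I)) ^ card I"
  obtains \<S> E where "\<S> \<subseteq> (\<Union>k. range (cell k))" "countable \<S>"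
    "\<And>C. C \<in> \<S> \<Longrightarrow> E C \<in> sets M \<and> E C \<subseteq> C \<and> emeasure M C \<le> 2 * emeasure M (E C)"
    "\<And>x C D. C \<in> \<S> \<Longrightarrow> D \<in> \<S> \<Longrightarrow> x \<in> E C \<Longrightarrow> x \<in> E D \<Longrightarrow> C = D"
    "\<And>k x. F (cell k x) \<noteq> 0 \<Longrightarrow> \<exists>C\<in>\<S>. x \<in> C \<and> F (cell k x) \<le> a * F C"
proof -
  define n where "n = card I"
  have n: "1 \<le> n" using I by (simp add: n_def Suc_le_eq card_gt_0_iff)
  have n1: "(1::ennreal) \<le> 2 * of_nat n"
    using n by (metis mult_mono' mult_1_right of_nat_1 of_nat_mono one_le_numeral zero_le_one zero_le)
  have a1: "1 \<le> a"
    using n1 unfolding a_def n_def by (rule one_le_power)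
  define G where "G k x = stopped a (\<lambda>j. F (cell j x)) k" for k x
  have G_cell: "G k y = G k x" if "y \<in> cell k x" for k x y
    unfolding G_def
    by (rule stopped_cong) (metis adapted_def adapted_cell less_imp_le that)
  define \<S> where "\<S> = {cell k x |k x. a * G k x < F (cell k x)}"
  define E where "E C = C - \<Union>{D \<in> \<S>. D \<subset> C}" for C
  have \<S>_sub: "\<S> \<subseteq> (\<Union>k. range (cell k))" by (auto simp: \<S>_def)
  have count: "countable \<S>"
    by (rule countable_subset[OF \<S>_sub]) (auto intro: countable_cells)
  have \<S>_sets: "C \<in> sets M" if "C \<in> \<S>" for C
    using that by (auto simp: \<S>_def)
  have \<S>_E: "C \<in> sets M" "E C \<in> sets M" if "C \<in> \<S>" for C
    using that count \<S>_sets unfolding E_def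
    by (auto intro!: sets.Diff sets.countable_Union intro: countable_subset)
  have large: "emeasure M C \<le> 2 * emeasure M (E C)" if C: "C \<in> \<S>" for C
  proof -
    obtain k x where kx: "C = cell k x" "a * G k x < F (cell k x)"
      using C by (auto simp: \<S>_def)
    have F0: "F C \<noteq> 0" using kx by auto
    have mean0: "mean_on M C (f i) \<noteq> 0" if "i \<in> I" for i
      using F0 I that unfolding F_def by auto
    define B where "B i = {y \<in> C. \<exists>j\<ge>k. 2 * of_nat n * mean_on M C (f i) < mean_on M (cell j y) (f i)}" for i
    have B_sets: "B i \<in> sets M" if "i \<in> I" for i
    proof -
      have "B i = C \<inter> (\<Union>j\<in>{k..}. {y \<in> space M. 2 * of_nat n * mean_on M C (f i) < mean_on M (cell j y) (f i)})"
        by (auto simp: B_def space_UNIV)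
      also have "\<dots> \<in> sets M" using \<S>_sets[OF C] by measurable
      finally show ?thesis .
    qed
    have cover: "C \<subseteq> E C \<union> (\<Union>i\<in>I. B i)"
    proof
      fix y assume y: "y \<in> C"
      show "y \<in> E C \<union> (\<Union>i\<in>I. B i)"
      proof (cases "y \<in> E C")
        case False
        then obtain D where D: "D \<in> \<S>" "D \<subset> C" "y \<in> D" using y by (auto simp: E_def)
        then obtain j z where jz: "D = cell j z" "a * G j z < F (cell j z)"
          by (auto simp: \<S>_def)
        then have Dj: "D = cell j y" "a * G j y < F D"
          using G_cell[of y j z] cell_eq[of y j z] D(3) by auto
        have "C = cell k y" using cell_eq y kx(1) by simp
        have "\<not> j \<le> k"
          using cell_antimono[of j k y] D(2) Dj(1) \<open>C = cell k y\<close> by auto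
        then have "Suc k \<le> j" by simp
        have "G (Suc k) y = F C"
          using kx(2) G_cell[of y k x] y kx(1) \<open>C = cell k y\<close> by (auto simp: G_def)
        then have "F C \<le> G j y"
          using stopped_mono[OF a1 \<open>Suc k \<le> j\<close>] by (metis G_def)
        then have "a * F C < F D"
          using Dj(2) by (meson le_less_trans mult_left_mono zero_le)
        have "\<exists>i\<in>I. 2 * of_nat n * mean_on M C (f i) < mean_on M D (f i)"
        proof (rule ccontr)
          assume "\<not> ?thesis"
          then have "F D \<le> (\<Prod>i\<in>I. 2 * of_nat n * mean_on M C (f i))"
            unfolding F_def by (intro prod_mono_ennreal) (auto simp: not_less)
          also have "\<dots> = a * F C"
            by (simp add: prod.distrib F_def a_def n_def)
          finally show False using \<open>a * F C < F D\<close> by simp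
        qed
        then show ?thesis
          using \<open>Suc k \<le> j\<close> y Dj(1) by (auto simp: B_def)
      qed simp
    qed
    have UB: "(\<Union>i\<in>I. B i) \<in> sets M"
      using B_sets I by (intro sets.finite_UN) auto
    have B_small: "2 * of_nat n * emeasure M (B i) \<le> emeasure M C" if i: "i \<in> I" for i
    proof (cases "mean_on M C (f i) = top")
      case True
      then have "2 * of_nat n * mean_on M C (f i) = top"
        using n by (simp add: ennreal_mult_top)
      then have "B i = {}" by (simp add: B_def)
      then show ?thesis by simp
    next
      case False
      have "2 * of_nat n * mean_on M C (f i) * emeasure M (B i) \<le> (\<integral>\<^sup>+y\<in>C. f i y \<partial>M)"
        unfolding B_def kx(1) using i by (intro cell_maximal_weak_type_cell) simp
      also have "\<dots> = mean_on M C (f i) * emeasure M C"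
        unfolding kx(1) using i by (subst mean_times_measure) auto
      finally have "mean_on M C (f i) * (2 * of_nat n * emeasure M (B i)) \<le> mean_on M C (f i) * emeasure M C"
        by (simp add: ac_simps)
      then show ?thesis
        using False mean0[OF i] by (subst (asm) ennreal_mult_le_mult_iff) auto
    qed
    have "of_nat n * (2 * emeasure M C) \<le> of_nat n * (2 * (emeasure M (E C) + (\<Sum>i\<in>I. emeasure M (B i))))"
    proof (intro mult_left_mono)
      have "emeasure M C \<le> emeasure M (E C \<union> (\<Union>i\<in>I. B i))"
        using cover \<S>_E[OF C] UB by (intro emeasure_mono) auto
      also have "\<dots> \<le> emeasure M (E C) + emeasure M (\<Union>i\<in>I. B i)"
        using \<S>_E[OF C] UB by (intro emeasure_subadditive) auto
      also have "emeasure M (\<Union>i\<in>I. B i) \<le> (\<Sum>i\<in>I. emeasure M (B i))"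
        using B_sets I by (intro emeasure_subadditive_finite) auto
      finally show "emeasure M C \<le> emeasure M (E C) + (\<Sum>i\<in>I. emeasure M (B i))"
        by (simp add: add_left_mono)
    qed auto
    also have "\<dots> = of_nat n * (2 * emeasure M (E C)) + (\<Sum>i\<in>I. 2 * of_nat n * emeasure M (B i))"
      by (simp add: distrib_left sum_distrib_left ac_simps)
    also have "\<dots> \<le> of_nat n * (2 * emeasure M (E C)) + (\<Sum>i\<in>I. emeasure M C)"
      by (intro add_left_mono sum_mono B_small)
    also have "\<dots> = of_nat n * (2 * emeasure M (E C) + emeasure M C)"
      by (simp add: n_def distrib_left)
    finally have "2 * emeasure M C \<le> 2 * emeasure M (E C) + emeasure M C"
      using n by (subst (asm) ennreal_mult_le_mult_iff) auto
    then have "emeasure M C + emeasure M C \<le> emeasure M C + 2 * emeasure M (E C)"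
      by (simp add: mult_2 ac_simps)
    then show ?thesis
      using finite_cell[of k x] kx(1) by (subst (asm) ennreal_add_left_cancel_le) auto
  qed
  show ?thesis
  proof (rule that[OF \<S>_sub count])
    show "E C \<in> sets M \<and> E C \<subseteq> C \<and> emeasure M C \<le> 2 * emeasure M (E C)" if "C \<in> \<S>" for C
      using \<S>_E[OF that] large[OF that] by (auto simp: E_def)
  next
    fix x C D assume CD: "C \<in> \<S>" "D \<in> \<S>" "x \<in> E C" "x \<in> E D"
    then have x: "x \<in> C" "x \<in> D" by (auto simp: E_def)
    obtain j y k z where "C = cell j y" "D = cell k z"
      using CD(1,2) by (auto simp: \<S>_def)
    with x have "C \<subseteq> D \<or> D \<subseteq> C"
      using cells_comparable by metis
    moreover have "\<not> D \<subset> C" "\<not> C \<subset> D"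
      using CD x unfolding E_def by auto
    ultimately show "C = D" by auto
  next
    fix k x assume F0: "F (cell k x) \<noteq> 0"
    have le: "F (cell k x) \<le> a * G (Suc k) x"
      unfolding G_def using le_stopped_Suc[OF a1, of "\<lambda>j. F (cell j x)" k] by simp
    with F0 have "G (Suc k) x \<noteq> 0" by auto
    then obtain j where "a * G j x < F (cell j x)" "G (Suc k) x = F (cell j x)"
      unfolding G_def using stopped_cases[of a "\<lambda>j. F (cell j x)" "Suc k"] by auto
    then show "\<exists>C\<in>\<S>. x \<in> C \<and> F (cell k x) \<le> a * F C"
      using le cell_self by (intro bexI[of _ "cell j x"]) (auto simp: \<S>_def)
  qed
qed

section \<open>Weights on the cells of nested partitions\<close>

text \<open>
A quantitative form of the fact that weights of Muckenhoupt type belong to \<open>A\<^sub>\<infinity>\<close>. Let \<open>s\<close> be the sum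
of the \<open>e j\<close>. As the powers of the weights multiply to one, Hoelder's inequality on \<open>E\<close> bounds the \<open>s\<close>-th
power of its measure by the product of the powers of \<open>\<integral>\<^sub>E W\<^sub>j\<close>, whereas the hypothesis bounds
the product of the powers of \<open>\<integral>\<^sub>Q W\<^sub>j\<close> by \<open>A\<close> times the \<open>s\<close>-th power of the measure of \<open>Q\<close>.
Enlarging \<open>E\<close> to \<open>Q\<close> in all factors but the \<open>i\<close>-th and cancelling them gives a bound that is linear in \<open>A\<close>.
\<close>

lemma balanced_weights_measure_comparison:
  fixes W :: "'i \<Rightarrow> 'a \<Rightarrow> ennreal" and M :: "'a measure"
  assumes J: "finite J" "\<And>j. j \<in> J \<Longrightarrow> 0 < e j"
    and [measurable]: "\<And>j. j \<in> J \<Longrightarrow> W j \<in> borel_measurable M" "Q \<in> sets M"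
    and balanced: "\<And>x. (\<Prod>j\<in>J. ennpow (W j x) (e j)) = 1"
    and Q: "emeasure M Q \<noteq> 0" "emeasure M Q \<noteq> top"
    and AP: "(\<Prod>j\<in>J. ennpow (mean_on M Q (W j)) (e j)) \<le> A" "A \<noteq> top"
    and i: "i \<in> J"
  shows "(\<integral>\<^sup>+x\<in>Q. W i x \<partial>M) \<noteq> 0" (is "?X i \<noteq> 0") and "(\<integral>\<^sup>+x\<in>Q. W i x \<partial>M) \<noteq> top"
    and "E \<in> sets M \<Longrightarrow> E \<subseteq> Q \<Longrightarrow> emeasure M Q \<le> 2 * emeasure M E \<Longrightarrow>
      ennpow (\<integral>\<^sup>+x\<in>Q. W i x \<partial>M) (e i) \<le> ennreal (2 powr (\<Sum>j\<in>J. e j)) * A * ennpow (\<integral>\<^sup>+x\<in>E. W i x \<partial>M) (e i)"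
proof -
  define s where "s = (\<Sum>j\<in>J. e j)"
  have s: "0 < s" unfolding s_def using J i by (intro sum_pos) auto
  have X0: "?X j \<noteq> 0" if j: "j \<in> J" for j
  proof
    assume "?X j = 0"
    then have "AE x in M. W j x * indicator Q x = 0"
      using j by (subst (asm) nn_integral_0_iff_AE) auto
    moreover have "W j x \<noteq> 0" for x
    proof
      assume "W j x = 0"
      then have "(\<Prod>j\<in>J. ennpow (W j x) (e j)) = 0"
        using J j by (intro prod_zero) (auto intro!: bexI[of _ j])
      with balanced[of x] show False by (simp only: zero_neq_one)
    qed
    ultimately have "AE x in M. x \<notin> Q"
      by (auto elim!: eventually_mono simp: indicator_def split: if_splits)
    then have "emeasure M Q = 0"
      by (subst (asm) AE_iff_measurable[of Q]) (use sets.sets_into_space[of Q M] in auto)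
    with Q show False by simp
  qed
  have mean: "emeasure M Q * mean_on M Q g = (\<integral>\<^sup>+x\<in>Q. g x \<partial>M)" for g
    using Q unfolding mean_on_def by (metis ennreal_divide_times ennreal_divide_self less_top mult_1_right mult.commute)
  have prod_X: "(\<Prod>j\<in>J. ennpow (?X j) (e j)) \<le> ennpow (emeasure M Q) s * A"
  proof -
    have "(\<Prod>j\<in>J. ennpow (?X j) (e j)) = (\<Prod>j\<in>J. ennpow (emeasure M Q) (e j) * ennpow (mean_on M Q (W j)) (e j))"
      by (intro prod.cong refl) (simp add: mean[symmetric] ennpow_mult less_imp_le J)
    also have "\<dots> = ennpow (emeasure M Q) s * (\<Prod>j\<in>J. ennpow (mean_on M Q (W j)) (e j))"
      using J i unfolding s_def by (subst ennpow_sum_exp) (auto simp: prod.distrib)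
    also have "\<dots> \<le> ennpow (emeasure M Q) s * A"
      by (intro mult_left_mono AP) simp
    finally show ?thesis .
  qed
  have fin: "ennpow (emeasure M Q) s * A \<noteq> top"
    using Q s AP by (simp add: ennreal_mult_eq_top_iff ennpow_eq_top_iff)
  have Xtop: "?X j \<noteq> top" if j: "j \<in> J" for j
  proof
    assume "?X j = top"
    then have "ennpow (?X j) (e j) = top" using J j by simp
    then have "(\<Prod>j\<in>J. ennpow (?X j) (e j)) = top"
      unfolding ennreal_prod_eq_top using J j X0 by (auto simp: ennpow_eq_0_iff)
    with prod_X fin show False by (simp add: top_unique)
  qed
  show "?X i \<noteq> 0" "?X i \<noteq> top" using X0 Xtop i by auto
  assume E[measurable]: "E \<in> sets M" and EQ: "E \<subseteq> Q" "emeasure M Q \<le> 2 * emeasure M E"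
  let ?Y = "\<lambda>j. \<integral>\<^sup>+x\<in>E. W j x \<partial>M"
  have "emeasure M E = (\<integral>\<^sup>+x. (\<Prod>j\<in>J. ennpow (W j x * indicator E x) (e j / s)) \<partial>M)"
  proof -
    have "(\<Prod>j\<in>J. ennpow (W j x * indicator E x) (e j / s)) = indicator E x" for x
    proof (cases "x \<in> E")
      case True
      have "(\<Prod>j\<in>J. ennpow (W j x) (e j / s)) = ennpow (\<Prod>j\<in>J. ennpow (W j x) (e j)) (1 / s)"
        using s J by (subst ennpow_prod) (auto simp: ennpow_ennpow intro!: prod.cong)
      with True show ?thesis by (simp add: balanced)
    next
      case False
      then have "(\<Prod>j\<in>J. ennpow (W j x * indicator E x) (e j / s)) = 0"
        using J i s by (intro prod_zero) (auto intro!: bexI[of _ i])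
      moreover have "indicator E x = (0::ennreal)" using False by simp
      ultimately show ?thesis by (simp only:)
    qed
    then show ?thesis by simp
  qed
  also have "\<dots> \<le> (\<Prod>j\<in>J. ennpow (?Y j) (e j / s))"
    using J s by (intro Holder_nn_integral) (auto simp: s_def sum_divide_distrib[symmetric])
  finally have "ennpow (emeasure M E) s \<le> ennpow (\<Prod>j\<in>J. ennpow (?Y j) (e j / s)) s"
    using s by (intro ennpow_mono) auto
  also have "\<dots> = (\<Prod>j\<in>J. ennpow (?Y j) (e j))"
    using s J by (subst ennpow_prod) (auto simp: ennpow_ennpow intro!: prod.cong)
  finally have E_le: "ennpow (emeasure M E) s \<le> (\<Prod>j\<in>J. ennpow (?Y j) (e j))" .
  have Q_le: "ennpow (emeasure M Q) s \<le> ennreal (2 powr s) * ennpow (emeasure M E) s"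
    using ennpow_mono[OF less_imp_le[OF s] EQ(2)] s ennpow_ennreal[of 2 s] by (simp add: ennpow_mult)
  let ?R = "\<Prod>j\<in>J - {i}. ennpow (?X j) (e j)"
  have "?R * ennpow (?X i) (e i) = (\<Prod>j\<in>J. ennpow (?X j) (e j))"
    using J i by (subst prod.remove[of J i]) (auto simp: mult.commute)
  also have "\<dots> \<le> ennpow (emeasure M Q) s * A" by (rule prod_X)
  also have "\<dots> \<le> ennreal (2 powr s) * (\<Prod>j\<in>J. ennpow (?Y j) (e j)) * A"
    by (intro mult_right_mono order_trans[OF Q_le] mult_left_mono E_le) auto
  also have "(\<Prod>j\<in>J. ennpow (?Y j) (e j)) = ennpow (?Y i) (e i) * (\<Prod>j\<in>J - {i}. ennpow (?Y j) (e j))"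
    using J i by (subst prod.remove[of J i]) auto
  also have "ennreal (2 powr s) * \<dots> * A \<le> ennreal (2 powr s) * (ennpow (?Y i) (e i) * ?R) * A"
    using EQ(1) J
    by (intro mult_right_mono mult_left_mono prod_mono_ennreal ennpow_mono nn_integral_mono)
       (auto simp: indicator_def less_imp_le)
  also have "\<dots> = ?R * (ennreal (2 powr s) * A * ennpow (?Y i) (e i))"
    by (simp add: ac_simps)
  finally have "?R * ennpow (?X i) (e i) \<le> ?R * (ennreal (2 powr s) * A * ennpow (?Y i) (e i))" .
  moreover have "?R \<noteq> 0"
    using J X0 by (auto simp: ennpow_eq_0_iff)
  moreover have "?R \<noteq> top"
    unfolding ennreal_prod_eq_top using J Xtop by (auto simp: ennpow_eq_top_iff)
  ultimately show "ennpow (?X i) (e i) \<le> ennreal (2 powr (\<Sum>j\<in>J. e j)) * A * ennpow (?Y i) (e i)"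
    unfolding s_def[symmetric] by (subst (asm) ennreal_mult_le_mult_iff) auto
qed

text \<open>
The weights are real and positive here; weights with values in \<^typ>\<open>ennreal\<close> are changed on a null set first.
\<close>

definition dual_weight :: "(nat \<Rightarrow> real) \<Rightarrow> (nat \<Rightarrow> 'a \<Rightarrow> real) \<Rightarrow> nat \<Rightarrow> 'a \<Rightarrow> ennreal" where
  "dual_weight P w i x = ennreal (w i x powr (1 - conj_exponent (P i)))"

definition joint_weight :: "nat \<Rightarrow> real \<Rightarrow> (nat \<Rightarrow> real) \<Rightarrow> (nat \<Rightarrow> 'a \<Rightarrow> real) \<Rightarrow> 'a \<Rightarrow> ennreal" where
  "joint_weight m p P w x = ennreal (\<Prod>i = 1..m. w i x powr (p / P i))"

lemma conj_exponent_gt_1: "1 < q \<Longrightarrow> 1 < conj_exponent q"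
  by (simp add: conj_exponent_def field_simps)

lemma conj_exponent_sub_1: "1 < q \<Longrightarrow> conj_exponent q - 1 = 1 / (q - 1)"
  by (simp add: conj_exponent_def field_simps)

lemma divide_conj_exponent: "1 < q \<Longrightarrow> x / conj_exponent q = x - x / q"
  by (simp add: conj_exponent_def field_simps)

text \<open>
The constants are written out since a bound for all weights needs them not to depend on the weights.
\<close>

definition strong_const :: "real \<Rightarrow> ennreal" where
  "strong_const q = ennreal (2 powr q * q / (q - 1))"

definition doubling_exponent :: "nat \<Rightarrow> real \<Rightarrow> (nat \<Rightarrow> real) \<Rightarrow> real" where
  "doubling_exponent m p P = 1 + (\<Sum>i = 1..m. p / conj_exponent (P i))"

definition sparse_const :: "nat \<Rightarrow> real \<Rightarrow> (nat \<Rightarrow> real) \<Rightarrow> ennreal" where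
  "sparse_const m p P = ennpow ((2 * of_nat m) ^ m) p *
     (\<Prod>i = 1..m. ennpow (ennreal (2 powr doubling_exponent m p P)) (1 / (P i - 1)) *
       ennpow (strong_const (P i)) (p / P i))"

lemma sparse_const_finite:
  assumes "0 < p" "\<And>i. i \<in> {1..m} \<Longrightarrow> 1 < P i"
  shows "sparse_const m p P \<noteq> top"
proof -
  have "(2 * of_nat m) ^ m \<noteq> (top :: ennreal)"
    by (simp add: ennreal_mult_eq_top_iff power_eq_top_ennreal)
  then have "ennpow ((2 * of_nat m) ^ m) p \<noteq> top"
    using assms by (simp add: ennpow_eq_top_iff)
  moreover have "ennpow (ennreal (2 powr doubling_exponent m p P)) (1 / (P i - 1)) * ennpow (strong_const (P i)) (p / P i) \<noteq> top"
    if "i \<in> {1..m}" for i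
    using assms(1) assms(2)[OF that] by (simp add: ennreal_mult_eq_top_iff ennpow_eq_top_iff strong_const_def)
  ultimately show ?thesis
    unfolding sparse_const_def by (simp add: ennreal_mult_eq_top_iff ennreal_prod_eq_top)
qed

locale multilinear_exponents =
  fixes m :: nat and p :: real and P :: "nat \<Rightarrow> real"
  assumes m: "1 \<le> m"
    and P: "\<And>i. i \<in> {1..m} \<Longrightarrow> 1 < P i"
    and p: "1 / p = (\<Sum>i = 1..m. 1 / P i)"
begin

lemma P_pos: "i \<in> {1..m} \<Longrightarrow> 0 < P i"
  using P[of i] by simp

lemma p_pos: "0 < p"
proof -
  have "0 < (\<Sum>i = 1..m. 1 / P i)"
    using m P_pos by (intro sum_pos) auto
  then show ?thesis using p by (metis zero_less_divide_1_iff)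
qed

lemma conj_pos: "i \<in> {1..m} \<Longrightarrow> 0 < conj_exponent (P i)"
  using conj_exponent_gt_1[of "P i"] P[of i] by simp

lemma exponent_pos: "i \<in> {1..m} \<Longrightarrow> 0 < p / conj_exponent (P i)"
  using p_pos conj_pos by simp

lemma sum_p_P: "(\<Sum>i = 1..m. p / P i) = 1"
proof -
  have "(\<Sum>i = 1..m. p / P i) = p * (1 / p)" unfolding p by (simp add: sum_distrib_left)
  then show ?thesis using p_pos by simp
qed

lemma sum_p_conj: "(\<Sum>i = 1..m. p / conj_exponent (P i)) = real m * p - 1"
proof -
  have "(\<Sum>i = 1..m. p / conj_exponent (P i)) = (\<Sum>i = 1..m. p - p / P i)"
    using P by (intro sum.cong) (auto simp: divide_conj_exponent)
  then show ?thesis using sum_p_P by (simp add: sum_subtractf)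
qed

lemma mp_gt_1: "0 < real m * p - 1"
  unfolding sum_p_conj[symmetric] using m exponent_pos by (intro sum_pos) auto

end

text \<open>
The weight condition is imposed on the cells only, with a bound \<open>A\<close> for the constant of the weights.
\<close>

locale weighted_cells = nested_partitions M cell + multilinear_exponents m p P
  for M :: "'a measure" and cell :: "nat \<Rightarrow> 'a \<Rightarrow> 'a set" and m p P +
  fixes w :: "nat \<Rightarrow> 'a \<Rightarrow> real" and A :: ennreal
  assumes measurable_w [measurable]: "\<And>i. i \<in> {1..m} \<Longrightarrow> w i \<in> borel_measurable M"
    and w_pos: "\<And>i x. i \<in> {1..m} \<Longrightarrow> 0 < w i x"
    and cell_pos: "\<And>k x. emeasure M (cell k x) \<noteq> 0"
    and A_finite: "A \<noteq> top"
    and AP: "\<And>k x. mean_on M (cell k x) (joint_weight m p P w) *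
        (\<Prod>i = 1..m. ennpow (mean_on M (cell k x) (dual_weight P w i)) (p / conj_exponent (P i))) \<le> A"
begin

abbreviation "\<sigma> \<equiv> dual_weight P w"
abbreviation "\<nu> \<equiv> joint_weight m p P w"

lemma measurable_dual_weight [measurable]: "i \<in> {1..m} \<Longrightarrow> \<sigma> i \<in> borel_measurable M"
  unfolding dual_weight_def by measurable

lemma measurable_joint_weight [measurable]: "\<nu> \<in> borel_measurable M"
  unfolding joint_weight_def by measurable

lemma w_nonzero [simp]: "i \<in> {1..m} \<Longrightarrow> w i x \<noteq> 0"
  using w_pos[of i x] by simp

lemma balanced: "\<nu> x * (\<Prod>i = 1..m. ennpow (\<sigma> i x) (p / conj_exponent (P i))) = 1"
proof -
  have "ennpow (\<sigma> i x) (p / conj_exponent (P i)) = ennreal (w i x powr (- (p / P i)))" if i: "i \<in> {1..m}" for i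
  proof -
    have "(1 - conj_exponent (P i)) * (p / conj_exponent (P i)) = - (p / P i)"
      using P[OF i] by (simp add: conj_exponent_def divide_simps)
    then show ?thesis
      using w_pos[OF i, of x] by (simp add: dual_weight_def ennpow_ennreal powr_powr)
  qed
  then have "(\<Prod>i = 1..m. ennpow (\<sigma> i x) (p / conj_exponent (P i))) = ennreal (\<Prod>i = 1..m. w i x powr (- (p / P i)))"
    by (subst prod_ennreal[symmetric]) (auto intro: prod.cong)
  then have "\<nu> x * (\<Prod>i = 1..m. ennpow (\<sigma> i x) (p / conj_exponent (P i))) =
      ennreal ((\<Prod>i = 1..m. w i x powr (p / P i)) * (\<Prod>i = 1..m. w i x powr (- (p / P i))))"
    unfolding joint_weight_def by (simp add: ennreal_mult prod_nonneg)
  also have "(\<Prod>i = 1..m. w i x powr (p / P i)) * (\<Prod>i = 1..m. w i x powr (- (p / P i))) = (\<Prod>i = 1..m. 1)"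
    unfolding prod.distrib[symmetric] by (intro prod.cong refl) (simp add: powr_add[symmetric])
  finally show ?thesis by simp
qed

text \<open>
The comparison of measures for the family consisting of \<open>\<nu>\<close>, with exponent \<open>1\<close> and index \<open>0\<close>, and of the
\<open>\<sigma> i\<close>, with exponents \<open>p / p\<^sub>i'\<close>.
\<close>

lemma cell_weights:
  shows joint_weight_cell: "(\<integral>\<^sup>+y\<in>cell k x. \<nu> y \<partial>M) \<noteq> 0" "(\<integral>\<^sup>+y\<in>cell k x. \<nu> y \<partial>M) \<noteq> top"
    and dual_weight_cell: "i \<in> {1..m} \<Longrightarrow> (\<integral>\<^sup>+y\<in>cell k x. \<sigma> i y \<partial>M) \<noteq> 0" "i \<in> {1..m} \<Longrightarrow> (\<integral>\<^sup>+y\<in>cell k x. \<sigma> i y \<partial>M) \<noteq> top"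
    and dual_weight_comparison: "i \<in> {1..m} \<Longrightarrow> E \<in> sets M \<Longrightarrow> E \<subseteq> cell k x \<Longrightarrow>
      emeasure M (cell k x) \<le> 2 * emeasure M E \<Longrightarrow>
      (\<integral>\<^sup>+y\<in>cell k x. \<sigma> i y \<partial>M) \<le>
        ennpow (ennreal (2 powr doubling_exponent m p P) * A) (conj_exponent (P i) / p) * (\<integral>\<^sup>+y\<in>E. \<sigma> i y \<partial>M)"
proof -
  define J where "J = insert 0 {1..m}"
  define W where "W j = (if j = 0 then \<nu> else \<sigma> j)" for j
  define e where "e j = (if j = 0 then 1 else p / conj_exponent (P j))" for j
  have prodJ: "(\<Prod>j\<in>J. h j) = h 0 * (\<Prod>i=1..m. h i)" for h :: "nat \<Rightarrow> ennreal"
    unfolding J_def by (subst prod.insert) auto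
  have e: "finite J" "\<And>j. j \<in> J \<Longrightarrow> 0 < e j"
    using p_pos conj_pos by (auto simp: J_def e_def)
  have sum_e: "(\<Sum>j\<in>J. e j) = doubling_exponent m p P"
    unfolding J_def doubling_exponent_def by (subst sum.insert) (auto simp: e_def)
  have W: "W j \<in> borel_measurable M" if "j \<in> J" for j
    using that by (auto simp: J_def W_def)
  have bal: "(\<Prod>j\<in>J. ennpow (W j x) (e j)) = 1" for x
  proof -
    have "(\<Prod>i=1..m. ennpow (W i x) (e i)) = (\<Prod>i=1..m. ennpow (\<sigma> i x) (p / conj_exponent (P i)))"
      by (intro prod.cong) (auto simp: W_def e_def)
    then show ?thesis
      unfolding prodJ using balanced[of x] by (simp add: W_def e_def)
  qed
  have AP': "(\<Prod>j\<in>J. ennpow (mean_on M (cell k x) (W j)) (e j)) \<le> A"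
  proof -
    have "(\<Prod>i=1..m. ennpow (mean_on M (cell k x) (W i)) (e i)) =
        (\<Prod>i=1..m. ennpow (mean_on M (cell k x) (\<sigma> i)) (p / conj_exponent (P i)))"
      by (intro prod.cong) (auto simp: W_def e_def)
    then show ?thesis
      unfolding prodJ using AP[of k x] by (simp add: W_def e_def)
  qed
  note facts = e W sets_cell bal cell_pos finite_cell AP' A_finite
  have pos: "(\<integral>\<^sup>+y\<in>cell k x. W j y \<partial>M) \<noteq> 0" if "j \<in> J" for j
    by (rule balanced_weights_measure_comparison(1)[of J e W M "cell k x" A]) (rule facts that | assumption)+
  have fin: "(\<integral>\<^sup>+y\<in>cell k x. W j y \<partial>M) \<noteq> top" if "j \<in> J" for j
    by (rule balanced_weights_measure_comparison(2)[of J e W M "cell k x" A]) (rule facts that | assumption)+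
  show "(\<integral>\<^sup>+y\<in>cell k x. \<nu> y \<partial>M) \<noteq> 0" "(\<integral>\<^sup>+y\<in>cell k x. \<nu> y \<partial>M) \<noteq> top"
    using pos[of 0] fin[of 0] by (simp_all add: W_def J_def)
  assume i: "i \<in> {1..m}"
  then have Wi: "W i = \<sigma> i" "e i = p / conj_exponent (P i)" "i \<in> J"
    by (auto simp: W_def e_def J_def)
  show "(\<integral>\<^sup>+y\<in>cell k x. \<sigma> i y \<partial>M) \<noteq> 0" "(\<integral>\<^sup>+y\<in>cell k x. \<sigma> i y \<partial>M) \<noteq> top"
    using pos[OF Wi(3)] fin[OF Wi(3)] Wi by simp_all
  assume E: "E \<in> sets M" "E \<subseteq> cell k x" "emeasure M (cell k x) \<le> 2 * emeasure M E"
  have "ennpow (\<integral>\<^sup>+y\<in>cell k x. \<sigma> i y \<partial>M) (p / conj_exponent (P i)) \<le>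
      ennreal (2 powr doubling_exponent m p P) * A * ennpow (\<integral>\<^sup>+y\<in>E. \<sigma> i y \<partial>M) (p / conj_exponent (P i))"
  proof -
    have "ennpow (\<integral>\<^sup>+y\<in>cell k x. W i y \<partial>M) (e i) \<le>
        ennreal (2 powr (\<Sum>j\<in>J. e j)) * A * ennpow (\<integral>\<^sup>+y\<in>E. W i y \<partial>M) (e i)"
      by (rule balanced_weights_measure_comparison(3)[of J e W M "cell k x" A])
        (rule facts Wi(3) E | assumption)+
    then show ?thesis unfolding Wi sum_e .
  qed
  then show "(\<integral>\<^sup>+y\<in>cell k x. \<sigma> i y \<partial>M) \<le>
        ennpow (ennreal (2 powr doubling_exponent m p P) * A) (conj_exponent (P i) / p) * (\<integral>\<^sup>+y\<in>E. \<sigma> i y \<partial>M)"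
    using p_pos conj_pos[OF i]
    by (subst (asm) ennpow_le_iff) (auto simp: ennpow_mult ennpow_ennpow)
qed

lemma nested_partitions_density:
  assumes [measurable]: "h \<in> borel_measurable M" and fin: "\<And>k x. (\<integral>\<^sup>+y\<in>cell k x. h y \<partial>M) \<noteq> top"
  shows "nested_partitions (density M h) cell"
  using cell_self cell_eq cell_Suc countable_cells fin
  by unfold_locales (auto simp: space_UNIV emeasure_density)

lemma nested_partitions_dual: "i \<in> {1..m} \<Longrightarrow> nested_partitions (density M (\<sigma> i)) cell"
  by (rule nested_partitions_density[OF measurable_dual_weight dual_weight_cell(2)])

lemma nested_partitions_joint: "nested_partitions (density M \<nu>) cell"
  by (rule nested_partitions_density[OF measurable_joint_weight joint_weight_cell(2)])

text \<open>
The quotient \<open>f i / \<sigma> i\<close>. Means of \<open>f i\<close> become means of this function with respect to \<open>\<sigma> i\<close>, and its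
norm in \<open>L\<close> of \<open>\<sigma> i\<close> is the norm of \<open>f i\<close> in \<open>L\<close> of \<open>w i\<close>, with the same exponent \<open>p\<^sub>i\<close>.
\<close>

definition quotient_fun :: "(nat \<Rightarrow> 'a \<Rightarrow> ennreal) \<Rightarrow> nat \<Rightarrow> 'a \<Rightarrow> ennreal" where
  "quotient_fun f i x = f i x * ennreal (w i x powr (conj_exponent (P i) - 1))"

lemma measurable_quotient_fun [measurable]:
  "i \<in> {1..m} \<Longrightarrow> f i \<in> borel_measurable M \<Longrightarrow> quotient_fun f i \<in> borel_measurable M"
proof -
  assume "i \<in> {1..m}" and [measurable]: "f i \<in> borel_measurable M"
  then have [measurable]: "w i \<in> borel_measurable M" by simp
  show ?thesis unfolding quotient_fun_def by measurable
qed

lemma dual_times_quotient_fun: "i \<in> {1..m} \<Longrightarrow> \<sigma> i x * quotient_fun f i x = f i x"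
proof -
  assume i: "i \<in> {1..m}"
  have "\<sigma> i x * quotient_fun f i x =
      f i x * (ennreal (w i x powr (1 - conj_exponent (P i))) * ennreal (w i x powr (conj_exponent (P i) - 1)))"
    by (simp add: dual_weight_def quotient_fun_def ac_simps)
  also have "ennreal (w i x powr (1 - conj_exponent (P i))) * ennreal (w i x powr (conj_exponent (P i) - 1)) = 1"
    using i by (simp add: ennreal_mult[symmetric] powr_add[symmetric])
  finally show ?thesis by simp
qed

lemma nn_integral_quotient_fun:
  assumes i: "i \<in> {1..m}" and [measurable]: "f i \<in> borel_measurable M"
  shows "(\<integral>\<^sup>+x. ennpow (quotient_fun f i x) (P i) \<partial>density M (\<sigma> i)) =
    (\<integral>\<^sup>+x. ennpow (f i x) (P i) * ennreal (w i x) \<partial>M)"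
proof -
  have "\<sigma> i x * ennpow (quotient_fun f i x) (P i) = ennpow (f i x) (P i) * ennreal (w i x)" for x
  proof -
    let ?q = "conj_exponent (P i)"
    have "(1 - ?q) + (?q - 1) * P i = 1"
    proof -
      have "(1 - ?q) + (?q - 1) * P i = (?q - 1) * (P i - 1)" by (simp add: algebra_simps)
      then show ?thesis using P[OF i] by (simp add: conj_exponent_sub_1)
    qed
    then have "w i x powr (1 - ?q) * (w i x powr (?q - 1)) powr P i = w i x"
      using w_pos[OF i, of x] by (simp add: powr_powr powr_add[symmetric])
    then have "ennreal (w i x powr (1 - ?q)) * ennpow (ennreal (w i x powr (?q - 1))) (P i) = ennreal (w i x)"
      using i by (subst ennpow_ennreal) (auto simp: ennreal_mult[symmetric])
    then show ?thesis
      using P_pos[OF i] by (simp add: dual_weight_def quotient_fun_def ennpow_mult mult.left_commute)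
  qed
  then show ?thesis
    using i by (subst nn_integral_density) auto
qed

lemma mean_quotient_fun:
  assumes i: "i \<in> {1..m}" and [measurable]: "f i \<in> borel_measurable M"
  shows "mean_on M (cell k x) (f i) =
    mean_on (density M (\<sigma> i)) (cell k x) (quotient_fun f i) * mean_on M (cell k x) (\<sigma> i)"
proof -
  have "(\<integral>\<^sup>+y\<in>cell k x. quotient_fun f i y \<partial>density M (\<sigma> i)) = (\<integral>\<^sup>+y\<in>cell k x. f i y \<partial>M)"
    using i by (subst nn_integral_density) (auto simp: mult.assoc[symmetric] dual_times_quotient_fun)
  then have "mean_on (density M (\<sigma> i)) (cell k x) (quotient_fun f i) =
      (\<integral>\<^sup>+y\<in>cell k x. f i y \<partial>M) / (\<integral>\<^sup>+y\<in>cell k x. \<sigma> i y \<partial>M)"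
    using i by (simp add: mean_on_def emeasure_density)
  then show ?thesis
    using dual_weight_cell[OF i, of k x] unfolding mean_on_def
    by (simp add: ennreal_times_divide ennreal_divide_times less_top)
qed

lemma dual_maximal_bound:
  assumes i: "i \<in> {1..m}" and [measurable]: "f i \<in> borel_measurable M"
  shows "(\<integral>\<^sup>+x. ennpow (cell_maximal (density M (\<sigma> i)) cell (quotient_fun f i) x) (P i) \<partial>density M (\<sigma> i))
      \<le> strong_const (P i) * (\<integral>\<^sup>+x. ennpow (f i x) (P i) * ennreal (w i x) \<partial>M)"
  unfolding nn_integral_quotient_fun[of i f, OF assms, symmetric] strong_const_def
  using i P[OF i]
  by (intro nested_partitions.cell_maximal_strong_type nested_partitions_dual) (auto intro: measurable_quotient_fun)

section \<open>The mixed bound\<close>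

text \<open>
Write \<open>p = p / p\<^sub>i' + p / p\<^sub>i\<close> in the exponent of the mean of \<open>\<sigma> i\<close>. The first summands, together with
the mean of \<open>\<nu>\<close>, form the expression of the weight condition; the second ones turn into
\<open>\<integral> \<sigma> i\<close> with the help of the measure of the cell, because the \<open>p / p\<^sub>i\<close> add up to one.
\<close>

lemma cell_energy_bound:
  assumes [measurable]: "\<And>i. i \<in> {1..m} \<Longrightarrow> f i \<in> borel_measurable M"
  shows "ennpow (\<Prod>i = 1..m. mean_on M (cell k x) (f i)) p * (\<integral>\<^sup>+y\<in>cell k x. \<nu> y \<partial>M) \<le>
    A * (\<Prod>i = 1..m. ennpow (ennpow (mean_on (density M (\<sigma> i)) (cell k x) (quotient_fun f i)) (P i) *
           (\<integral>\<^sup>+y\<in>cell k x. \<sigma> i y \<partial>M)) (p / P i))"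
proof -
  let ?C = "cell k x"
  let ?a = "\<lambda>i. mean_on (density M (\<sigma> i)) ?C (quotient_fun f i)"
  let ?s = "\<lambda>i. mean_on M ?C (\<sigma> i)"
  let ?c = "emeasure M ?C"
  have "ennpow (mean_on M ?C (f i)) p * ennpow ?c (p / P i) =
      ennpow (?s i) (p / conj_exponent (P i)) * ennpow (ennpow (?a i) (P i) * (\<integral>\<^sup>+y\<in>?C. \<sigma> i y \<partial>M)) (p / P i)"
    if i: "i \<in> {1..m}" for i
  proof -
    have pos: "0 < p / P i" "0 < p / conj_exponent (P i)"
      using p_pos P_pos[OF i] conj_pos[OF i] by auto
    have p_eq: "p = p / conj_exponent (P i) + p / P i"
      using P[OF i] by (simp add: divide_conj_exponent)
    have "ennpow (mean_on M ?C (f i)) p = ennpow (?a i) p * ennpow (?s i) p"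
      using p_pos i by (subst mean_quotient_fun) (auto simp: ennpow_mult)
    also have "ennpow (?s i) p = ennpow (?s i) (p / conj_exponent (P i)) * ennpow (?s i) (p / P i)"
      by (subst p_eq) (rule ennpow_add[OF pos(2,1)])
    also have "ennpow (?a i) p = ennpow (ennpow (?a i) (P i)) (p / P i)"
      using pos P_pos[OF i] by (simp add: ennpow_ennpow)
    finally have "ennpow (mean_on M ?C (f i)) p =
        ennpow (ennpow (?a i) (P i)) (p / P i) * (ennpow (?s i) (p / conj_exponent (P i)) * ennpow (?s i) (p / P i))" .
    moreover have "(\<integral>\<^sup>+y\<in>?C. \<sigma> i y \<partial>M) = ?s i * ?c"
      using i by (subst mean_times_measure) auto
    ultimately show ?thesis
      using pos by (simp only: ennpow_mult less_imp_le ac_simps)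
  qed
  then have "(\<Prod>i = 1..m. ennpow (mean_on M ?C (f i)) p * ennpow ?c (p / P i)) =
      (\<Prod>i = 1..m. ennpow (?s i) (p / conj_exponent (P i)) *
        ennpow (ennpow (?a i) (P i) * (\<integral>\<^sup>+y\<in>?C. \<sigma> i y \<partial>M)) (p / P i))"
    by (rule prod.cong[OF refl])
  moreover have "(\<Prod>i = 1..m. ennpow ?c (p / P i)) = ?c"
    using m p_pos P_pos sum_p_P by (subst ennpow_sum_exp[symmetric]) auto
  ultimately have eq: "ennpow (\<Prod>i = 1..m. mean_on M ?C (f i)) p * ?c =
      (\<Prod>i = 1..m. ennpow (?s i) (p / conj_exponent (P i))) *
      (\<Prod>i = 1..m. ennpow (ennpow (?a i) (P i) * (\<integral>\<^sup>+y\<in>?C. \<sigma> i y \<partial>M)) (p / P i))"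
    using p_pos by (simp add: ennpow_prod prod.distrib)
  have "ennpow (\<Prod>i = 1..m. mean_on M ?C (f i)) p * (\<integral>\<^sup>+y\<in>?C. \<nu> y \<partial>M) =
      mean_on M ?C \<nu> * (ennpow (\<Prod>i = 1..m. mean_on M ?C (f i)) p * ?c)"
    by (subst mean_times_measure[symmetric]) (auto simp: ac_simps)
  also have "\<dots> = (mean_on M ?C \<nu> * (\<Prod>i = 1..m. ennpow (?s i) (p / conj_exponent (P i)))) *
      (\<Prod>i = 1..m. ennpow (ennpow (?a i) (P i) * (\<integral>\<^sup>+y\<in>?C. \<sigma> i y \<partial>M)) (p / P i))"
    unfolding eq by (simp only: mult.assoc)
  also have "\<dots> \<le> A * (\<Prod>i = 1..m. ennpow (ennpow (?a i) (P i) * (\<integral>\<^sup>+y\<in>?C. \<sigma> i y \<partial>M)) (p / P i))"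
    by (intro mult_right_mono AP) simp
  finally show ?thesis .
qed

text \<open>
The mass of \<open>\<sigma> i\<close> on a cell of the sparse family is comparable with its mass on the private part of the cell.
On that part the mean over the cell is at most the maximal function, and the parts are disjoint, so the sum is at
most the integral of the maximal function.
\<close>

lemma carleson_embedding:
  assumes i: "i \<in> {1..m}" and [measurable]: "f i \<in> borel_measurable M"
    and \<S>: "\<S> \<subseteq> (\<Union>k. range (cell k))" "countable \<S>"
    and E: "\<And>C. C \<in> \<S> \<Longrightarrow> E C \<in> sets M \<and> E C \<subseteq> C \<and> emeasure M C \<le> 2 * emeasure M (E C)"
    and disj: "\<And>x C D. C \<in> \<S> \<Longrightarrow> D \<in> \<S> \<Longrightarrow> x \<in> E C \<Longrightarrow> x \<in> E D \<Longrightarrow> C = D"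
  shows "(\<integral>\<^sup>+C. ennpow (mean_on (density M (\<sigma> i)) C (quotient_fun f i)) (P i) * (\<integral>\<^sup>+y\<in>C. \<sigma> i y \<partial>M) \<partial>count_space \<S>)
    \<le> ennpow (ennreal (2 powr doubling_exponent m p P) * A) (conj_exponent (P i) / p) *
      (strong_const (P i) * (\<integral>\<^sup>+x. ennpow (f i x) (P i) * ennreal (w i x) \<partial>M))"
proof -
  let ?D = "density M (\<sigma> i)"
  let ?a = "\<lambda>C. mean_on ?D C (quotient_fun f i)"
  let ?K = "ennpow (ennreal (2 powr doubling_exponent m p P) * A) (conj_exponent (P i) / p)"
  interpret D: nested_partitions ?D cell by (rule nested_partitions_dual[OF i])
  have [measurable]: "quotient_fun f i \<in> borel_measurable M"
    using i by (rule measurable_quotient_fun) measurable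
  have "(\<integral>\<^sup>+C. ennpow (?a C) (P i) * (\<integral>\<^sup>+y\<in>C. \<sigma> i y \<partial>M) \<partial>count_space \<S>) \<le>
      (\<integral>\<^sup>+C. ?K * (\<integral>\<^sup>+x. ennpow (?a C) (P i) * indicator (E C) x \<partial>?D) \<partial>count_space \<S>)"
  proof (rule nn_integral_mono)
    fix C assume "C \<in> space (count_space \<S>)"
    then have C: "C \<in> \<S>" by simp
    then obtain k x where kx: "C = cell k x" using \<S> by auto
    have "ennpow (?a C) (P i) * (\<integral>\<^sup>+y\<in>C. \<sigma> i y \<partial>M) \<le> ennpow (?a C) (P i) * (?K * (\<integral>\<^sup>+y\<in>E C. \<sigma> i y \<partial>M))"
      using E[OF C] unfolding kx by (intro mult_left_mono dual_weight_comparison[OF i]) auto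
    also have "(\<integral>\<^sup>+y\<in>E C. \<sigma> i y \<partial>M) = emeasure ?D (E C)"
      using E[OF C] i by (subst emeasure_density) auto
    finally show "ennpow (?a C) (P i) * (\<integral>\<^sup>+y\<in>C. \<sigma> i y \<partial>M) \<le>
        ?K * (\<integral>\<^sup>+x. ennpow (?a C) (P i) * indicator (E C) x \<partial>?D)"
      using E[OF C] by (subst nn_integral_cmult_indicator) (auto simp: ac_simps)
  qed
  also have "\<dots> = ?K * (\<integral>\<^sup>+C. (\<integral>\<^sup>+x. ennpow (?a C) (P i) * indicator (E C) x \<partial>?D) \<partial>count_space \<S>)"
    by (rule nn_integral_cmult) simp
  also have "(\<integral>\<^sup>+C. (\<integral>\<^sup>+x. ennpow (?a C) (P i) * indicator (E C) x \<partial>?D) \<partial>count_space \<S>) =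
      (\<integral>\<^sup>+x. (\<integral>\<^sup>+C. ennpow (?a C) (P i) * indicator (E C) x \<partial>count_space \<S>) \<partial>?D)"
  proof (rule nn_integral_count_space_nn_integral[symmetric, OF \<S>(2)])
    fix C assume "C \<in> \<S>"
    then have [measurable]: "E C \<in> sets M" using E by simp
    show "(\<lambda>x. ennpow (?a C) (P i) * indicator (E C) x) \<in> borel_measurable ?D" by measurable
  qed
  also have "\<dots> \<le> (\<integral>\<^sup>+x. ennpow (cell_maximal ?D cell (quotient_fun f i) x) (P i) \<partial>?D)"
  proof (rule nn_integral_mono)
    fix x
    show "(\<integral>\<^sup>+C. ennpow (?a C) (P i) * indicator (E C) x \<partial>count_space \<S>) \<le>
        ennpow (cell_maximal ?D cell (quotient_fun f i) x) (P i)"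
    proof (cases "\<exists>C\<in>\<S>. x \<in> E C")
      case True
      then obtain C where C: "C \<in> \<S>" "x \<in> E C" by auto
      have "(\<integral>\<^sup>+C. ennpow (?a C) (P i) * indicator (E C) x \<partial>count_space \<S>) =
          (\<Sum>C\<in>{C}. ennpow (?a C) (P i) * indicator (E C) x)"
        using C disj by (intro nn_integral_count_space') (auto simp: indicator_def)
      also have "\<dots> \<le> ennpow (?a C) (P i)"
        using C by simp
      also have "\<dots> \<le> ennpow (cell_maximal ?D cell (quotient_fun f i) x) (P i)"
      proof (rule ennpow_mono)
        obtain k z where "C = cell k z" using C \<S> by auto
        then have "C = cell k x" using E[OF C(1)] C(2) cell_eq by blast
        then show "?a C \<le> cell_maximal ?D cell (quotient_fun f i) x"
          unfolding cell_maximal_def by (auto intro: SUP_upper)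
      qed (use P_pos[OF i] in simp)
      finally show ?thesis .
    next
      case False
      then have "(\<integral>\<^sup>+C. ennpow (?a C) (P i) * indicator (E C) x \<partial>count_space \<S>) = (\<integral>\<^sup>+C. 0 \<partial>count_space \<S>)"
        by (intro nn_integral_cong) (auto simp: indicator_def)
      then show ?thesis by (simp only: nn_integral_const mult_zero_left zero_le)
    qed
  qed
  also have "\<dots> \<le> strong_const (P i) * (\<integral>\<^sup>+x. ennpow (f i x) (P i) * ennreal (w i x) \<partial>M)"
    using i by (rule dual_maximal_bound) measurable
  finally show ?thesis
    by (simp add: mult_left_mono)
qed

text \<open>
At each point the \<open>p\<close>-th power of the maximal function is dominated by a single term of the sum over the sparse
family, so no summation of geometric series is involved. Hoelder's inequality with exponents \<open>p / p\<^sub>i\<close> then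
splits the sum into the sums of \<open>carleson_embedding\<close>.
\<close>

theorem multilinear_cell_maximal_mixed_bound:
  assumes [measurable]: "\<And>i. i \<in> {1..m} \<Longrightarrow> f i \<in> borel_measurable M"
  shows "(\<integral>\<^sup>+x. ennpow (SUP k. \<Prod>i = 1..m. mean_on M (cell k x) (f i)) p * \<nu> x \<partial>M) \<le>
    sparse_const m p P * ennpow A (1 + (\<Sum>i = 1..m. 1 / (P i - 1))) *
    (\<Prod>i = 1..m. ennpow (\<integral>\<^sup>+x. ennpow (f i x) (P i) * ennreal (w i x) \<partial>M) (p / P i))"
proof -
  let ?F = "\<lambda>C. \<Prod>i = 1..m. mean_on M C (f i)"
  let ?T = "\<lambda>C i. ennpow (mean_on (density M (\<sigma> i)) C (quotient_fun f i)) (P i) * (\<integral>\<^sup>+y\<in>C. \<sigma> i y \<partial>M)"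
  let ?a = "(2 * of_nat m :: ennreal) ^ m"
  obtain \<S> E where \<S>: "\<S> \<subseteq> (\<Union>k. range (cell k))" "countable \<S>"
    and E: "\<And>C. C \<in> \<S> \<Longrightarrow> E C \<in> sets M \<and> E C \<subseteq> C \<and> emeasure M C \<le> 2 * emeasure M (E C)"
    and disj: "\<And>x C D. C \<in> \<S> \<Longrightarrow> D \<in> \<S> \<Longrightarrow> x \<in> E C \<Longrightarrow> x \<in> E D \<Longrightarrow> C = D"
    and dom: "\<And>k x. ?F (cell k x) \<noteq> 0 \<Longrightarrow> \<exists>C\<in>\<S>. x \<in> C \<and> ?F (cell k x) \<le> ?a * ?F C"
  proof (rule sparse_domination[of "{1..m}" f])
    show "{1..m} \<noteq> {}" using m by simp
  next
    fix \<S> E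
    assume "\<S> \<subseteq> (\<Union>k. range (cell k))" "countable \<S>"
      "\<And>C. C \<in> \<S> \<Longrightarrow> E C \<in> sets M \<and> E C \<subseteq> C \<and> emeasure M C \<le> 2 * emeasure M (E C)"
      "\<And>x C D. C \<in> \<S> \<Longrightarrow> D \<in> \<S> \<Longrightarrow> x \<in> E C \<Longrightarrow> x \<in> E D \<Longrightarrow> C = D"
      "\<And>k x. ?F (cell k x) \<noteq> 0 \<Longrightarrow> \<exists>C\<in>\<S>. x \<in> C \<and> ?F (cell k x) \<le> (2 * of_nat (card {1..m})) ^ card {1..m} * ?F C"
    then show thesis by (intro that[of \<S> E]) (simp_all only: card_atLeastAtMost diff_Suc_1)
  qed (use assms in auto)
  have \<S>_sets [measurable]: "C \<in> sets M" if "C \<in> \<S>" for C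
    using \<S> that by auto
  define B where "B = ennreal (2 powr doubling_exponent m p P) * A"
  define X where "X i = (\<integral>\<^sup>+x. ennpow (f i x) (P i) * ennreal (w i x) \<partial>M)" for i
  have pointwise: "ennpow (SUP k. ?F (cell k x)) p \<le> ennpow ?a p * (\<integral>\<^sup>+C. ennpow (?F C) p * indicator C x \<partial>count_space \<S>)" for x
    unfolding ennpow_le_iff[OF p_pos]
  proof (rule SUP_least, unfold ennpow_le_iff[OF p_pos, symmetric])
    fix k
    show "ennpow (?F (cell k x)) p \<le> ennpow ?a p * (\<integral>\<^sup>+C. ennpow (?F C) p * indicator C x \<partial>count_space \<S>)"
    proof (cases "?F (cell k x) = 0")
      case True
      then show ?thesis using p_pos by (simp only: ennpow_0 zero_le)
    next
      case False
      from dom[OF this] obtain C where C: "C \<in> \<S>" "x \<in> C" "?F (cell k x) \<le> ?a * ?F C" by auto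
      have "ennpow (?F (cell k x)) p \<le> ennpow (?a * ?F C) p"
        using C p_pos by (intro ennpow_mono) auto
      also have "\<dots> = ennpow ?a p * (ennpow (?F C) p * indicator C x)"
        using p_pos C by (simp add: ennpow_mult)
      also have "\<dots> \<le> ennpow ?a p * (\<integral>\<^sup>+C. ennpow (?F C) p * indicator C x \<partial>count_space \<S>)"
        using C(1) by (intro mult_left_mono nn_integral_ge_point) auto
      finally show ?thesis .
    qed
  qed
  have "(\<integral>\<^sup>+x. ennpow (SUP k. ?F (cell k x)) p * \<nu> x \<partial>M) \<le>
      (\<integral>\<^sup>+x. (\<integral>\<^sup>+C. ennpow ?a p * ennpow (?F C) p * (\<nu> x * indicator C x) \<partial>count_space \<S>) \<partial>M)"
  proof (rule nn_integral_mono)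
    fix x
    have "ennpow (SUP k. ?F (cell k x)) p * \<nu> x \<le>
        ennpow ?a p * (\<integral>\<^sup>+C. ennpow (?F C) p * indicator C x \<partial>count_space \<S>) * \<nu> x"
      by (intro mult_right_mono pointwise) simp
    also have "\<dots> = (ennpow ?a p * \<nu> x) * (\<integral>\<^sup>+C. ennpow (?F C) p * indicator C x \<partial>count_space \<S>)"
      by (simp only: ac_simps)
    also have "\<dots> = (\<integral>\<^sup>+C. (ennpow ?a p * \<nu> x) * (ennpow (?F C) p * indicator C x) \<partial>count_space \<S>)"
      by (rule nn_integral_cmult[symmetric]) simp
    finally show "ennpow (SUP k. ?F (cell k x)) p * \<nu> x \<le>
        (\<integral>\<^sup>+C. ennpow ?a p * ennpow (?F C) p * (\<nu> x * indicator C x) \<partial>count_space \<S>)"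
      by (simp only: ac_simps)
  qed
  also have "\<dots> = (\<integral>\<^sup>+C. (\<integral>\<^sup>+x. ennpow ?a p * ennpow (?F C) p * (\<nu> x * indicator C x) \<partial>M) \<partial>count_space \<S>)"
    by (rule nn_integral_count_space_nn_integral[OF \<S>(2)]) measurable
  also have "\<dots> = (\<integral>\<^sup>+C. ennpow ?a p * (ennpow (?F C) p * (\<integral>\<^sup>+x\<in>C. \<nu> x \<partial>M)) \<partial>count_space \<S>)"
    unfolding mult.assoc[symmetric, of "ennpow ?a p"]
    by (intro nn_integral_cong nn_integral_cmult) auto
  also have "\<dots> = ennpow ?a p * (\<integral>\<^sup>+C. ennpow (?F C) p * (\<integral>\<^sup>+x\<in>C. \<nu> x \<partial>M) \<partial>count_space \<S>)"
    by (rule nn_integral_cmult) simp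
  also have "(\<integral>\<^sup>+C. ennpow (?F C) p * (\<integral>\<^sup>+x\<in>C. \<nu> x \<partial>M) \<partial>count_space \<S>) \<le> (\<integral>\<^sup>+C. A * (\<Prod>i = 1..m. ennpow (?T C i) (p / P i)) \<partial>count_space \<S>)"
  proof (rule nn_integral_mono)
    fix C assume "C \<in> space (count_space \<S>)"
    then obtain k x where "C = cell k x" using \<S> by auto
    then show "ennpow (?F C) p * (\<integral>\<^sup>+x\<in>C. \<nu> x \<partial>M) \<le>
        A * (\<Prod>i = 1..m. ennpow (?T C i) (p / P i))"
      using cell_energy_bound[of f k x] assms by simp
  qed
  also have "\<dots> = A * (\<integral>\<^sup>+C. (\<Prod>i = 1..m. ennpow (?T C i) (p / P i)) \<partial>count_space \<S>)"
    by (rule nn_integral_cmult) simp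
  also have "(\<integral>\<^sup>+C. (\<Prod>i = 1..m. ennpow (?T C i) (p / P i)) \<partial>count_space \<S>) \<le>
      (\<Prod>i = 1..m. ennpow (\<integral>\<^sup>+C. ?T C i \<partial>count_space \<S>) (p / P i))"
    using p_pos P_pos sum_p_P by (intro Holder_nn_integral) auto
  also have "\<dots> \<le> (\<Prod>i = 1..m. ennpow (ennpow B (conj_exponent (P i) / p) * (strong_const (P i) * X i)) (p / P i))"
    unfolding B_def X_def
    using p_pos P_pos by (intro prod_mono_ennreal ennpow_mono carleson_embedding[OF _ _ \<S> E disj]) (auto simp: less_imp_le)
  also have "\<dots> = (\<Prod>i = 1..m. (ennpow (ennreal (2 powr doubling_exponent m p P)) (1 / (P i - 1)) * ennpow (strong_const (P i)) (p / P i)) *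
      ennpow A (1 / (P i - 1)) * ennpow (X i) (p / P i))"
  proof (rule prod.cong[OF refl])
    fix i assume i: "i \<in> {1..m}"
    have "ennpow (ennpow B (conj_exponent (P i) / p)) (p / P i) = ennpow B (1 / (P i - 1))"
      using p_pos P_pos[OF i] conj_pos[OF i] P[OF i]
      by (subst ennpow_ennpow) (auto simp: conj_exponent_def)
    then show "ennpow (ennpow B (conj_exponent (P i) / p) * (strong_const (P i) * X i)) (p / P i) =
        (ennpow (ennreal (2 powr doubling_exponent m p P)) (1 / (P i - 1)) * ennpow (strong_const (P i)) (p / P i)) *
        ennpow A (1 / (P i - 1)) * ennpow (X i) (p / P i)"
      using p_pos P_pos[OF i] P[OF i] by (simp add: ennpow_mult B_def ac_simps)
  qed
  finally have "(\<integral>\<^sup>+x. ennpow (SUP k. ?F (cell k x)) p * \<nu> x \<partial>M) \<le> ennpow ?a p * (A * \<dots>)"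
    by (simp add: mult_left_mono)
  also have "\<dots> = sparse_const m p P * (A * (\<Prod>i = 1..m. ennpow A (1 / (P i - 1)))) * (\<Prod>i = 1..m. ennpow (X i) (p / P i))"
    by (simp add: sparse_const_def prod.distrib ac_simps)
  also have "A * (\<Prod>i = 1..m. ennpow A (1 / (P i - 1))) = ennpow A (1 + (\<Sum>i = 1..m. 1 / (P i - 1)))"
  proof -
    have pos: "0 < (\<Sum>i = 1..m. 1 / (P i - 1))" using m P by (intro sum_pos) auto
    have "ennpow A (\<Sum>i = 1..m. 1 / (P i - 1)) = (\<Prod>i = 1..m. ennpow A (1 / (P i - 1)))"
      using m P by (intro ennpow_sum_exp) auto
    then show ?thesis by (simp only: ennpow_add[OF zero_less_one pos] ennpow_exp_1)
  qed
  finally show ?thesis unfolding X_def .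
qed

section \<open>The bound for equal exponents\<close>

text \<open>
With \<open>\<gamma> = p / r' = (r - 1) / m\<close>, the \<open>\<gamma>\<close>-th powers of the means of the \<open>\<sigma> i\<close> are exactly the factors
of the weight condition. Multiplying by the mean of \<open>\<nu>\<close> shows that \<open>F\<close> to the power \<open>\<gamma>\<close> is at most \<open>A\<close>
times the \<open>\<nu>\<close>-mean of \<open>h\<close>, the product of the \<open>\<gamma>\<close>-th powers of the maximal functions of the \<open>\<sigma> i\<close>,
divided by \<open>\<nu>\<close>. Taking the supremum over the cells leaves one maximal function with respect to \<open>\<nu>\<close>, raised to
the power \<open>p / \<gamma> = r'\<close>, followed by the \<open>m\<close> maximal functions on \<open>L\<^sup>r(\<sigma> i)\<close>.
\<close>

theorem multilinear_cell_maximal_diagonal_bound: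
  assumes [measurable]: "\<And>i. i \<in> {1..m} \<Longrightarrow> f i \<in> borel_measurable M"
    and r: "\<And>i. i \<in> {1..m} \<Longrightarrow> P i = r"
  shows "(\<integral>\<^sup>+x. ennpow (SUP k. \<Prod>i = 1..m. mean_on M (cell k x) (f i)) p * \<nu> x \<partial>M) \<le>
    strong_const (conj_exponent r) * strong_const r * ennpow A (conj_exponent r) *
    (\<Prod>i = 1..m. ennpow (\<integral>\<^sup>+x. ennpow (f i x) (P i) * ennreal (w i x) \<partial>M) (p / P i))"
proof -
  let ?X = "\<lambda>i. \<integral>\<^sup>+x. ennpow (f i x) (P i) * ennreal (w i x) \<partial>M"
  define r' where "r' = conj_exponent r"
  have r1: "1 < r" using r[of 1] P[of 1] m by simp
  have r': "1 < r'" using conj_exponent_gt_1[OF r1] by (simp add: r'_def)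
  have pr: "p / r = 1 / real m" "p = r / real m"
  proof -
    have "1 / p = real m * (1 / r)" unfolding p using r by simp
    then show "p = r / real m" using p_pos m r1 by (simp add: field_simps)
    then show "p / r = 1 / real m" using r1 by simp
  qed
  define \<gamma> where "\<gamma> = p / r'"
  have \<gamma>: "0 < \<gamma>" using p_pos r' by (simp add: \<gamma>_def)
  let ?F = "\<lambda>C. \<Prod>i = 1..m. mean_on M C (f i)"
  let ?D = "\<lambda>i. density M (\<sigma> i)" and ?N = "density M \<nu>"
  let ?Mx = "\<lambda>i. cell_maximal (?D i) cell (quotient_fun f i)"
  define v where "v x = (\<Prod>i = 1..m. w i x powr (p / P i))" for x
  have v: "0 < v x" "\<nu> x = ennreal (v x)" for x
    using w_pos unfolding v_def joint_weight_def by (auto intro!: prod_pos)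
  have [measurable]: "v \<in> borel_measurable M"
    unfolding v_def by measurable
  have [measurable]: "?Mx i \<in> borel_measurable M" if "i \<in> {1..m}" for i
    using nested_partitions.measurable_cell_maximal[OF nested_partitions_dual[OF that]] by simp
  define h where "h x = (\<Prod>i = 1..m. ennpow (?Mx i x) \<gamma>) * ennreal (1 / v x)" for x
  have [measurable]: "h \<in> borel_measurable M"
    unfolding h_def by measurable
  \<comment> \<open>The weight \<open>\<nu>\<close> in \<open>h\<close> cancels against the density of the measure \<open>\<nu>\<close>.\<close>
  have vh: "\<nu> x * h x = (\<Prod>i = 1..m. ennpow (?Mx i x) \<gamma>)" for x
  proof -
    have "\<nu> x * ennreal (1 / v x) = 1"
      using v(1)[of x] unfolding v(2) by (subst ennreal_mult[symmetric]) auto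
    moreover have "\<nu> x * h x = (\<Prod>i = 1..m. ennpow (?Mx i x) \<gamma>) * (\<nu> x * ennreal (1 / v x))"
      by (simp only: h_def ac_simps)
    ultimately show ?thesis by (simp only: mult_1_right)
  qed
  have cell_bound: "ennpow (?F (cell k x)) \<gamma> \<le> A * mean_on ?N (cell k x) h" for k x
  proof -
    let ?C = "cell k x"
    let ?a = "\<lambda>i. mean_on (?D i) ?C (quotient_fun f i)"
    let ?V = "\<integral>\<^sup>+y\<in>?C. \<nu> y \<partial>M"
    have "(\<Prod>i = 1..m. ennpow (?a i) \<gamma>) * emeasure M ?C = (\<integral>\<^sup>+y. (\<Prod>i = 1..m. ennpow (?a i) \<gamma>) * indicator ?C y \<partial>M)"
      by (simp add: nn_integral_cmult_indicator)
    also have "\<dots> \<le> (\<integral>\<^sup>+y\<in>?C. \<nu> y * h y \<partial>M)"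
    proof (rule nn_integral_mono)
      fix y
      have "(\<Prod>i = 1..m. ennpow (?a i) \<gamma>) \<le> \<nu> y * h y" if "y \<in> ?C"
        unfolding vh
      proof (intro prod_mono_ennreal ennpow_mono)
        fix i
        show "?a i \<le> ?Mx i y"
          using cell_eq[OF that] unfolding cell_maximal_def by (auto intro!: SUP_upper2[of k])
      qed (use \<gamma> in simp)
      then show "(\<Prod>i = 1..m. ennpow (?a i) \<gamma>) * indicator ?C y \<le> \<nu> y * h y * indicator ?C y"
        by (auto simp: indicator_def)
    qed
    also have "\<dots> = (\<integral>\<^sup>+y\<in>?C. h y \<partial>?N)"
      by (subst nn_integral_density) (auto simp: ac_simps)
    also have "\<dots> = mean_on ?N ?C h * ?V"
      by (subst nested_partitions.mean_times_measure[OF nested_partitions_joint, symmetric])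
         (auto simp: emeasure_density)
    finally have avg: "(\<Prod>i = 1..m. ennpow (?a i) \<gamma>) * emeasure M ?C \<le> mean_on ?N ?C h * ?V" .
    have F: "ennpow (?F ?C) \<gamma> = (\<Prod>i = 1..m. ennpow (?a i) \<gamma>) *
        (\<Prod>i = 1..m. ennpow (mean_on M ?C (\<sigma> i)) (p / conj_exponent (P i)))"
    proof -
      have "ennpow (?F ?C) \<gamma> = (\<Prod>i = 1..m. ennpow (mean_on M ?C (f i)) \<gamma>)"
        by (rule ennpow_prod[OF less_imp_le[OF \<gamma>]])
      also have "\<dots> = (\<Prod>i = 1..m. ennpow (?a i) \<gamma> * ennpow (mean_on M ?C (\<sigma> i)) (p / conj_exponent (P i)))"
      proof (rule prod.cong[OF refl])
        fix i assume i: "i \<in> {1..m}"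
        have "p / conj_exponent (P i) = \<gamma>"
          using r[OF i] by (simp add: \<gamma>_def r'_def)
        then show "ennpow (mean_on M ?C (f i)) \<gamma> = ennpow (?a i) \<gamma> * ennpow (mean_on M ?C (\<sigma> i)) (p / conj_exponent (P i))"
          using \<gamma> i by (simp only: mean_quotient_fun[of i f, OF i assms(1)[OF i]] ennpow_mult less_imp_le)
      qed
      finally show ?thesis by (simp only: prod.distrib)
    qed
    have "?V * ennpow (?F ?C) \<gamma> = ((\<Prod>i = 1..m. ennpow (?a i) \<gamma>) * emeasure M ?C) *
        (mean_on M ?C \<nu> * (\<Prod>i = 1..m. ennpow (mean_on M ?C (\<sigma> i)) (p / conj_exponent (P i))))"
      unfolding F by (subst mean_times_measure[symmetric]) (auto simp: ac_simps)
    also have "\<dots> \<le> (mean_on ?N ?C h * ?V) * A"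
      by (intro mult_mono avg AP) auto
    finally have "?V * ennpow (?F ?C) \<gamma> \<le> ?V * (A * mean_on ?N ?C h)"
      by (simp add: ac_simps)
    then show ?thesis
      using joint_weight_cell[of k x] by (subst (asm) ennreal_mult_le_mult_iff) auto
  qed
  have pointwise: "ennpow (SUP k. ?F (cell k x)) p \<le> ennpow A r' * ennpow (cell_maximal ?N cell h x) r'" for x
  proof -
    have "?F (cell k x) \<le> ennpow (A * cell_maximal ?N cell h x) (1 / \<gamma>)" for k
      unfolding ennpow_le_iff[OF \<gamma>, symmetric]
    proof (rule order_trans[OF cell_bound])
      show "A * mean_on ?N (cell k x) h \<le> A * cell_maximal ?N cell h x"
        unfolding cell_maximal_def by (intro mult_left_mono SUP_upper) auto
    qed
    then have "ennpow (SUP k. ?F (cell k x)) p \<le> ennpow (ennpow (A * cell_maximal ?N cell h x) (1 / \<gamma>)) p"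
      using p_pos by (intro ennpow_mono SUP_least) auto
    also have "\<dots> = ennpow (A * cell_maximal ?N cell h x) r'"
      using p_pos r' by (subst ennpow_ennpow) (auto simp: \<gamma>_def)
    finally show ?thesis using r' by (simp add: ennpow_mult)
  qed
  have [measurable]: "cell_maximal ?N cell h \<in> borel_measurable M"
    using nested_partitions.measurable_cell_maximal[OF nested_partitions_joint] by simp
  have "(\<integral>\<^sup>+x. ennpow (SUP k. ?F (cell k x)) p * \<nu> x \<partial>M) \<le>
      (\<integral>\<^sup>+x. ennpow A r' * (\<nu> x * ennpow (cell_maximal ?N cell h x) r') \<partial>M)"
  proof (rule nn_integral_mono)
    fix x
    show "ennpow (SUP k. ?F (cell k x)) p * \<nu> x \<le> ennpow A r' * (\<nu> x * ennpow (cell_maximal ?N cell h x) r')"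
      using mult_right_mono[OF pointwise, of "\<nu> x" x] by (simp add: ac_simps)
  qed
  also have "\<dots> = ennpow A r' * (\<integral>\<^sup>+x. \<nu> x * ennpow (cell_maximal ?N cell h x) r' \<partial>M)"
    by (rule nn_integral_cmult) measurable
  also have "(\<integral>\<^sup>+x. \<nu> x * ennpow (cell_maximal ?N cell h x) r' \<partial>M) = (\<integral>\<^sup>+x. ennpow (cell_maximal ?N cell h x) r' \<partial>?N)"
    by (rule nn_integral_density[symmetric]) measurable
  also have "\<dots> \<le> strong_const r' * (\<integral>\<^sup>+x. ennpow (h x) r' \<partial>?N)"
    unfolding strong_const_def using r'
    by (intro nested_partitions.cell_maximal_strong_type nested_partitions_joint) auto
  also have "(\<integral>\<^sup>+x. ennpow (h x) r' \<partial>?N) = (\<integral>\<^sup>+x. \<nu> x * ennpow (h x) r' \<partial>M)"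
    by (rule nn_integral_density) measurable
  also have "\<dots> = (\<integral>\<^sup>+x. (\<Prod>i = 1..m. ennpow (\<sigma> i x * ennpow (?Mx i x) r) (1 / real m)) \<partial>M)"
  proof (rule nn_integral_cong)
    fix x
    have "\<nu> x * ennpow (h x) r' = (\<Prod>i = 1..m. ennpow (ennpow (?Mx i x) \<gamma>) r') * (\<nu> x * ennpow (ennreal (1 / v x)) r')"
      using r' by (simp add: h_def ennpow_mult ennpow_prod ac_simps)
    also have "\<nu> x * ennpow (ennreal (1 / v x)) r' = (\<Prod>i = 1..m. ennpow (\<sigma> i x) (1 / real m))"
    proof -
      have "\<nu> x * ennpow (ennreal (1 / v x)) r' = ennreal (v x powr 1 * v x powr (- r'))"
      proof -
        have "(1 / v x) powr r' = v x powr (- r')"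
          using v(1)[of x] by (simp add: powr_divide powr_minus_divide)
        then have "ennpow (ennreal (1 / v x)) r' = ennreal (v x powr (- r'))"
          using v(1)[of x] by (simp add: ennpow_ennreal)
        then show ?thesis
          using v(1)[of x] unfolding v(2) by (simp add: ennreal_mult)
      qed
      also have "v x powr 1 * v x powr (- r') = v x powr (1 - r')"
        by (simp only: powr_add[symmetric] add_uminus_conv_diff)
      also have "\<dots> = (\<Prod>i = 1..m. (w i x powr (p / P i)) powr (1 - r'))"
        unfolding v_def by (rule prod_powr_distrib)
      also have "\<dots> = (\<Prod>i = 1..m. (w i x powr (1 - r')) powr (1 / real m))"
        using r pr by (intro prod.cong) (auto simp: powr_powr mult.commute)
      finally show ?thesis
        using r w_pos by (subst (asm) prod_ennreal[symmetric])
          (auto simp: dual_weight_def r'_def ennpow_ennreal intro!: prod.cong)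
    qed
    also have "(\<Prod>i = 1..m. ennpow (ennpow (?Mx i x) \<gamma>) r') = (\<Prod>i = 1..m. ennpow (ennpow (?Mx i x) r) (1 / real m))"
      using \<gamma> r' r1 m pr by (intro prod.cong refl) (simp add: ennpow_ennpow \<gamma>_def)
    finally show "\<nu> x * ennpow (h x) r' = (\<Prod>i = 1..m. ennpow (\<sigma> i x * ennpow (?Mx i x) r) (1 / real m))"
      by (simp add: prod.distrib[symmetric] ennpow_mult ac_simps)
  qed
  also have "\<dots> \<le> (\<Prod>i = 1..m. ennpow (\<integral>\<^sup>+x. \<sigma> i x * ennpow (?Mx i x) r \<partial>M) (1 / real m))"
    using m by (intro Holder_nn_integral) auto
  also have "\<dots> \<le> (\<Prod>i = 1..m. ennpow (strong_const r) (1 / real m) *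
      ennpow (?X i) (p / P i))"
  proof (rule prod_mono_ennreal)
    fix i assume i: "i \<in> {1..m}"
    have "(\<integral>\<^sup>+x. \<sigma> i x * ennpow (?Mx i x) r \<partial>M) = (\<integral>\<^sup>+x. ennpow (?Mx i x) r \<partial>?D i)"
      using i by (intro nn_integral_density[symmetric]) auto
    also have "\<dots> \<le> strong_const r * (?X i)"
      using dual_maximal_bound[of i f] i assms(1)[OF i] r[OF i] by simp
    finally have "ennpow (\<integral>\<^sup>+x. \<sigma> i x * ennpow (?Mx i x) r \<partial>M) (1 / real m) \<le>
        ennpow (strong_const r * (?X i)) (1 / real m)"
      by (intro ennpow_mono) auto
    then show "ennpow (\<integral>\<^sup>+x. \<sigma> i x * ennpow (?Mx i x) r \<partial>M) (1 / real m) \<le>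
        ennpow (strong_const r) (1 / real m) * ennpow (?X i) (p / P i)"
      using r[OF i] pr by (simp add: ennpow_mult)
  qed
  also have "\<dots> = strong_const r * (\<Prod>i = 1..m. ennpow (?X i) (p / P i))"
  proof -
    have "(\<Prod>i = 1..m. ennpow (strong_const r) (1 / real m)) = strong_const r"
      using m by (subst ennpow_sum_exp[symmetric]) auto
    then show ?thesis by (simp only: prod.distrib)
  qed
  finally have "(\<integral>\<^sup>+x. ennpow (SUP k. ?F (cell k x)) p * \<nu> x \<partial>M) \<le>
      ennpow A r' * (strong_const r' * (strong_const r *
        (\<Prod>i = 1..m. ennpow (?X i) (p / P i))))"
    by (simp add: mult_left_mono)
  then show ?thesis
    unfolding r'_def[symmetric] by (simp only: ac_simps)
qed

end

section \<open>Cubes and dyadic grids\<close>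

text \<open>
The half-open cell around \<open>x\<close> with side \<open>L / 2 ^ k\<close> in the dyadic grid translated by \<open>u\<close>. Bounding the
scales by \<open>L\<close> from above lets the selection of cells begin at generation \<open>0\<close>.
\<close>

definition grid_cell :: "real \<Rightarrow> (real ^ 'n) \<Rightarrow> nat \<Rightarrow> real ^ 'n \<Rightarrow> (real ^ 'n) set" where
  "grid_cell L u k x = {y. \<forall>i. \<lfloor>(y $ i - u $ i) / (L / 2 ^ k)\<rfloor> = \<lfloor>(x $ i - u $ i) / (L / 2 ^ k)\<rfloor>}"

lemma emeasure_cube:
  fixes a :: "real ^ 'n"
  assumes "0 < l"
  shows "emeasure lebesgue (cbox a (\<chi> i. a $ i + l)) = ennreal (l ^ CARD('n))"
    and "emeasure lebesgue (box a (\<chi> i. a $ i + l)) = ennreal (l ^ CARD('n))"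
proof -
  have "cbox a (\<chi> i. a $ i + l) \<noteq> {}"
    using assms by (simp add: interval_ne_empty_cart)
  then have *: "measure lebesgue (cbox a (\<chi> i. a $ i + l)) = l ^ CARD('n)"
    by (simp add: content_cbox_cart)
  show "emeasure lebesgue (cbox a (\<chi> i. a $ i + l)) = ennreal (l ^ CARD('n))"
    unfolding *[symmetric] using emeasure_lborel_cbox_finite[of a "\<chi> i. a $ i + l"]
    by (intro emeasure_eq_ennreal_measure) auto
  then show "emeasure lebesgue (box a (\<chi> i. a $ i + l)) = ennreal (l ^ CARD('n))"
    by (simp add: emeasure_lborel_box_eq emeasure_lborel_cbox_eq)
qed

lemma grid_cell_box:
  fixes x u :: "real ^ 'n"
  assumes L: "0 < L"
  obtains a where "box a (\<chi> i. a $ i + L / 2 ^ k) \<subseteq> grid_cell L u k x"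
    "grid_cell L u k x \<subseteq> cbox a (\<chi> i. a $ i + L / 2 ^ k)"
    "grid_cell L u k x = {y. \<forall>i. a $ i \<le> y $ i \<and> y $ i < a $ i + L / 2 ^ k}"
proof -
  define h where "h = L / 2 ^ k"
  have h: "0 < h" using L by (simp add: h_def)
  define a :: "real ^ 'n" where "a = (\<chi> i. u $ i + h * of_int \<lfloor>(x $ i - u $ i) / h\<rfloor>)"
  have "\<lfloor>(t - s) / h\<rfloor> = z \<longleftrightarrow> s + h * of_int z \<le> t \<and> t < s + h * of_int z + h" for s t :: real and z
    using h by (simp add: floor_eq_iff field_simps)
  then have eq: "grid_cell L u k x = {y. \<forall>i. a $ i \<le> y $ i \<and> y $ i < a $ i + h}"
    unfolding grid_cell_def h_def[symmetric] a_def by simp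
  show ?thesis
    by (rule that[of a]) (auto simp: eq h_def[symmetric] mem_box_cart less_imp_le)
qed

lemma sets_grid_cell: "0 < L \<Longrightarrow> grid_cell L u k x \<in> sets lebesgue"
proof -
  assume "0 < L"
  then obtain a where a: "grid_cell L u k x = {y. \<forall>i. a $ i \<le> y $ i \<and> y $ i < a $ i + L / 2 ^ k}"
    by (rule grid_cell_box)
  have "{y \<in> space borel. \<forall>i\<in>UNIV. a $ i \<le> y $ i \<and> y $ i < a $ i + L / 2 ^ k} \<in> sets borel"
    by measurable
  then show ?thesis unfolding a by simp
qed

lemma emeasure_grid_cell:
  fixes u :: "real ^ 'n"
  assumes L: "0 < L"
  shows "emeasure lebesgue (grid_cell L u k x) = ennreal ((L / 2 ^ k) ^ CARD('n))"
proof -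
  have h: "0 < L / 2 ^ k" using L by simp
  obtain a where a: "box a (\<chi> i. a $ i + L / 2 ^ k) \<subseteq> grid_cell L u k x"
    "grid_cell L u k x \<subseteq> cbox a (\<chi> i. a $ i + L / 2 ^ k)"
    by (rule grid_cell_box[OF L])
  show ?thesis
  proof (rule antisym)
    show "emeasure lebesgue (grid_cell L u k x) \<le> ennreal ((L / 2 ^ k) ^ CARD('n))"
      unfolding emeasure_cube(1)[OF h, of a, symmetric] by (rule emeasure_mono[OF a(2)]) simp
    show "ennreal ((L / 2 ^ k) ^ CARD('n)) \<le> emeasure lebesgue (grid_cell L u k x)"
      unfolding emeasure_cube(2)[OF h, of a, symmetric] by (rule emeasure_mono[OF a(1) sets_grid_cell[OF L]])
  qed
qed

lemma floor_double_cong: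
  fixes s t :: real
  assumes "\<lfloor>2 * s\<rfloor> = \<lfloor>2 * t\<rfloor>"
  shows "\<lfloor>s\<rfloor> = \<lfloor>t\<rfloor>"
proof -
  define c where "c = \<lfloor>2 * t\<rfloor>"
  have half: "\<lfloor>r\<rfloor> = c div 2" if "\<lfloor>2 * r\<rfloor> = c" for r :: real
  proof -
    have "of_int c \<le> 2 * r" "2 * r < of_int c + 1" "of_int \<lfloor>r\<rfloor> \<le> r" "r < of_int \<lfloor>r\<rfloor> + 1"
      using that by (auto simp: floor_eq_iff)
    then have "of_int (2 * \<lfloor>r\<rfloor>) < (of_int (c + 1) :: real)" "(of_int c :: real) < of_int (2 * \<lfloor>r\<rfloor> + 2)"
      unfolding of_int_mult of_int_add of_int_numeral of_int_1 by linarith+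
    then have "2 * \<lfloor>r\<rfloor> < c + 1" "c < 2 * \<lfloor>r\<rfloor> + 2"
      by (simp_all only: of_int_less_iff)
    then show ?thesis by linarith
  qed
  show ?thesis using half[of s] half[of t] assms by (simp add: c_def)
qed

lemma nested_partitions_grid:
  fixes u :: "real ^ 'n"
  assumes L: "0 < L"
  shows "nested_partitions lebesgue (grid_cell L u)"
proof
  fix k and x y :: "real ^ 'n"
  show "space lebesgue = (UNIV :: (real ^ 'n) set)" by simp
  show "x \<in> grid_cell L u k x" by (simp add: grid_cell_def)
  show "y \<in> grid_cell L u k x \<Longrightarrow> grid_cell L u k y = grid_cell L u k x"
    by (auto simp: grid_cell_def)
  show "grid_cell L u k x \<in> sets lebesgue" by (rule sets_grid_cell[OF L])
  show "emeasure lebesgue (grid_cell L u k x) \<noteq> top" by (simp add: emeasure_grid_cell[OF L])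
  show "grid_cell L u (Suc k) x \<subseteq> grid_cell L u k x"
  proof -
    have "\<lfloor>(y $ i - u $ i) / (L / 2 ^ k)\<rfloor> = \<lfloor>(x $ i - u $ i) / (L / 2 ^ k)\<rfloor>"
      if "\<lfloor>(y $ i - u $ i) / (L / 2 ^ Suc k)\<rfloor> = \<lfloor>(x $ i - u $ i) / (L / 2 ^ Suc k)\<rfloor>" for y :: "real ^ 'n" and i
    proof (rule floor_double_cong)
      have "t / (L / 2 ^ Suc k) = 2 * (t / (L / 2 ^ k))" for t by simp
      with that show "\<lfloor>2 * ((y $ i - u $ i) / (L / 2 ^ k))\<rfloor> = \<lfloor>2 * ((x $ i - u $ i) / (L / 2 ^ k))\<rfloor>"
        by (simp only:)
    qed
    then show ?thesis unfolding grid_cell_def by blast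
  qed
  have "range (grid_cell L u k) \<subseteq> range (\<lambda>z :: 'n \<Rightarrow> int. {y. \<forall>i. \<lfloor>(y $ i - u $ i) / (L / 2 ^ k)\<rfloor> = z i})"
    unfolding grid_cell_def by fast
  then show "countable (range (grid_cell L u k))"
    by (rule countable_subset) simp
qed

lemma average_eq_mean_on: "average Q g = mean_on lebesgue Q g"
  by (simp add: average_def mean_on_def)

text \<open>
A cell and its closure have the same measure, so the weight condition on closed cubes passes to cells.
\<close>

lemma grid_cell_le_cube:
  fixes u x :: "real ^ 'n"
  assumes L: "0 < L"
  obtains Q where "Q \<in> cubes" "\<And>g. mean_on lebesgue (grid_cell L u k x) g \<le> average Q g"
proof -
  have h: "0 < L / 2 ^ k" using L by simp
  obtain a where a: "grid_cell L u k x \<subseteq> cbox a (\<chi> i. a $ i + L / 2 ^ k)"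
    by (rule grid_cell_box[OF L])
  show ?thesis
  proof (rule that)
    show "cbox a (\<chi> i. a $ i + L / 2 ^ k) \<in> cubes" using h by (auto simp: cubes_def)
    fix g
    show "mean_on lebesgue (grid_cell L u k x) g \<le> average (cbox a (\<chi> i. a $ i + L / 2 ^ k)) g"
      unfolding average_eq_mean_on mean_on_def emeasure_cube(1)[OF h] emeasure_grid_cell[OF L]
      using a by (intro divide_right_mono_ennreal nn_integral_mono) (auto simp: indicator_def)
  qed
qed

text \<open>
Here \<open>h\<close> is the side of the cells and \<open>2 ^ k * h\<close> the top scale. If the interval is cut by both
partitions, it contains end points \<open>z h\<close> and \<open>z' h + 2^k h / 3\<close>, whose distance is less than \<open>h / 3\<close>. Hence
\<open>3 (z - z')\<close> would be the power \<open>2^k\<close>. Translating by a third of the top scale therefore works at all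
smaller scales simultaneously.
\<close>

lemma one_third_trick:
  fixes a l h :: real
  assumes l: "0 < l" "3 * l \<le> h"
  shows "\<exists>s\<in>{0, 2 ^ k * h / 3}. \<forall>y. a \<le> y \<and> y \<le> a + l \<longrightarrow> \<lfloor>(y - s) / h\<rfloor> = \<lfloor>(a - s) / h\<rfloor>"
proof (rule ccontr)
  assume contra: "\<not> ?thesis"
  have h: "0 < h" using l by simp
  have ex: "\<exists>z::int. a < of_int z * h + s \<and> of_int z * h + s \<le> a + l"
    if s: "s \<in> {0, 2 ^ k * h / 3}" for s
  proof -
    obtain y where y: "a \<le> y" "y \<le> a + l" "\<lfloor>(y - s) / h\<rfloor> \<noteq> \<lfloor>(a - s) / h\<rfloor>"
    proof -
      have "\<not> (\<forall>y. a \<le> y \<and> y \<le> a + l \<longrightarrow> \<lfloor>(y - s) / h\<rfloor> = \<lfloor>(a - s) / h\<rfloor>)"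
        using contra s by blast
      then show ?thesis using that by blast
    qed
    define z where "z = \<lfloor>(y - s) / h\<rfloor>"
    have "\<lfloor>(a - s) / h\<rfloor> \<le> z"
      unfolding z_def using y h by (intro floor_mono divide_right_mono) auto
    with y(3) have "\<lfloor>(a - s) / h\<rfloor> < z" by (simp add: z_def)
    then have "(a - s) / h < of_int z" by (simp add: floor_less_iff)
    moreover have "of_int z \<le> (y - s) / h" by (simp add: z_def)
    ultimately have "a - s < of_int z * h" "of_int z * h \<le> y - s"
      using h by (simp_all add: pos_divide_less_eq pos_le_divide_eq)
    with y(2) show ?thesis by (intro exI[of _ z]) auto
  qed
  obtain z z' :: int where z: "a < of_int z * h" "of_int z * h \<le> a + l"
    "a < of_int z' * h + 2 ^ k * h / 3" "of_int z' * h + 2 ^ k * h / 3 \<le> a + l"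
    using ex[of 0] ex[of "2 ^ k * h / 3"] by auto
  have "\<bar>(of_int z - of_int z' - 2 ^ k / 3) * h\<bar> < l"
    using z by (simp add: abs_less_iff algebra_simps)
  also have "l \<le> 1 / 3 * h" using l by simp
  finally have "\<bar>of_int z - of_int z' - 2 ^ k / 3\<bar> < (1 / 3 :: real)"
    using h by (simp add: abs_mult)
  then have near: "of_int z - of_int z' - 2 ^ k / 3 < (1 / 3 :: real)" "- (of_int z - of_int z' - 2 ^ k / 3) < (1 / 3 :: real)"
    unfolding abs_less_iff by blast+
  have "of_int (3 * (z - z') - 2 ^ k) < (1 :: real)"
    using near(1) by (simp add: field_simps)
  moreover have "(- 1 :: real) < of_int (3 * (z - z') - 2 ^ k)"
    using near(2) by (simp add: field_simps)
  ultimately have "3 * (z - z') = 2 ^ k"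
    by linarith
  then have "(3::int) dvd 2 ^ k" by (metis dvd_triv_left)
  then have "(3::int) dvd 2"
    by (rule prime_dvd_power_int[rotated]) simp
  then show False by simp
qed

lemma dyadic_scale:
  fixes l L :: real
  assumes "0 < l" "3 * l \<le> L"
  obtains k where "3 * l \<le> L / 2 ^ k" "L / 2 ^ k \<le> 6 * l"
proof -
  obtain n where "L / (6 * l) < 2 ^ n"
    using real_arch_pow[of 2 "L / (6 * l)"] by auto
  then have ex: "\<exists>n. L \<le> 6 * l * 2 ^ n"
    using assms by (intro exI[of _ n]) (simp add: pos_divide_less_eq mult.commute)
  \<comment> \<open>The least \<open>n\<close> keeps the side at least \<open>3 l\<close>: one generation earlier it exceeds \<open>6 l\<close>.\<close>
  define k where "k = (LEAST n. L \<le> 6 * l * 2 ^ n)"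
  have k: "L \<le> 6 * l * 2 ^ k" unfolding k_def using ex by (rule LeastI_ex)
  have "3 * l * 2 ^ k \<le> L"
  proof (cases k)
    case (Suc j)
    then have "\<not> L \<le> 6 * l * 2 ^ j" unfolding k_def by (intro not_less_Least) simp
    then show ?thesis by (simp add: Suc)
  qed (use assms in simp)
  with k show ?thesis by (intro that[of k]) (simp_all add: field_simps)
qed

definition third_shift :: "real \<Rightarrow> ('n \<Rightarrow> bool) \<Rightarrow> real ^ 'n" where
  "third_shift L b = (\<chi> i. if b i then L / 3 else 0)"

text \<open>
Choose the generation whose cells have between three and six times the side of the cube, and apply the one-third
trick in each coordinate separately; this is the origin of the \<open>2^n\<close> translations and of the factor \<open>6^n\<close>.
\<close>

lemma cube_le_grid_cell:
  fixes x :: "real ^ 'n"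
  assumes Q: "Q = cbox a (\<chi> i. a $ i + l)" "x \<in> Q" and l: "0 < l" "3 * l \<le> L"
  obtains b k where "\<And>g. average Q g \<le> 6 ^ CARD('n) * mean_on lebesgue (grid_cell L (third_shift L b) k x) g"
proof -
  obtain k where k: "3 * l \<le> L / 2 ^ k" "L / 2 ^ k \<le> 6 * l"
    using dyadic_scale[OF l] by auto
  define h where "h = L / 2 ^ k"
  have L: "0 < L" "L / 3 = 2 ^ k * h / 3" using l by (auto simp: h_def)
  have "\<exists>b. \<forall>y. a $ i \<le> y \<and> y \<le> a $ i + l \<longrightarrow>
      \<lfloor>(y - (if b then L / 3 else 0)) / h\<rfloor> = \<lfloor>(a $ i - (if b then L / 3 else 0)) / h\<rfloor>" for i
    using one_third_trick[OF l(1) k(1), of k "a $ i"] unfolding L(2) h_def[symmetric]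
    by (metis (full_types) insertE singletonD)
  then obtain b where b: "\<And>i y. a $ i \<le> y \<Longrightarrow> y \<le> a $ i + l \<Longrightarrow>
      \<lfloor>(y - (if b i then L / 3 else 0)) / h\<rfloor> = \<lfloor>(a $ i - (if b i then L / 3 else 0)) / h\<rfloor>"
    by metis
  let ?C = "grid_cell L (third_shift L b) k x"
  have sub: "Q \<subseteq> ?C"
  proof
    fix y assume "y \<in> Q"
    then have "\<lfloor>(y $ i - third_shift L b $ i) / h\<rfloor> = \<lfloor>(x $ i - third_shift L b $ i) / h\<rfloor>" for i
      using b[of i "y $ i"] b[of i "x $ i"] Q by (simp add: third_shift_def mem_box_cart)
    then show "y \<in> ?C" by (simp add: grid_cell_def h_def)
  qed
  show ?thesis
  proof (rule that)
    fix g
    have hn: "0 < l ^ CARD('n)" "0 < h ^ CARD('n)" "h ^ CARD('n) \<le> 6 ^ CARD('n) * l ^ CARD('n)"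
      using l L k power_mono[of h "6 * l" "CARD('n)"] by (auto simp: h_def power_mult_distrib)
    have "average Q g \<le> (\<integral>\<^sup>+y\<in>?C. g y \<partial>lebesgue) / ennreal (l ^ CARD('n))"
      unfolding average_def Q(1) emeasure_cube(1)[OF l(1)]
      using sub Q(1) by (intro divide_right_mono_ennreal nn_integral_mono) (auto simp: indicator_def)
    also have "\<dots> = (\<integral>\<^sup>+y\<in>?C. g y \<partial>lebesgue) * ennreal (1 / l ^ CARD('n))"
      using hn by (simp add: divide_ennreal_def inverse_ennreal inverse_eq_divide)
    also have "\<dots> \<le> (\<integral>\<^sup>+y\<in>?C. g y \<partial>lebesgue) * ennreal (6 ^ CARD('n) * (1 / h ^ CARD('n)))"
      using hn by (intro mult_left_mono ennreal_leI) (auto simp: field_simps)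
    also have "\<dots> = 6 ^ CARD('n) * ((\<integral>\<^sup>+y\<in>?C. g y \<partial>lebesgue) * ennreal (1 / h ^ CARD('n)))"
      using hn by (subst ennreal_mult) (auto simp: ennreal_power[symmetric] ac_simps)
    also have "(\<integral>\<^sup>+y\<in>?C. g y \<partial>lebesgue) * ennreal (1 / h ^ CARD('n)) = mean_on lebesgue ?C g"
      unfolding mean_on_def emeasure_grid_cell[OF L(1)] h_def[symmetric]
      using hn by (simp add: divide_ennreal_def inverse_ennreal inverse_eq_divide)
    finally show "average Q g \<le> 6 ^ CARD('n) * mean_on lebesgue ?C g" .
  qed
qed

lemma measurable_grid_maximal [measurable]:
  fixes u :: "real ^ 'n"
  assumes "0 < L"
  shows "(\<lambda>x. SUP k. \<Prod>i\<in>I. mean_on lebesgue (grid_cell L u k x) (g i)) \<in> borel_measurable lebesgue"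
proof -
  interpret nested_partitions lebesgue "grid_cell L u"
    by (rule nested_partitions_grid[OF assms])
  show ?thesis by measurable
qed

text \<open>
A fixed cube is captured by one of the grids for every sufficiently large top scale \<open>2 ^ N\<close>, so at each point the
maximal function is bounded by a limit inferior of dyadic maximal functions, summed over the translations. Fatou's
lemma applies to this measurable majorant and spares a measurability argument for the maximal function itself.
\<close>

lemma multi_maximal_le_grids:
  fixes f :: "nat \<Rightarrow> real ^ 'n \<Rightarrow> complex"
  assumes p: "0 < p" and v [measurable]: "v \<in> borel_measurable lebesgue" and v_pos: "\<And>x. 0 < v x \<and> v x < top"
    and bound: "\<And>L u. 0 < L \<Longrightarrow>
      (\<integral>\<^sup>+x. ennpow (SUP k. \<Prod>i = 1..m. mean_on lebesgue (grid_cell L u k x) (\<lambda>y. ennreal (norm (f i y)))) p * v x \<partial>lebesgue) \<le> B"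
  shows "(\<integral>\<^sup>+x. ennpow (multi_maximal m f x) p * v x \<partial>lebesgue) \<le>
    ennpow ((6 ^ CARD('n)) ^ m) p * of_nat (card (UNIV :: ('n \<Rightarrow> bool) set)) * B"
proof -
  let ?g = "\<lambda>i y. ennreal (norm (f i y))" and ?G = "\<lambda>N b k x. grid_cell (2 ^ N) (third_shift (2 ^ N) b) k x"
  let ?c = "(6 ^ CARD('n)) ^ m :: ennreal"
  define D where "D N b x = (SUP k. \<Prod>i = 1..m. mean_on lebesgue (?G N b k x) (?g i))"
    for N :: nat and b :: "'n \<Rightarrow> bool" and x
  have [measurable]: "D N b \<in> borel_measurable lebesgue" for N b
    unfolding D_def by (rule measurable_grid_maximal) simp
  define H where "H N x = (\<Sum>b\<in>UNIV. ennpow ?c p * (ennpow (D N b x) p * v x))" for N x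
  have [measurable]: "H N \<in> borel_measurable lebesgue" for N
    unfolding H_def by measurable
  have cube: "\<forall>\<^sub>F N in sequentially. ennpow (\<Prod>i = 1..m. average Q (?g i)) p * v x \<le> H N x"
    if "Q \<in> cubes" "x \<in> Q" for Q x
  proof -
    obtain a l where Q: "Q = cbox a (\<chi> i. a $ i + l)" "0 < l"
      using \<open>Q \<in> cubes\<close> by (auto simp: cubes_def)
    obtain N0 where N0: "3 * l < 2 ^ N0" using real_arch_pow[of 2 "3 * l"] by auto
    show ?thesis
      unfolding eventually_sequentially
    proof (intro exI allI impI)
      fix N assume "N0 \<le> N"
      then have "(2::real) ^ N0 \<le> 2 ^ N" by (intro power_increasing) auto
      with N0 have "3 * l \<le> 2 ^ N" by linarith
      from cube_le_grid_cell[OF Q(1) \<open>x \<in> Q\<close> Q(2) this] obtain b k where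
        bk: "\<And>g. average Q g \<le> 6 ^ CARD('n) * mean_on lebesgue (?G N b k x) g"
        by blast
      have "(\<Prod>i = 1..m. average Q (?g i)) \<le>
          (\<Prod>i = 1..m. 6 ^ CARD('n) * mean_on lebesgue (?G N b k x) (?g i))"
        by (intro prod_mono_ennreal bk)
      also have "\<dots> = ?c * (\<Prod>i = 1..m. mean_on lebesgue (?G N b k x) (?g i))"
        by (simp add: prod.distrib)
      also have "\<dots> \<le> ?c * D N b x"
        unfolding D_def by (intro mult_left_mono SUP_upper) auto
      finally have "ennpow (\<Prod>i = 1..m. average Q (?g i)) p * v x \<le> ennpow (?c * D N b x) p * v x"
        using p by (intro mult_right_mono ennpow_mono) auto
      also have "\<dots> = ennpow ?c p * (ennpow (D N b x) p * v x)"
        using p by (simp add: ennpow_mult mult.assoc)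
      also have "\<dots> \<le> H N x"
        unfolding H_def by (rule member_le_sum) auto
      finally show "ennpow (\<Prod>i = 1..m. average Q (?g i)) p * v x \<le> H N x" .
    qed
  qed
  have pointwise: "ennpow (multi_maximal m f x) p * v x \<le> liminf (\<lambda>N. H N x)" for x
  proof -
    let ?Z = "liminf (\<lambda>N. H N x)"
    have "(\<Prod>i = 1..m. average Q (?g i)) \<le> ennpow (?Z / v x) (1 / p)"
      if "Q \<in> cubes" "x \<in> Q" for Q
      unfolding ennpow_le_iff[OF p, symmetric]
    proof -
      let ?y = "ennpow (\<Prod>i = 1..m. average Q (?g i)) p"
      have "?y * v x \<le> ?Z"
        using cube[OF that] by (rule Liminf_bounded)
      then have "?y * v x / v x \<le> ?Z / v x"
        by (rule divide_right_mono_ennreal)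
      then show "?y \<le> ?Z / v x"
        using v_pos[of x] by (subst (asm) ennreal_mult_divide_eq) auto
    qed
    then have "multi_maximal m f x \<le> ennpow (?Z / v x) (1 / p)"
      unfolding multi_maximal_def by (intro SUP_least) auto
    then have "ennpow (multi_maximal m f x) p * v x \<le> ?Z / v x * v x"
      unfolding ennpow_le_iff[OF p, symmetric] by (intro mult_right_mono) auto
    also have "\<dots> = ?Z"
    proof -
      have "v x / v x = 1" using v_pos[of x] by (intro ennreal_divide_self) auto
      then show ?thesis by (simp only: ennreal_divide_times mult_1_right)
    qed
    finally show ?thesis .
  qed
  have "(\<integral>\<^sup>+x. ennpow (multi_maximal m f x) p * v x \<partial>lebesgue) \<le> (\<integral>\<^sup>+x. liminf (\<lambda>N. H N x) \<partial>lebesgue)"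
    by (intro nn_integral_mono pointwise)
  also have "\<dots> \<le> liminf (\<lambda>N. \<integral>\<^sup>+x. H N x \<partial>lebesgue)"
    by (rule nn_integral_liminf) measurable
  also have "\<dots> \<le> liminf (\<lambda>N. ennpow ?c p * of_nat (card (UNIV :: ('n \<Rightarrow> bool) set)) * B)"
  proof (intro Liminf_mono always_eventually allI)
    fix N
    have "(\<integral>\<^sup>+x. H N x \<partial>lebesgue) = (\<Sum>b\<in>UNIV. ennpow ?c p * (\<integral>\<^sup>+x. ennpow (D N b x) p * v x \<partial>lebesgue))"
      unfolding H_def by (subst nn_integral_sum) (auto simp: nn_integral_cmult)
    also have "\<dots> \<le> (\<Sum>b\<in>(UNIV :: ('n \<Rightarrow> bool) set). ennpow ?c p * B)"
      unfolding D_def by (intro sum_mono mult_left_mono bound) auto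
    finally show "(\<integral>\<^sup>+x. H N x \<partial>lebesgue) \<le> ennpow ?c p * of_nat (card (UNIV :: ('n \<Rightarrow> bool) set)) * B"
      by (simp add: ac_simps)
  qed
  also have "\<dots> = ennpow ?c p * of_nat (card (UNIV :: ('n \<Rightarrow> bool) set)) * B"
    by (rule Liminf_const) simp
  finally show ?thesis .
qed

section \<open>Admissible exponents\<close>

text \<open>
A version of the weight that is real and positive everywhere, as an almost everywhere equal weight has the same
integrals.
\<close>

definition real_weight :: "('a \<Rightarrow> ennreal) \<Rightarrow> 'a \<Rightarrow> real" where
  "real_weight w x = (if 0 < w x \<and> w x < top then enn2real (w x) else 1)"

lemma real_weight_pos: "0 < real_weight w x"
  by (simp add: real_weight_def enn2real_positive_iff)

lemma measurable_real_weight [measurable]: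
  assumes [measurable]: "w \<in> borel_measurable M"
  shows "real_weight w \<in> borel_measurable M"
  unfolding real_weight_def by measurable

lemma real_weight_AE:
  assumes "\<And>i. i \<in> {1..m :: nat} \<Longrightarrow> weight (w i)"
  shows "AE x in lebesgue. \<forall>i\<in>{1..m}. w i x = ennreal (real_weight (w i) x)"
proof (rule AE_finite_allI)
  show "finite {1..m}" by simp
next
  fix i assume "i \<in> {1..m}"
  then have "AE x in lebesgue. 0 < w i x \<and> w i x < \<infinity>"
    using assms by (auto simp: weight_def)
  then show "AE x in lebesgue. w i x = ennreal (real_weight (w i) x)"
    by eventually_elim (auto simp: real_weight_def)
qed

lemma product_weight_eq:
  assumes "\<forall>i\<in>{1..m}. w i x = ennreal (real_weight (w i) x)"
  shows "product_weight m p P w x = joint_weight m p P (\<lambda>i. real_weight (w i)) x"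
proof -
  have "ennpow (w i x) (p / P i) = ennreal (real_weight (w i) x powr (p / P i))" if "i \<in> {1..m}" for i
    using assms that by (metis ennpow_ennreal real_weight_pos)
  then show ?thesis
    unfolding product_weight_def joint_weight_def
    by (subst prod_ennreal[symmetric]) (auto intro: prod.cong)
qed

lemma dual_weight_eq:
  assumes "w i x = ennreal (real_weight (w i) x)"
  shows "ennpow (w i x) (1 - conj_exponent (P i)) = dual_weight P (\<lambda>i. real_weight (w i)) i x"
  unfolding dual_weight_def using assms by (metis ennpow_ennreal real_weight_pos)

lemma average_cong_AE:
  assumes "AE x in lebesgue. g x = h x"
  shows "average Q g = average Q h"
proof -
  have "AE x in lebesgue. g x * indicator Q x = h x * indicator Q x"
    using assms by eventually_elim simp
  then show ?thesis
    unfolding average_def by (simp cong: nn_integral_cong_AE)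
qed

lemma weighted_cells_grid:
  fixes w :: "nat \<Rightarrow> real ^ 'n \<Rightarrow> ennreal" and u :: "real ^ 'n"
  assumes m: "1 \<le> m" and P: "\<And>i. i \<in> {1..m} \<Longrightarrow> 1 < P i" and p: "1 / p = (\<Sum>i = 1..m. 1 / P i)"
    and w: "w \<in> AP_weights m p P" and L: "0 < L"
  shows "weighted_cells lebesgue (grid_cell L u) m p P (\<lambda>i. real_weight (w i)) (AP_const m p P w)"
proof -
  let ?w = "\<lambda>i. real_weight (w i)"
  interpret nested_partitions lebesgue "grid_cell L u" by (rule nested_partitions_grid[OF L])
  have wt: "weight (w i)" if "i \<in> {1..m}" for i
    using w that by (auto simp: AP_weights_def)
  have AE: "AE x in lebesgue. \<forall>i\<in>{1..m}. w i x = ennreal (real_weight (w i) x)"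
    by (rule real_weight_AE) (rule wt)
  interpret multilinear_exponents m p P by unfold_locales (fact m P p)+
  have joint: "average Q (product_weight m p P w) = average Q (joint_weight m p P ?w)" for Q
    by (rule average_cong_AE) (use AE in \<open>rule eventually_mono\<close>, rule product_weight_eq)
  have dual: "average Q (\<lambda>x. ennpow (w i x) (1 - conj_exponent (P i))) =
      average Q (dual_weight P ?w i)" if "i \<in> {1..m}" for Q i
    by (rule average_cong_AE) (use AE in \<open>rule eventually_mono\<close>, rule dual_weight_eq, erule bspec[OF _ that])
  show ?thesis
  proof
    fix k x
    let ?C = "grid_cell L u k x"
    obtain Q where Q: "Q \<in> cubes" "\<And>g. mean_on lebesgue (grid_cell L u k x) g \<le> average Q g"
      using grid_cell_le_cube[OF L] by blast
    have "mean_on lebesgue ?C (joint_weight m p P ?w) *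
        (\<Prod>i = 1..m. ennpow (mean_on lebesgue ?C (dual_weight P ?w i)) (p / conj_exponent (P i)))
      \<le> average Q (product_weight m p P w) *
        (\<Prod>i = 1..m. ennpow (average Q (\<lambda>x. ennpow (w i x) (1 - conj_exponent (P i)))) (p / conj_exponent (P i)))"
      unfolding joint
    proof (intro mult_mono Q(2) prod_mono_ennreal)
      fix i assume i: "i \<in> {1..m}"
      show "ennpow (mean_on lebesgue ?C (dual_weight P ?w i)) (p / conj_exponent (P i)) \<le>
          ennpow (average Q (\<lambda>x. ennpow (w i x) (1 - conj_exponent (P i)))) (p / conj_exponent (P i))"
        unfolding dual[OF i]
        using exponent_pos[OF i] by (intro ennpow_mono Q(2)) simp
    qed auto
    also have "\<dots> \<le> AP_const m p P w"
      unfolding AP_const_def by (rule SUP_upper[OF Q(1)])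
    finally show "mean_on lebesgue ?C (joint_weight m p P ?w) *
        (\<Prod>i = 1..m. ennpow (mean_on lebesgue ?C (dual_weight P ?w i)) (p / conj_exponent (P i)))
      \<le> AP_const m p P w" .
  next
    show "AP_const m p P w \<noteq> top" using w by (auto simp: AP_weights_def)
    show "emeasure lebesgue (grid_cell L u k x) \<noteq> 0" for k x
      unfolding emeasure_grid_cell[OF L] using L by simp
    show "real_weight (w i) \<in> borel_measurable lebesgue" if "i \<in> {1..m}" for i
      using wt[OF that] by (auto simp: weight_def intro: measurable_real_weight)
  qed (use m P p in \<open>auto simp: real_weight_pos\<close>)
qed

text \<open>
The bound is for \<open>p\<close>-th powers of norms; taking \<open>p\<close>-th roots divides the exponent \<open>e\<close> by \<open>p\<close>.
\<close>

lemma admissible_if_cell_bound: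
  fixes K :: ennreal
  assumes m: "1 \<le> m" and P: "\<And>i. i \<in> {1..m} \<Longrightarrow> 1 < P i" and p: "1 / p = (\<Sum>i = 1..m. 1 / P i)"
    and e: "0 < e" and K: "K \<noteq> top"
    and bound: "\<And>cell w A f. weighted_cells lebesgue cell m p P w A \<Longrightarrow>
        (\<And>i. i \<in> {1..m} \<Longrightarrow> f i \<in> borel_measurable (lebesgue :: (real ^ 'n) measure)) \<Longrightarrow>
        (\<integral>\<^sup>+x. ennpow (SUP k. \<Prod>i = 1..m. mean_on lebesgue (cell k x) (f i)) p * joint_weight m p P w x \<partial>lebesgue) \<le>
        K * ennpow A e * (\<Prod>i = 1..m. ennpow (\<integral>\<^sup>+x. ennpow (f i x) (P i) * ennreal (w i x) \<partial>lebesgue) (p / P i))"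
  shows "e / p \<in> admissible_exponents TYPE('n::finite) m p P"
proof -
  interpret multilinear_exponents m p P by unfold_locales (fact m P p)+
  define C :: ennreal where "C = ennpow ((6 ^ CARD('n)) ^ m) p * of_nat (card (UNIV :: ('n \<Rightarrow> bool) set)) * K"
  have "(6 ^ CARD('n)) ^ m \<noteq> (top :: ennreal)"
    by (simp add: power_eq_top_ennreal)
  then have C: "C \<noteq> top"
    using K p_pos by (simp add: C_def ennreal_mult_eq_top_iff ennpow_eq_top_iff)
  then have C': "ennpow C (1 / p) \<noteq> top"
    using p_pos by (simp add: ennpow_eq_top_iff)
  show ?thesis
    unfolding admissible_exponents_def
  proof (intro CollectI exI[of _ "enn2real (ennpow C (1 / p))"] ballI allI impI)
    fix w :: "nat \<Rightarrow> real ^ 'n \<Rightarrow> ennreal" and f :: "nat \<Rightarrow> real ^ 'n \<Rightarrow> complex"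
    assume w: "w \<in> AP_weights m p P" and f: "\<forall>i\<in>{1..m}. f i \<in> borel_measurable lebesgue"
    define A where "A = AP_const m p P w"
    define w' where "w' i = real_weight (w i)" for i
    define X where "X i = (\<integral>\<^sup>+x. ennpow (ennreal (norm (f i x))) (P i) * w i x \<partial>lebesgue)" for i
    have wc: "weighted_cells lebesgue (grid_cell L u) m p P w' A" if "0 < L" for L u
      unfolding A_def w'_def by (rule weighted_cells_grid[OF m P p w that])
    have "AE x in lebesgue. \<forall>i\<in>{1..m}. w i x = ennreal (w' i x)"
      unfolding w'_def using w by (intro real_weight_AE) (auto simp: AP_weights_def)
    note AE = this
    have X: "X i = (\<integral>\<^sup>+x. ennpow (ennreal (norm (f i x))) (P i) * ennreal (w' i x) \<partial>lebesgue)" if "i \<in> {1..m}" for i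
      unfolding X_def by (rule nn_integral_cong_AE) (use AE in eventually_elim, use that in simp)
    have fm: "(\<lambda>y. ennreal (norm (f i y))) \<in> borel_measurable lebesgue" if "i \<in> {1..m}" for i
    proof -
      have [measurable]: "f i \<in> borel_measurable lebesgue" using f that by simp
      show ?thesis by measurable
    qed
    have "(\<integral>\<^sup>+x. ennpow (multi_maximal m f x) p * product_weight m p P w x \<partial>lebesgue) =
        (\<integral>\<^sup>+x. ennpow (multi_maximal m f x) p * joint_weight m p P w' x \<partial>lebesgue)"
      by (rule nn_integral_cong_AE)
        (use AE in eventually_elim, simp add: product_weight_eq w'_def[abs_def])
    also have "\<dots> \<le> ennpow ((6 ^ CARD('n)) ^ m) p * of_nat (card (UNIV :: ('n \<Rightarrow> bool) set)) *
        (K * ennpow A e * (\<Prod>i = 1..m. ennpow (X i) (p / P i)))"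
    proof (rule multi_maximal_le_grids[OF p_pos])
      show "joint_weight m p P w' \<in> borel_measurable lebesgue"
        using weighted_cells.measurable_joint_weight[OF wc[of 1]] by simp
      show "0 < joint_weight m p P w' x \<and> joint_weight m p P w' x < top" for x
        unfolding joint_weight_def w'_def by (auto intro!: prod_pos simp: less_imp_neq[OF real_weight_pos, symmetric])
      fix L :: real and u :: "real ^ 'n" assume L: "0 < L"
      have "(\<Prod>i = 1..m. ennpow (X i) (p / P i)) =
          (\<Prod>i = 1..m. ennpow (\<integral>\<^sup>+x. ennpow (ennreal (norm (f i x))) (P i) * ennreal (w' i x) \<partial>lebesgue) (p / P i))"
        by (intro prod.cong refl) (simp add: X)
      then show "(\<integral>\<^sup>+x. ennpow (SUP k. \<Prod>i = 1..m. mean_on lebesgue (grid_cell L u k x) (\<lambda>y. ennreal (norm (f i y)))) p *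
          joint_weight m p P w' x \<partial>lebesgue) \<le> K * ennpow A e * (\<Prod>i = 1..m. ennpow (X i) (p / P i))"
        using bound[OF wc[OF L], of "\<lambda>i y. ennreal (norm (f i y))"] fm by simp
    qed
    also have "\<dots> = C * ennpow A e * (\<Prod>i = 1..m. ennpow (X i) (p / P i))"
      by (simp only: C_def ac_simps)
    finally have "weighted_norm p (product_weight m p P w) (multi_maximal m f) \<le>
        ennpow (C * ennpow A e * (\<Prod>i = 1..m. ennpow (X i) (p / P i))) (1 / p)"
      unfolding weighted_norm_def using p_pos by (intro ennpow_mono) auto
    also have "\<dots> = ennpow C (1 / p) * ennpow A (e / p) * (\<Prod>i = 1..m. ennpow (X i) (1 / P i))"
    proof -
      have "(\<Prod>i = 1..m. ennpow (ennpow (X i) (p / P i)) (1 / p)) = (\<Prod>i = 1..m. ennpow (X i) (1 / P i))"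
      proof (rule prod.cong[OF refl])
        fix i assume i: "i \<in> {1..m}"
        show "ennpow (ennpow (X i) (p / P i)) (1 / p) = ennpow (X i) (1 / P i)"
          using P_pos[OF i] p_pos by (subst ennpow_ennpow) auto
      qed
      then show ?thesis
        using p_pos e by (simp add: ennpow_mult ennpow_prod ennpow_ennpow)
    qed
    finally show "weighted_norm p (product_weight m p P w) (multi_maximal m f) \<le>
        ennreal (enn2real (ennpow C (1 / p))) * ennpow (AP_const m p P w) (e / p) *
        (\<Prod>i = 1..m. weighted_norm (P i) (w i) (\<lambda>x. ennreal (norm (f i x))))"
      using C' by (simp add: weighted_norm_def X_def A_def less_top)
  qed
qed

theorem mixed_exponent_admissible:
  assumes m: "1 \<le> m" and P: "\<And>i. i \<in> {1..m} \<Longrightarrow> 1 < P i" and p: "1 / p = (\<Sum>i = 1..m. 1 / P i)"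
  shows "1 / p * (1 + (\<Sum>i = 1..m. 1 / (P i - 1))) \<in> admissible_exponents TYPE('n::finite) m p P"
proof -
  interpret multilinear_exponents m p P by unfold_locales (fact m P p)+
  have "0 \<le> (\<Sum>i = 1..m. 1 / (P i - 1))"
    by (intro sum_nonneg) (use P in \<open>auto simp: less_imp_le\<close>)
  then have e: "0 < 1 + (\<Sum>i = 1..m. 1 / (P i - 1))" by simp
  have "(1 + (\<Sum>i = 1..m. 1 / (P i - 1))) / p \<in> admissible_exponents TYPE('n) m p P"
  proof (rule admissible_if_cell_bound[OF m P p e sparse_const_finite[OF p_pos P]])
    fix cell :: "nat \<Rightarrow> real ^ 'n \<Rightarrow> (real ^ 'n) set" and w A and f :: "nat \<Rightarrow> real ^ 'n \<Rightarrow> ennreal"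
    assume wc: "weighted_cells lebesgue cell m p P w A" and f: "\<And>i. i \<in> {1..m} \<Longrightarrow> f i \<in> borel_measurable lebesgue"
    show "(\<integral>\<^sup>+x. ennpow (SUP k. \<Prod>i = 1..m. mean_on lebesgue (cell k x) (f i)) p * joint_weight m p P w x \<partial>lebesgue) \<le>
        sparse_const m p P * ennpow A (1 + (\<Sum>i = 1..m. 1 / (P i - 1))) *
        (\<Prod>i = 1..m. ennpow (\<integral>\<^sup>+x. ennpow (f i x) (P i) * ennreal (w i x) \<partial>lebesgue) (p / P i))"
      by (rule weighted_cells.multilinear_cell_maximal_mixed_bound[OF wc f])
  qed
  then show ?thesis by simp
qed

theorem diagonal_exponent_admissible:
  assumes m: "1 \<le> m" and P: "\<And>i. i \<in> {1..m} \<Longrightarrow> P i = r" and r: "1 < r" and p: "1 / p = (\<Sum>i = 1..m. 1 / P i)"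
  shows "m / (r - 1) \<in> admissible_exponents TYPE('n::finite) m p P"
proof -
  have "1 / p = real m * (1 / r)" unfolding p using P by simp
  moreover have "0 < p"
    by (rule multilinear_exponents.p_pos, unfold_locales) (use m P r p in auto)
  ultimately have p_eq: "p = r / real m" using m r by (simp add: field_simps)
  have "conj_exponent r / p \<in> admissible_exponents TYPE('n) m p P"
  proof (rule admissible_if_cell_bound[OF m _ p])
    show "1 < P i" if "i \<in> {1..m}" for i using P[OF that] r by simp
    show "0 < conj_exponent r" using conj_exponent_gt_1[OF r] by simp
    show "strong_const (conj_exponent r) * strong_const r \<noteq> top"
      by (simp add: strong_const_def ennreal_mult_eq_top_iff)
  next
    fix cell :: "nat \<Rightarrow> real ^ 'n \<Rightarrow> (real ^ 'n) set" and w A and f :: "nat \<Rightarrow> real ^ 'n \<Rightarrow> ennreal"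
    assume wc: "weighted_cells lebesgue cell m p P w A" and f: "\<And>i. i \<in> {1..m} \<Longrightarrow> f i \<in> borel_measurable lebesgue"
    show "(\<integral>\<^sup>+x. ennpow (SUP k. \<Prod>i = 1..m. mean_on lebesgue (cell k x) (f i)) p * joint_weight m p P w x \<partial>lebesgue) \<le>
        strong_const (conj_exponent r) * strong_const r * ennpow A (conj_exponent r) *
        (\<Prod>i = 1..m. ennpow (\<integral>\<^sup>+x. ennpow (f i x) (P i) * ennreal (w i x) \<partial>lebesgue) (p / P i))"
      by (rule weighted_cells.multilinear_cell_maximal_diagonal_bound[OF wc f P])
  qed
  also have "conj_exponent r / p = m / (r - 1)"
    using r m by (simp add: p_eq conj_exponent_def)
  finally show ?thesis .
qed

section \<open>Power weights\<close>

lemma AE_coordinate_neq: "AE x in lebesgue. (x :: real ^ 'n) $ j \<noteq> c"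
proof -
  have "negligible {x :: real ^ 'n. x \<bullet> axis j 1 = c}"
    by (rule negligible_standard_hyperplane) (auto simp: Basis_vec_def)
  then have "{x :: real ^ 'n. x $ j = c} \<in> null_sets lebesgue"
    by (simp add: negligible_iff_null_sets inner_axis)
  then show ?thesis by (rule AE_not_in[THEN eventually_mono]) simp
qed

text \<open>
Fubini's theorem: the integrand is a product of functions of the single coordinates.
\<close>

lemma nn_integral_cube_coordinate:
  fixes a :: "real ^ 'n" and h :: "real \<Rightarrow> ennreal"
  assumes [measurable]: "h \<in> borel_measurable borel" and l: "0 < l"
  shows "(\<integral>\<^sup>+x\<in>cbox a (\<chi> i. a $ i + l). h (x $ j) \<partial>lebesgue) =
    ennreal (l ^ (CARD('n) - 1)) * (\<integral>\<^sup>+t\<in>{a $ j..a $ j + l}. h t \<partial>lborel)"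
proof -
  define g where "g b t = (if b = axis j 1 then h t else 1) * indicator {a \<bullet> b..a \<bullet> b + l} t" for b :: "real ^ 'n" and t
  have [measurable]: "g b \<in> borel_measurable borel" for b
    unfolding g_def by measurable
  have prod_Basis: "(\<Prod>b\<in>Basis. q b) = (\<Prod>i\<in>UNIV. q (axis i 1))" for q :: "real ^ 'n \<Rightarrow> ennreal"
  proof -
    have Basis: "Basis = (\<lambda>i. axis i 1 :: real ^ 'n) ` UNIV" by (auto simp: Basis_vec_def)
    have "inj (\<lambda>i. axis i 1 :: real ^ 'n)" by (auto simp: inj_on_def axis_eq_axis)
    then show ?thesis unfolding Basis by (subst prod.reindex) (auto simp: o_def)
  qed
  have split: "(\<Prod>i\<in>UNIV. q i) = q j * (\<Prod>i\<in>UNIV - {j}. q i)" for q :: "'n \<Rightarrow> ennreal"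
    by (rule prod.remove) auto
  have "h (x $ j) * indicator (cbox a (\<chi> i. a $ i + l)) x = (\<Prod>b\<in>Basis. g b (x \<bullet> b))" for x
  proof -
    have "(\<Prod>i\<in>UNIV. indicator {a $ i..a $ i + l} (x $ i) :: ennreal) = indicator (cbox a (\<chi> i. a $ i + l)) x"
      by (auto simp: indicator_def mem_box_cart prod_zero_iff)
    moreover have "(\<Prod>b\<in>Basis. g b (x \<bullet> b)) = (\<Prod>i\<in>UNIV. (if i = j then h (x $ j) else 1)) * (\<Prod>i\<in>UNIV. indicator {a $ i..a $ i + l} (x $ i))"
      unfolding prod_Basis prod.distrib[symmetric] g_def
      by (intro prod.cong refl) (auto simp: inner_axis axis_eq_axis)
    ultimately show ?thesis by simp
  qed
  then have "(\<integral>\<^sup>+x\<in>cbox a (\<chi> i. a $ i + l). h (x $ j) \<partial>lebesgue) = (\<integral>\<^sup>+x. (\<Prod>b\<in>Basis. g b (x \<bullet> b)) \<partial>lborel)"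
    by (simp add: nn_integral_completion)
  also have "\<dots> = (\<Prod>b\<in>Basis. \<integral>\<^sup>+t. g b t \<partial>lborel)"
    by (rule nn_integral_lborel_prod) auto
  also have "\<dots> = (\<integral>\<^sup>+t. g (axis j 1) t \<partial>lborel) * (\<Prod>i\<in>UNIV - {j}. \<integral>\<^sup>+t. g (axis i 1) t \<partial>lborel)"
    unfolding prod_Basis by (rule split)
  also have "(\<Prod>i\<in>UNIV - {j}. \<integral>\<^sup>+t. g (axis i 1) t \<partial>lborel) = (\<Prod>i\<in>UNIV - {j}. ennreal l)"
  proof (rule prod.cong[OF refl])
    fix i assume "i \<in> UNIV - {j}"
    then have "g (axis i 1) = indicator {a $ i..a $ i + l}"
      by (auto simp: g_def fun_eq_iff inner_axis axis_eq_axis)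
    then show "(\<integral>\<^sup>+t. g (axis i 1) t \<partial>lborel) = ennreal l"
      using l by simp
  qed
  also have "\<dots> = ennreal (l ^ (CARD('n) - 1))"
    using l by (simp add: ennreal_power card_Diff_singleton)
  finally show ?thesis
    by (simp add: g_def inner_axis mult.commute)
qed

lemma average_cube_coordinate:
  fixes a :: "real ^ 'n" and h :: "real \<Rightarrow> ennreal"
  assumes "h \<in> borel_measurable borel" and l: "0 < l"
  shows "average (cbox a (\<chi> i. a $ i + l)) (\<lambda>x. h (x $ j)) = (\<integral>\<^sup>+t\<in>{a $ j..a $ j + l}. h t \<partial>lborel) / ennreal l"
proof -
  have "l ^ CARD('n) = l ^ (CARD('n) - 1) * l"
    by (metis One_nat_def Suc_pred power_Suc2 zero_less_card_finite)
  then have "ennreal (l ^ CARD('n)) = ennreal (l ^ (CARD('n) - 1)) * ennreal l"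
    using l by (simp add: ennreal_mult)
  moreover have "ennreal (l ^ (CARD('n) - 1)) \<noteq> 0" "ennreal (l ^ (CARD('n) - 1)) \<noteq> \<infinity>"
    using l by (auto simp: ennreal_eq_0_iff not_le)
  ultimately show ?thesis
    unfolding average_def nn_integral_cube_coordinate[OF assms] emeasure_cube(1)[OF l]
    by (simp only: divide_mult_eq simp_thms mult.commute[of "ennreal (l ^ (CARD('n) - 1))"])
qed

lemma nn_integral_power:
  assumes "-1 < c" "0 \<le> b"
  shows "(\<integral>\<^sup>+t\<in>{0..b}. ennreal (t powr c) \<partial>lborel) = ennreal (b powr (c + 1) / (c + 1))"
  using assms by (intro nn_integral_has_integral_lebesgue' has_integral_powr_from_0) auto

text \<open>
If \<open>R \<le> 2 l\<close>, enlarge the interval to \<open>[-R, R]\<close>, whose length is comparable. Otherwise the interval stays at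
distance at least \<open>R / 2\<close> from the origin, and the integrand is comparable with its value at \<open>R\<close>.
\<close>

lemma nn_integral_abs_power_le:
  fixes a l \<epsilon> :: real
  assumes \<epsilon>: "0 < \<epsilon>" "\<epsilon> \<le> 1" and l: "0 < l"
  defines "R \<equiv> max \<bar>a\<bar> \<bar>a + l\<bar>"
  shows "(\<integral>\<^sup>+t\<in>{a..a + l}. ennreal (\<bar>t\<bar> powr (\<epsilon> - 1)) \<partial>lborel) \<le> ennreal (4 * R powr (\<epsilon> - 1) / \<epsilon> * l)"
proof (cases "R \<le> 2 * l")
  case True
  have R: "0 < R" using l by (auto simp: R_def)
  have "(\<integral>\<^sup>+t\<in>{a..a + l}. ennreal (\<bar>t\<bar> powr (\<epsilon> - 1)) \<partial>lborel) \<le>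
      (\<integral>\<^sup>+t. ennreal (\<bar>t\<bar> powr (\<epsilon> - 1)) * indicator {0..R} t + ennreal (\<bar>t\<bar> powr (\<epsilon> - 1)) * indicator {-R..0} t \<partial>lborel)"
  proof (rule nn_integral_mono)
    fix t
    have "t \<in> {a..a + l} \<Longrightarrow> t \<in> {0..R} \<or> t \<in> {-R..0}" by (auto simp: R_def)
    then show "ennreal (\<bar>t\<bar> powr (\<epsilon> - 1)) * indicator {a..a + l} t \<le>
        ennreal (\<bar>t\<bar> powr (\<epsilon> - 1)) * indicator {0..R} t + ennreal (\<bar>t\<bar> powr (\<epsilon> - 1)) * indicator {-R..0} t"
      by (auto simp: indicator_def)
  qed
  also have "\<dots> = (\<integral>\<^sup>+t\<in>{0..R}. ennreal (\<bar>t\<bar> powr (\<epsilon> - 1)) \<partial>lborel) + (\<integral>\<^sup>+t\<in>{-R..0}. ennreal (\<bar>t\<bar> powr (\<epsilon> - 1)) \<partial>lborel)"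
    by (rule nn_integral_add) measurable
  also have "(\<integral>\<^sup>+t\<in>{-R..0}. ennreal (\<bar>t\<bar> powr (\<epsilon> - 1)) \<partial>lborel) = (\<integral>\<^sup>+t\<in>{0..R}. ennreal (\<bar>t\<bar> powr (\<epsilon> - 1)) \<partial>lborel)"
    by (subst nn_integral_real_affine[where c = "-1" and t = 0]) (auto simp: indicator_def intro!: nn_integral_cong)
  also have "(\<integral>\<^sup>+t\<in>{0..R}. ennreal (\<bar>t\<bar> powr (\<epsilon> - 1)) \<partial>lborel) = (\<integral>\<^sup>+t\<in>{0..R}. ennreal (t powr (\<epsilon> - 1)) \<partial>lborel)"
    by (intro nn_integral_cong) (auto simp: indicator_def)
  also have "\<dots> = ennreal (R powr \<epsilon> / \<epsilon>)"
    using \<epsilon> R by (subst nn_integral_power) auto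
  also have "ennreal (R powr \<epsilon> / \<epsilon>) + ennreal (R powr \<epsilon> / \<epsilon>) = ennreal (2 * R powr \<epsilon> / \<epsilon>)"
    using \<epsilon> by (subst ennreal_plus[symmetric]) auto
  also have "\<dots> \<le> ennreal (4 * R powr (\<epsilon> - 1) / \<epsilon> * l)"
  proof (rule ennreal_leI)
    have "R powr \<epsilon> = R powr (\<epsilon> - 1) * R" using R by (simp add: powr_diff)
    then have "2 * R powr \<epsilon> \<le> 4 * R powr (\<epsilon> - 1) * l"
      using mult_left_mono[OF True, of "2 * R powr (\<epsilon> - 1)"] by (simp add: mult.assoc)
    then have "2 * R powr \<epsilon> / \<epsilon> \<le> 4 * R powr (\<epsilon> - 1) * l / \<epsilon>"
      using \<epsilon> by (intro divide_right_mono) auto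
    then show "2 * R powr \<epsilon> / \<epsilon> \<le> 4 * R powr (\<epsilon> - 1) / \<epsilon> * l" by simp
  qed
  finally show ?thesis .
next
  case False
  then have R: "0 < R" using l by linarith
  have "(\<integral>\<^sup>+t\<in>{a..a + l}. ennreal (\<bar>t\<bar> powr (\<epsilon> - 1)) \<partial>lborel) \<le>
      (\<integral>\<^sup>+t. ennreal (4 * R powr (\<epsilon> - 1) / \<epsilon>) * indicator {a..a + l} t \<partial>lborel)"
  proof (rule nn_integral_mono)
    fix t
    have "\<bar>t\<bar> powr (\<epsilon> - 1) \<le> 4 * R powr (\<epsilon> - 1) / \<epsilon>" if "t \<in> {a..a + l}"
    proof -
      have "R / 2 \<le> \<bar>t\<bar>" using that False unfolding R_def by (auto simp: max_def abs_if split: if_splits)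
      then have "\<bar>t\<bar> powr (\<epsilon> - 1) \<le> (R / 2) powr (\<epsilon> - 1)"
        using R \<epsilon> by (intro powr_mono2') auto
      also have "\<dots> = R powr (\<epsilon> - 1) * 2 powr (1 - \<epsilon>)"
        using R by (simp add: powr_divide powr_diff)
      also have "\<dots> \<le> R powr (\<epsilon> - 1) * (4 / \<epsilon>)"
      proof (rule mult_left_mono)
        have "2 powr (1 - \<epsilon>) \<le> (2::real) powr 1" using \<epsilon> by (intro powr_mono) auto
        also have "\<dots> \<le> 4 / \<epsilon>" using \<epsilon> by (simp add: field_simps)
        finally show "2 powr (1 - \<epsilon>) \<le> 4 / \<epsilon>" .
      qed simp
      finally show ?thesis by (simp add: mult.commute)
    qed
    then show "ennreal (\<bar>t\<bar> powr (\<epsilon> - 1)) * indicator {a..a + l} t \<le> ennreal (4 * R powr (\<epsilon> - 1) / \<epsilon>) * indicator {a..a + l} t"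
      by (auto simp: indicator_def intro: ennreal_leI)
  qed
  also have "\<dots> = ennreal (4 * R powr (\<epsilon> - 1) / \<epsilon>) * ennreal l"
    using l by (simp add: nn_integral_cmult_indicator)
  also have "\<dots> = ennreal (4 * R powr (\<epsilon> - 1) / \<epsilon> * l)"
    using l \<epsilon> by (intro ennreal_mult[symmetric]) auto
  finally show ?thesis .
qed

text \<open>
The exponent is chosen such that each dual weight is \<open>\<bar>x $ j\<bar>\<close> to the power \<open>\<epsilon> - 1\<close>, which is barely
integrable near the hyperplane \<open>x $ j = 0\<close>. As the weights depend on one coordinate only, all averages reduce to
one-dimensional ones, in every dimension.
\<close>

definition power_weight :: "'n \<Rightarrow> real \<Rightarrow> (nat \<Rightarrow> real) \<Rightarrow> nat \<Rightarrow> real ^ 'n \<Rightarrow> ennreal" where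
  "power_weight j \<epsilon> P i x = ennreal (\<bar>x $ j\<bar> powr ((1 - \<epsilon>) * (P i - 1)))"

definition power_fun :: "'n \<Rightarrow> real \<Rightarrow> real ^ 'n \<Rightarrow> complex" where
  "power_fun j \<epsilon> x = of_real (\<bar>x $ j\<bar> powr (\<epsilon> - 1) * indicator (cbox 0 1) x)"

locale power_weight_example = multilinear_exponents m p P
  for m :: nat and p :: real and P :: "nat \<Rightarrow> real" +
  fixes \<epsilon> :: real and j :: "'n::finite"
  assumes \<epsilon>: "0 < \<epsilon>" "\<epsilon> \<le> 1"
begin

abbreviation "w \<equiv> power_weight j \<epsilon> P"
abbreviation "\<gamma> \<equiv> real m * p - 1"

lemma weight_power_weight: "i \<in> {1..m} \<Longrightarrow> weight (w i)"
proof -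
  have "AE x in lebesgue. 0 < w i x \<and> w i x < \<infinity>"
    using AE_coordinate_neq[of j 0] by eventually_elim (auto simp: power_weight_def)
  moreover have "w i \<in> borel_measurable lebesgue"
    unfolding power_weight_def by (intro measurable_completion) measurable
  ultimately show ?thesis by (simp add: weight_def)
qed

lemma product_power_weight:
  assumes "x $ j \<noteq> 0"
  shows "product_weight m p P w x = ennreal (\<bar>x $ j\<bar> powr ((1 - \<epsilon>) * \<gamma>))"
proof -
  have "product_weight m p P w x = (\<Prod>i = 1..m. ennreal (\<bar>x $ j\<bar> powr ((1 - \<epsilon>) * (p - p / P i))))"
    unfolding product_weight_def
  proof (rule prod.cong[OF refl])
    fix i assume i: "i \<in> {1..m}"
    have "(1 - \<epsilon>) * (P i - 1) * (p / P i) = (1 - \<epsilon>) * (p - p / P i)"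
      using P[OF i] by (simp add: field_simps)
    then show "ennpow (w i x) (p / P i) = ennreal (\<bar>x $ j\<bar> powr ((1 - \<epsilon>) * (p - p / P i)))"
      using assms by (simp add: power_weight_def ennpow_ennreal powr_powr)
  qed
  also have "\<dots> = ennreal (\<bar>x $ j\<bar> powr (\<Sum>i = 1..m. (1 - \<epsilon>) * (p - p / P i)))"
    using assms by (simp add: prod_ennreal powr_sum)
  also have "(\<Sum>i = 1..m. (1 - \<epsilon>) * (p - p / P i)) = (1 - \<epsilon>) * \<gamma>"
    using sum_p_P by (simp add: sum_distrib_left[symmetric] sum_subtractf)
  finally show ?thesis .
qed

lemma dual_power_weight:
  assumes "x $ j \<noteq> 0" "i \<in> {1..m}"
  shows "ennpow (w i x) (1 - conj_exponent (P i)) = ennreal (\<bar>x $ j\<bar> powr (\<epsilon> - 1))"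
proof -
  have "(1 - \<epsilon>) * (P i - 1) * (1 - conj_exponent (P i)) = \<epsilon> - 1"
    using P[OF assms(2)] conj_exponent_sub_1[of "P i"] by (simp add: conj_exponent_def field_simps)
  then show ?thesis
    using assms by (simp add: power_weight_def ennpow_ennreal powr_powr)
qed

lemma average_dual_power_weight:
  "i \<in> {1..m} \<Longrightarrow> average Q (\<lambda>x. ennpow (w i x) (1 - conj_exponent (P i))) = average Q (\<lambda>x. ennreal (\<bar>x $ j\<bar> powr (\<epsilon> - 1)))"
  by (rule average_cong_AE, rule eventually_mono[OF AE_coordinate_neq[of j 0]]) (rule dual_power_weight)

lemma average_product_power_weight:
  "average Q (product_weight m p P w) = average Q (\<lambda>x. ennreal (\<bar>x $ j\<bar> powr ((1 - \<epsilon>) * \<gamma>)))"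
  by (rule average_cong_AE, rule eventually_mono[OF AE_coordinate_neq[of j 0]]) (rule product_power_weight)

text \<open>
Let \<open>R\<close> be the largest value of \<open>\<bar>x $ j\<bar>\<close> on the cube. The average of the joint weight is at most its value
at \<open>R\<close>, and the averages of the dual weights exceed their value at \<open>R\<close> at most by the factor \<open>4 / \<epsilon>\<close>. The powers
of \<open>R\<close> cancel.
\<close>

lemma AP_const_power_weight_le: "AP_const m p P w \<le> ennreal ((4 / \<epsilon>) powr \<gamma>)"
  unfolding AP_const_def
proof (rule SUP_least)
  let ?dual = "\<lambda>Q i. average Q (\<lambda>x. ennpow (w i x) (1 - conj_exponent (P i)))"
  fix Q :: "(real ^ 'n) set" assume "Q \<in> cubes"
  then obtain a l where Q: "Q = cbox a (\<chi> i. a $ i + l)" and l: "0 < l" by (auto simp: cubes_def)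
  define R where "R = max \<bar>a $ j\<bar> \<bar>a $ j + l\<bar>"
  have R: "0 < R" using l by (auto simp: R_def)
  have "average Q (product_weight m p P w) \<le> ennreal (R powr ((1 - \<epsilon>) * \<gamma>))"
  proof -
    have "(\<integral>\<^sup>+x\<in>Q. ennreal (\<bar>x $ j\<bar> powr ((1 - \<epsilon>) * \<gamma>)) \<partial>lebesgue) \<le>
        (\<integral>\<^sup>+x. ennreal (R powr ((1 - \<epsilon>) * \<gamma>)) * indicator Q x \<partial>lebesgue)"
    proof (rule nn_integral_mono)
      fix x :: "real ^ 'n"
      have "\<bar>x $ j\<bar> \<le> R" if "x \<in> Q"
        using that by (auto simp: Q mem_box_cart R_def abs_le_iff le_max_iff_disj dest!: spec[of _ j])
      then show "ennreal (\<bar>x $ j\<bar> powr ((1 - \<epsilon>) * \<gamma>)) * indicator Q x \<le> ennreal (R powr ((1 - \<epsilon>) * \<gamma>)) * indicator Q x"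
        using \<epsilon> mp_gt_1 by (auto simp: indicator_def intro!: ennreal_leI powr_mono2)
    qed
    also have "\<dots> = ennreal (R powr ((1 - \<epsilon>) * \<gamma>)) * emeasure lebesgue Q"
      by (rule nn_integral_cmult_indicator) (simp add: Q)
    finally have "average Q (product_weight m p P w) \<le> ennreal (R powr ((1 - \<epsilon>) * \<gamma>)) * emeasure lebesgue Q / emeasure lebesgue Q"
      unfolding average_product_power_weight unfolding average_def by (rule divide_right_mono_ennreal)
    also have "\<dots> = ennreal (R powr ((1 - \<epsilon>) * \<gamma>))"
      unfolding Q emeasure_cube(1)[OF l] using l by (intro ennreal_mult_divide_eq) auto
    finally show ?thesis .
  qed
  moreover have dual: "?dual Q i \<le> ennreal (4 * R powr (\<epsilon> - 1) / \<epsilon>)"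
    if "i \<in> {1..m}" for i
  proof -
    have "?dual Q i =
        (\<integral>\<^sup>+t\<in>{a $ j..a $ j + l}. ennreal (\<bar>t\<bar> powr (\<epsilon> - 1)) \<partial>lborel) / ennreal l"
      unfolding average_dual_power_weight[OF that] Q by (rule average_cube_coordinate[OF _ l]) measurable
    also have "\<dots> \<le> ennreal (4 * R powr (\<epsilon> - 1) / \<epsilon> * l) / ennreal l"
      unfolding R_def by (intro divide_right_mono_ennreal nn_integral_abs_power_le \<epsilon> l)
    also have "\<dots> = ennreal (4 * R powr (\<epsilon> - 1) / \<epsilon>)"
      using l \<epsilon> by (simp add: divide_ennreal)
    finally show ?thesis .
  qed
  ultimately have "average Q (product_weight m p P w) *
      (\<Prod>i = 1..m. ennpow (?dual Q i) (p / conj_exponent (P i))) \<le>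
      ennreal (R powr ((1 - \<epsilon>) * \<gamma>)) * (\<Prod>i = 1..m. ennpow (ennreal (4 * R powr (\<epsilon> - 1) / \<epsilon>)) (p / conj_exponent (P i)))"
    by (intro mult_mono prod_mono_ennreal ennpow_mono dual less_imp_le[OF exponent_pos]) auto
  also have "(\<Prod>i = 1..m. ennpow (ennreal (4 * R powr (\<epsilon> - 1) / \<epsilon>)) (p / conj_exponent (P i))) =
      ennpow (ennreal (4 * R powr (\<epsilon> - 1) / \<epsilon>)) \<gamma>"
    unfolding sum_p_conj[symmetric]
    using m exponent_pos by (subst ennpow_sum_exp) auto
  also have "\<dots> = ennreal ((4 * R powr (\<epsilon> - 1) / \<epsilon>) powr \<gamma>)"
    using R \<epsilon> by (intro ennpow_ennreal) simp
  also have "ennreal (R powr ((1 - \<epsilon>) * \<gamma>)) * \<dots> = ennreal (R powr ((1 - \<epsilon>) * \<gamma>) * (4 * R powr (\<epsilon> - 1) / \<epsilon>) powr \<gamma>)"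
    by (simp add: ennreal_mult)
  also have "R powr ((1 - \<epsilon>) * \<gamma>) * (4 * R powr (\<epsilon> - 1) / \<epsilon>) powr \<gamma> = (4 / \<epsilon>) powr \<gamma>"
  proof -
    have "(4 * R powr (\<epsilon> - 1) / \<epsilon>) powr \<gamma> = (4 / \<epsilon>) powr \<gamma> * R powr ((\<epsilon> - 1) * \<gamma>)"
      using \<epsilon> R by (simp add: powr_mult powr_divide powr_powr)
    moreover have "R powr ((1 - \<epsilon>) * \<gamma>) * R powr ((\<epsilon> - 1) * \<gamma>) = 1"
    proof -
      have "(1 - \<epsilon>) * \<gamma> + (\<epsilon> - 1) * \<gamma> = 0" by (simp add: algebra_simps)
      then show ?thesis using R by (simp only: powr_add[symmetric]) simp
    qed
    ultimately show ?thesis by simp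
  qed
  finally show "average Q (product_weight m p P w) *
      (\<Prod>i = 1..m. ennpow (?dual Q i) (p / conj_exponent (P i))) \<le> ennreal ((4 / \<epsilon>) powr \<gamma>)" .
qed

lemma unit_cube: "cbox 0 1 = cbox (0 :: real ^ 'n) (\<chi> i. 0 $ i + 1)"
  by (rule arg_cong[where f = "cbox 0"]) (simp add: vec_eq_iff)

lemma nn_integral_unit_cube:
  assumes "-1 < c"
  shows "(\<integral>\<^sup>+x\<in>cbox 0 1. ennreal (\<bar>(x :: real ^ 'n) $ j\<bar> powr c) \<partial>lebesgue) = ennreal (1 / (c + 1))"
proof -
  have "(\<integral>\<^sup>+x\<in>cbox 0 1. ennreal (\<bar>(x :: real ^ 'n) $ j\<bar> powr c) \<partial>lebesgue) = (\<integral>\<^sup>+t\<in>{0..1}. ennreal (\<bar>t\<bar> powr c) \<partial>lborel)"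
    unfolding unit_cube by (subst nn_integral_cube_coordinate[where h = "\<lambda>t. ennreal (\<bar>t\<bar> powr c)"]) auto
  also have "\<dots> = (\<integral>\<^sup>+t\<in>{0..1}. ennreal (t powr c) \<partial>lborel)"
    by (intro nn_integral_cong) (auto simp: indicator_def)
  also have "\<dots> = ennreal (1 / (c + 1))"
    using assms by (subst nn_integral_power) auto
  finally show ?thesis .
qed

text \<open>
A positive lower bound independent of \<open>\<epsilon>\<close>, read off from the unit cube. It keeps negative powers of the
constant bounded as \<open>\<epsilon>\<close> tends to zero.
\<close>

lemma AP_const_power_weight_ge: "ennreal (1 / (\<gamma> + 1)) \<le> AP_const m p P w"
proof -
  let ?Q = "cbox 0 1 :: (real ^ 'n) set"
  have cube: "?Q \<in> cubes" unfolding unit_cube cubes_def by (intro CollectI exI[of _ 0] exI[of _ 1]) simp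
  have one: "emeasure lebesgue ?Q = 1" unfolding unit_cube by (subst emeasure_cube) auto
  have "ennreal (1 / (\<gamma> + 1)) \<le> ennreal (1 / ((1 - \<epsilon>) * \<gamma> + 1))"
  proof -
    have "(1 - \<epsilon>) * \<gamma> \<le> 1 * \<gamma>" "0 \<le> (1 - \<epsilon>) * \<gamma>"
      using \<epsilon> mp_gt_1 by (intro mult_right_mono mult_nonneg_nonneg; simp)+
    then show ?thesis by (intro ennreal_leI divide_left_mono mult_pos_pos add_nonneg_pos) auto
  qed
  also have "\<dots> = average ?Q (product_weight m p P w)"
  proof -
    have "- 1 < (1 - \<epsilon>) * \<gamma>" using \<epsilon> mp_gt_1 mult_nonneg_nonneg[of "1 - \<epsilon>" \<gamma>] by linarith
    then show ?thesis
      unfolding average_product_power_weight unfolding average_def one by (subst nn_integral_unit_cube) (auto simp: divide_ennreal_def)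
  qed
  finally have 1: "ennreal (1 / (\<gamma> + 1)) \<le> average ?Q (product_weight m p P w)" .
  have "average ?Q (\<lambda>x. ennpow (w i x) (1 - conj_exponent (P i))) = ennreal (1 / \<epsilon>)" if "i \<in> {1..m}" for i
    unfolding average_dual_power_weight[OF that] unfolding average_def one using \<epsilon> by (subst nn_integral_unit_cube) (auto simp: divide_ennreal_def)
  then have "1 \<le> ennpow (average ?Q (\<lambda>x. ennpow (w i x) (1 - conj_exponent (P i)))) (p / conj_exponent (P i))" if "i \<in> {1..m}" for i
    using ennpow_mono[of "p / conj_exponent (P i)" 1 "ennreal (1 / \<epsilon>)"] that \<epsilon> p_pos conj_exponent_gt_1[OF P[OF that]]
    by simp
  then have "1 \<le> (\<Prod>i = 1..m. ennpow (average ?Q (\<lambda>x. ennpow (w i x) (1 - conj_exponent (P i)))) (p / conj_exponent (P i)))"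
    using prod_mono_ennreal[of "{1..m}" "\<lambda>_. 1"] by simp
  with 1 have "ennreal (1 / (\<gamma> + 1)) * 1 \<le> average ?Q (product_weight m p P w) *
      (\<Prod>i = 1..m. ennpow (average ?Q (\<lambda>x. ennpow (w i x) (1 - conj_exponent (P i)))) (p / conj_exponent (P i)))"
    by (intro mult_mono) auto
  also have "\<dots> \<le> AP_const m p P w"
    unfolding AP_const_def by (rule SUP_upper[OF cube])
  finally show ?thesis by simp
qed

lemma norm_power_fun: "ennreal (norm (power_fun j \<epsilon> x)) = ennreal (\<bar>x $ j\<bar> powr (\<epsilon> - 1)) * indicator (cbox 0 1) x"
  unfolding power_fun_def by (auto simp: indicator_def)

lemma weighted_norm_power_fun:
  assumes i: "i \<in> {1..m}"
  shows "weighted_norm (P i) (w i) (\<lambda>x. ennreal (norm (power_fun j \<epsilon> x))) = ennreal ((1 / \<epsilon>) powr (1 / P i))"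
proof -
  have "(\<integral>\<^sup>+x. ennpow (ennreal (norm (power_fun j \<epsilon> x))) (P i) * w i x \<partial>lebesgue) =
      (\<integral>\<^sup>+x\<in>cbox 0 1. ennreal (\<bar>(x :: real ^ 'n) $ j\<bar> powr (\<epsilon> - 1)) \<partial>lebesgue)"
  proof (rule nn_integral_cong_AE, rule eventually_mono[OF AE_coordinate_neq[of j 0]])
    fix x :: "real ^ 'n" assume x: "x $ j \<noteq> 0"
    have "(\<epsilon> - 1) * P i + (1 - \<epsilon>) * (P i - 1) = \<epsilon> - 1" by (simp add: algebra_simps)
    then have "ennpow (ennreal (\<bar>x $ j\<bar> powr (\<epsilon> - 1))) (P i) * w i x = ennreal (\<bar>x $ j\<bar> powr (\<epsilon> - 1))"
      using x by (simp add: ennpow_ennreal power_weight_def powr_powr ennreal_mult[symmetric] powr_add[symmetric])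
    then show "ennpow (ennreal (norm (power_fun j \<epsilon> x))) (P i) * w i x = ennreal (\<bar>x $ j\<bar> powr (\<epsilon> - 1)) * indicator (cbox 0 1) x"
      using P[OF i] unfolding norm_power_fun by (cases "x \<in> cbox 0 1") auto
  qed
  also have "\<dots> = ennreal (1 / \<epsilon>)"
    using \<epsilon> by (subst nn_integral_unit_cube) auto
  finally show ?thesis
    unfolding weighted_norm_def using \<epsilon> by (simp add: ennpow_ennreal)
qed

text \<open>
The cube \<open>?Q\<close> inside the unit cube has side \<open>t = x $ j\<close>, begins at the hyperplane \<open>x $ j = 0\<close> and contains
\<open>x\<close> as the end point of its \<open>j\<close>-th side; in the other coordinates it is shifted so as to stay inside the unit cube.
\<close>

lemma multi_maximal_power_fun_ge:
  assumes x: "x \<in> cbox 0 1" "x $ j \<noteq> 0"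
  shows "ennreal ((\<bar>x $ j\<bar> powr (\<epsilon> - 1) / \<epsilon>) ^ m) \<le> multi_maximal m (\<lambda>_. power_fun j \<epsilon>) x"
proof -
  define t where "t = x $ j"
  have x01: "0 \<le> x $ i" "x $ i \<le> 1" for i using x(1) by (auto simp: mem_box_cart)
  have t: "0 < t" "t \<le> 1" using x01[of j] x(2) by (auto simp: t_def)
  define b :: "real ^ 'n" where "b = (\<chi> i. if i = j then 0 else x $ i * (1 - t))"
  let ?Q = "cbox b (\<chi> i. b $ i + t)"
  have b: "0 \<le> b $ i" "b $ i \<le> x $ i" "x $ i \<le> b $ i + t" "b $ i + t \<le> 1" for i
  proof -
    have "x $ i * (1 - t) \<le> 1 - t" using t x01[of i] by (intro mult_left_le_one_le) auto
    moreover have "x $ i * t \<le> t" using t x01[of i] by (intro mult_left_le_one_le) auto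
    moreover have "x $ i * t \<le> x $ i" using t x01[of i] by (intro mult_left_le) auto
    ultimately show "0 \<le> b $ i" "b $ i \<le> x $ i" "x $ i \<le> b $ i + t" "b $ i + t \<le> 1"
      using t x01[of i] unfolding b_def by (auto simp: t_def algebra_simps)
  qed
  have Q: "?Q \<in> cubes" "x \<in> ?Q"
    using t b by (auto simp: cubes_def mem_box_cart)
  have Q_sub: "?Q \<subseteq> cbox 0 1"
  proof
    fix y assume "y \<in> ?Q"
    then have y: "b $ i \<le> y $ i" "y $ i \<le> b $ i + t" for i by (auto simp: mem_box_cart)
    show "y \<in> cbox 0 1"
      using order_trans[OF b(1) y(1)] order_trans[OF y(2) b(4)] by (simp add: mem_box_cart)
  qed
  have "average ?Q (\<lambda>y. ennreal (norm (power_fun j \<epsilon> y))) = average ?Q (\<lambda>y. ennreal (\<bar>y $ j\<bar> powr (\<epsilon> - 1)))"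
    unfolding average_def norm_power_fun
    by (intro arg_cong2[where f = "(/)"] refl nn_integral_cong) (use Q_sub in \<open>auto simp: indicator_def\<close>)
  also have "\<dots> = (\<integral>\<^sup>+s\<in>{b $ j..b $ j + t}. ennreal (\<bar>s\<bar> powr (\<epsilon> - 1)) \<partial>lborel) / ennreal t"
    by (rule average_cube_coordinate[OF _ t(1)]) measurable
  also have "(\<integral>\<^sup>+s\<in>{b $ j..b $ j + t}. ennreal (\<bar>s\<bar> powr (\<epsilon> - 1)) \<partial>lborel) = (\<integral>\<^sup>+s\<in>{0..t}. ennreal (s powr (\<epsilon> - 1)) \<partial>lborel)"
    by (intro nn_integral_cong) (auto simp: indicator_def b_def)
  also have "\<dots> = ennreal (t powr \<epsilon> / \<epsilon>)"
    using \<epsilon> t by (subst nn_integral_power) auto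
  also have "ennreal (t powr \<epsilon> / \<epsilon>) / ennreal t = ennreal (t powr (\<epsilon> - 1) / \<epsilon>)"
    using t \<epsilon> by (simp add: divide_ennreal powr_diff)
  finally have avg: "average ?Q (\<lambda>y. ennreal (norm (power_fun j \<epsilon> y))) = ennreal (t powr (\<epsilon> - 1) / \<epsilon>)" .
  have "ennreal ((t powr (\<epsilon> - 1) / \<epsilon>) ^ m) = (\<Prod>i = 1..m. average ?Q (\<lambda>y. ennreal (norm (power_fun j \<epsilon> y))))"
    unfolding avg using \<epsilon> by (simp add: ennreal_power)
  also have "\<dots> \<le> multi_maximal m (\<lambda>_. power_fun j \<epsilon>) x"
    unfolding multi_maximal_def using Q by (intro SUP_upper) auto
  finally show ?thesis using t by (simp add: t_def)
qed

lemma weighted_norm_multi_maximal_ge: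
  "ennreal ((1 / \<epsilon>) powr (real m + 1 / p)) \<le> weighted_norm p (product_weight m p P w) (multi_maximal m (\<lambda>_. power_fun j \<epsilon>))"
proof -
  have "ennreal ((1 / \<epsilon>) powr (real m * p + 1)) = ennreal ((1 / \<epsilon>) powr (real m * p)) * ennreal (1 / \<epsilon>)"
  proof -
    have "(1 / \<epsilon>) powr (real m * p + 1) = (1 / \<epsilon>) powr (real m * p) * (1 / \<epsilon>)"
      using \<epsilon> by (simp add: powr_add)
    then show ?thesis using \<epsilon> by (simp only: ennreal_mult powr_ge_zero divide_nonneg_pos zero_le_one)
  qed
  also have "\<dots> = ennreal ((1 / \<epsilon>) powr (real m * p)) *
      (\<integral>\<^sup>+x\<in>cbox 0 1. ennreal (\<bar>(x :: real ^ 'n) $ j\<bar> powr (\<epsilon> - 1)) \<partial>lebesgue)"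
    using \<epsilon> by (subst nn_integral_unit_cube) auto
  also have "\<dots> = (\<integral>\<^sup>+x. ennreal ((1 / \<epsilon>) powr (real m * p)) * (ennreal (\<bar>(x :: real ^ 'n) $ j\<bar> powr (\<epsilon> - 1)) * indicator (cbox 0 1) x) \<partial>lebesgue)"
    by (rule nn_integral_cmult[symmetric]) (intro measurable_completion, measurable)
  also have "\<dots> \<le> (\<integral>\<^sup>+x. ennpow (multi_maximal m (\<lambda>_. power_fun j \<epsilon>) x) p * product_weight m p P w x \<partial>lebesgue)"
  proof (rule nn_integral_mono_AE, rule eventually_mono[OF AE_coordinate_neq[of j 0]])
    fix x :: "real ^ 'n" assume x: "x $ j \<noteq> 0"
    show "ennreal ((1 / \<epsilon>) powr (real m * p)) * (ennreal (\<bar>x $ j\<bar> powr (\<epsilon> - 1)) * indicator (cbox 0 1) x) \<le>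
        ennpow (multi_maximal m (\<lambda>_. power_fun j \<epsilon>) x) p * product_weight m p P w x"
    proof (cases "x \<in> cbox 0 1")
      case True
      have s: "0 < \<bar>x $ j\<bar>" using x by simp
      have "(\<epsilon> - 1) * (real m * p) + (1 - \<epsilon>) * \<gamma> = \<epsilon> - 1" by (simp add: algebra_simps)
      then have "(1 / \<epsilon>) powr (real m * p) * \<bar>x $ j\<bar> powr (\<epsilon> - 1) =
          (1 / \<epsilon>) powr (real m * p) * (\<bar>x $ j\<bar> powr ((\<epsilon> - 1) * (real m * p)) * \<bar>x $ j\<bar> powr ((1 - \<epsilon>) * \<gamma>))"
        by (simp only: powr_add[symmetric])
      also have "\<dots> = ((\<bar>x $ j\<bar> powr (\<epsilon> - 1) / \<epsilon>) ^ m) powr p * \<bar>x $ j\<bar> powr ((1 - \<epsilon>) * \<gamma>)"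
        using \<epsilon> s by (simp add: powr_realpow[symmetric] powr_powr powr_divide mult.assoc)
      finally have "ennreal ((1 / \<epsilon>) powr (real m * p)) * ennreal (\<bar>x $ j\<bar> powr (\<epsilon> - 1)) =
          ennpow (ennreal ((\<bar>x $ j\<bar> powr (\<epsilon> - 1) / \<epsilon>) ^ m)) p * product_weight m p P w x"
        using \<epsilon> s by (simp add: product_power_weight x ennpow_ennreal ennreal_mult[symmetric])
      also have "\<dots> \<le> ennpow (multi_maximal m (\<lambda>_. power_fun j \<epsilon>) x) p * product_weight m p P w x"
        using p_pos by (intro mult_right_mono ennpow_mono multi_maximal_power_fun_ge True x) auto
      finally show ?thesis using True by simp
    qed simp
  qed
  finally have "ennpow (ennreal ((1 / \<epsilon>) powr (real m * p + 1))) (1 / p) \<le>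
      weighted_norm p (product_weight m p P w) (multi_maximal m (\<lambda>_. power_fun j \<epsilon>))"
    unfolding weighted_norm_def using p_pos by (intro ennpow_mono) auto
  moreover have "(real m * p + 1) * (1 / p) = real m + 1 / p" using p_pos by (simp add: field_simps)
  ultimately show ?thesis
    using \<epsilon> by (simp add: ennpow_ennreal powr_powr)
qed

lemma power_weight_AP: "w \<in> AP_weights m p P"
  using weight_power_weight AP_const_power_weight_le
  by (auto simp: AP_weights_def intro: le_less_trans)

end

section \<open>The lower bound for admissible exponents\<close>

lemma exponent_le_if_powr_bound:
  fixes s r C :: real
  assumes "\<And>X. 1 \<le> X \<Longrightarrow> X powr s \<le> C * X powr r"
  shows "s \<le> r"
proof (rule ccontr)
  assume "\<not> s \<le> r"
  then have d: "0 < s - r" by simp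
  \<comment> \<open>If \<open>s > r\<close>, this \<open>X\<close> makes \<open>X\<close> to the power \<open>s - r\<close> larger than \<open>C\<close>.\<close>
  define X where "X = (max 1 (C + 1)) powr (1 / (s - r))"
  have X: "1 \<le> X" unfolding X_def using d by (intro ge_one_powr_ge_zero) auto
  have "X powr (s - r) * X powr r \<le> C * X powr r"
    using assms[OF X] by (simp add: powr_add[symmetric])
  then have "X powr (s - r) \<le> C" using X by simp
  moreover have "X powr (s - r) = max 1 (C + 1)"
    unfolding X_def using d by (simp add: powr_powr)
  ultimately show False by simp
qed

text \<open>
Insert the power weights and compare powers of \<open>X = 1 / \<epsilon>\<close>: the left side is at least \<open>X\<close> to the power
\<open>m + 1 / p\<close>, the norms on the right contribute \<open>1 / p\<close>, and the constant of the weights contributes at most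
\<open>(m p - 1) \<beta>\<close> if \<open>\<beta> \<ge> 0\<close> and \<open>0\<close> otherwise.
\<close>

theorem admissible_exponent_lower_bound:
  assumes m: "1 \<le> m" and P: "\<And>i. i \<in> {1..m} \<Longrightarrow> 1 < P i" and p: "1 / p = (\<Sum>i = 1..m. 1 / P i)"
    and \<beta>: "\<beta> \<in> admissible_exponents TYPE('n::finite) m p P"
  shows "m / (m * p - 1) \<le> \<beta>"
proof -
  define \<gamma> where "\<gamma> = real m * p - 1"
  \<comment> \<open>Negative \<open>\<beta>\<close> are treated together with \<open>\<beta> = 0\<close>.\<close>
  define \<beta>' where "\<beta>' = max \<beta> 0"
  interpret multilinear_exponents m p P by unfold_locales (fact m P p)+
  have ex: "power_weight_example m p P \<epsilon>" if "0 < \<epsilon>" "\<epsilon> \<le> 1" for \<epsilon>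
    using that by unfold_locales
  have \<gamma>: "0 < \<gamma>" unfolding \<gamma>_def by (rule mp_gt_1)
  obtain C :: real where C: "\<And>w f. w \<in> AP_weights m p P \<Longrightarrow>
      (\<And>i. i \<in> {1..m} \<Longrightarrow> f i \<in> borel_measurable lebesgue) \<Longrightarrow>
      weighted_norm p (product_weight m p P w) (multi_maximal m f)
          \<le> ennreal C * ennpow (AP_const m p P w) \<beta> *
            (\<Prod>i = 1..m. weighted_norm (P i) (w i) (\<lambda>x. ennreal (norm (f i (x :: real ^ 'n)))))"
    using \<beta> unfolding admissible_exponents_def by blast
  define C' where "C' = max C 0"
  define j :: 'n where "j = undefined"
  define K where "K = max ((1 / (\<gamma> + 1)) powr \<beta>) (4 powr (\<gamma> * \<beta>'))"
  have AP_pow: "ennpow (AP_const m p P (power_weight j \<epsilon> P)) \<beta> \<le> ennreal (K * (1 / \<epsilon>) powr (\<gamma> * \<beta>'))"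
    if \<epsilon>: "0 < \<epsilon>" "\<epsilon> \<le> 1" for \<epsilon>
  proof (cases "0 \<le> \<beta>")
    case True
    have "ennpow (AP_const m p P (power_weight j \<epsilon> P)) \<beta> \<le> ennpow (ennreal ((4 / \<epsilon>) powr \<gamma>)) \<beta>"
      unfolding \<gamma>_def using True by (intro ennpow_mono power_weight_example.AP_const_power_weight_le[OF ex[OF \<epsilon>]]) auto
    also have "\<dots> = ennreal (4 powr (\<gamma> * \<beta>') * (1 / \<epsilon>) powr (\<gamma> * \<beta>'))"
      using \<epsilon> True by (simp add: ennpow_ennreal powr_powr \<beta>'_def powr_mult[symmetric])
    also have "\<dots> \<le> ennreal (K * (1 / \<epsilon>) powr (\<gamma> * \<beta>'))"
      by (intro ennreal_leI mult_right_mono) (auto simp: K_def)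
    finally show ?thesis .
  next
    case False
    have "ennpow (AP_const m p P (power_weight j \<epsilon> P)) \<beta> \<le> ennpow (ennreal (1 / (\<gamma> + 1))) \<beta>"
      using False \<gamma> power_weight_example.AP_const_power_weight_ge[OF ex[OF \<epsilon>], of j, folded \<gamma>_def] by (intro ennpow_antimono) auto
    also have "\<dots> = ennreal ((1 / (\<gamma> + 1)) powr \<beta> * (1 / \<epsilon>) powr (\<gamma> * \<beta>'))"
      using False \<gamma> \<epsilon> by (simp add: ennpow_ennreal \<beta>'_def)
    also have "\<dots> \<le> ennreal (K * (1 / \<epsilon>) powr (\<gamma> * \<beta>'))"
      by (intro ennreal_leI mult_right_mono) (auto simp: K_def)
    finally show ?thesis .
  qed
  have "X powr real m \<le> C' * K * X powr (\<gamma> * \<beta>')" if X: "1 \<le> X" for X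
  proof -
    define \<epsilon> where "\<epsilon> = 1 / X"
    have \<epsilon>: "0 < \<epsilon>" "\<epsilon> \<le> 1" and X_eq: "X = 1 / \<epsilon>" using X by (auto simp: \<epsilon>_def)
    let ?w = "power_weight j \<epsilon> P" and ?f = "\<lambda>_::nat. power_fun j \<epsilon>"
    have "power_fun j \<epsilon> \<in> borel_measurable lebesgue"
      unfolding power_fun_def by (intro measurable_completion) measurable
    then have "weighted_norm p (product_weight m p P ?w) (multi_maximal m ?f)
        \<le> ennreal C * ennpow (AP_const m p P ?w) \<beta> *
            (\<Prod>i = 1..m. weighted_norm (P i) (?w i) (\<lambda>x. ennreal (norm (?f i x))))"
      by (intro C power_weight_example.power_weight_AP[OF ex[OF \<epsilon>]])
    also have "(\<Prod>i = 1..m. weighted_norm (P i) (?w i) (\<lambda>x. ennreal (norm (?f i x)))) = (\<Prod>i = 1..m. ennreal (X powr (1 / P i)))"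
      unfolding X_eq by (intro prod.cong refl power_weight_example.weighted_norm_power_fun[OF ex[OF \<epsilon>]])
    also have "\<dots> = ennreal (X powr (1 / p))"
      unfolding p using X by (simp add: prod_ennreal powr_sum)
    also have "ennreal C * ennpow (AP_const m p P ?w) \<beta> * ennreal (X powr (1 / p)) \<le>
        ennreal C' * ennreal (K * X powr (\<gamma> * \<beta>')) * ennreal (X powr (1 / p))"
      unfolding X_eq using AP_pow[OF \<epsilon>]
      by (intro mult_right_mono mult_mono ennreal_leI) (auto simp: C'_def)
    also have "\<dots> = ennreal (C' * K * X powr (\<gamma> * \<beta>') * X powr (1 / p))"
      by (simp add: ennreal_mult C'_def K_def mult.assoc le_max_iff_disj)
    finally have "ennreal (X powr (real m + 1 / p)) \<le> ennreal (C' * K * X powr (\<gamma> * \<beta>') * X powr (1 / p))"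
      using power_weight_example.weighted_norm_multi_maximal_ge[OF ex[OF \<epsilon>], of j] unfolding X_eq by (rule order_trans[rotated])
    then have "X powr real m * X powr (1 / p) \<le> C' * K * X powr (\<gamma> * \<beta>') * X powr (1 / p)"
      by (subst (asm) ennreal_le_iff) (auto simp: C'_def K_def powr_add le_max_iff_disj)
    then show ?thesis using X by simp
  qed
  then have "real m \<le> \<gamma> * \<beta>'" by (rule exponent_le_if_powr_bound)
  then have "real m / \<gamma> \<le> \<beta>'" using \<gamma> by (simp add: pos_divide_le_eq mult.commute)
  moreover have "0 < real m / \<gamma>" using m \<gamma> by simp
  ultimately show ?thesis unfolding \<gamma>_def \<beta>'_def by auto
qed

section \<open>The best exponent\<close>

theorem theorem1p2:
  fixes m :: nat and p :: real and P :: "nat \<Rightarrow> real"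
  assumes "m \<ge> 1"
    and "\<And>i. i \<in> {1..m} \<Longrightarrow> 1 < P i"
    and "1 / p = (\<Sum>i = 1..m. 1 / P i)"
  shows "(ereal (m / (m * p - 1)) \<le> best_exponent TYPE('n::finite) m p P \<and>
          best_exponent TYPE('n) m p P \<le> ereal (1 / p * (1 + (\<Sum>i = 1..m. 1 / (P i - 1)))) \<and>
          1 / p * (1 + (\<Sum>i = 1..m. 1 / (P i - 1))) \<in> admissible_exponents TYPE('n) m p P) \<and>
         (\<forall>r > 1. (\<forall>i \<in> {1..m}. P i = r) \<longrightarrow>
            best_exponent TYPE('n) m p P = ereal (m / (r - 1)) \<and>
            m / (r - 1) \<in> admissible_exponents TYPE('n) m p P)"
proof (intro conjI allI impI)
  have lower: "ereal (m / (m * p - 1)) \<le> best_exponent TYPE('n) m p P"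
    unfolding best_exponent_def
    using admissible_exponent_lower_bound[OF assms] by (intro INF_greatest) auto
  then show "ereal (m / (m * p - 1)) \<le> best_exponent TYPE('n) m p P" .
  show mixed: "1 / p * (1 + (\<Sum>i = 1..m. 1 / (P i - 1))) \<in> admissible_exponents TYPE('n) m p P"
    by (rule mixed_exponent_admissible[OF assms])
  then show "best_exponent TYPE('n) m p P \<le> ereal (1 / p * (1 + (\<Sum>i = 1..m. 1 / (P i - 1))))"
    unfolding best_exponent_def by (rule INF_lower)
  fix r :: real assume r: "1 < r" and Pr: "\<forall>i\<in>{1..m}. P i = r"
  show diag: "m / (r - 1) \<in> admissible_exponents TYPE('n) m p P"
    using Pr r by (intro diagonal_exponent_admissible assms) auto
  have "1 / p = real m * (1 / r)" unfolding assms(3) using Pr by simp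
  moreover have "0 < p"
    by (rule multilinear_exponents.p_pos, unfold_locales) (use assms in auto)
  ultimately have "m * p = r" using assms(1) r by (simp add: field_simps)
  with lower have "ereal (m / (r - 1)) \<le> best_exponent TYPE('n) m p P" by simp
  moreover have "best_exponent TYPE('n) m p P \<le> ereal (m / (r - 1))"
    unfolding best_exponent_def using diag by (rule INF_lower)
  ultimately show "best_exponent TYPE('n) m p P = ereal (m / (r - 1))" by (rule antisym[rotated])
qed

end
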